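(* Let $q$ be a power of $2$ and let $H=\mathbb{F}_{q^2}(x,y)$ be the Hermitian function field over $\mathbb{F}_{q^2}$, defined by $y^q+y=x^{q+1}$. Let $a\in\mathbb{F}_{q^2}$ be a primitive $(q^2-1)$-th root of unity and let $c=a+a^{q}$ (so $c^q+c=0$). Let $\sigma$ be the $\mathbb{F}_{q^2}$-automorphism of $H$ given by $\sigma(x)=\frac{ax}{a^{q+1}y+c}$, $\sigma(y)=\frac{1}{a^{q+1}y+c}$ (it has order $q+1$). Let $m$ be a positive divisor of $q+1$ and let $\mathcal G=\langle\sigma^{\frac{q+1}{m}}\rangle$. Then $$g(H^{\mathcal G})=\frac{(q-1)(q+1-m)}{2m}.$$
   Context: $H^{\mathcal G}$ denotes the subfield of $H$ fixed by every element of $\mathcal G$, regarded as a function field over $\mathbb{F}_{q^2}$. *)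

theory Defs
  imports Complex_Main "HOL-Computational_Algebra.Polynomial" "HOL-Algebra.Generated_Groups"
begin

text \<open>
  Throughout, the constant field is a type \<open>'k\<close>, the ambient field is a type \<open>'h\<close>, and the
  constants are embedded by a field homomorphism \<open>\<iota> :: 'k \<Rightarrow> 'h\<close>.  Intermediate fields
  (such as fixed fields) are subsets of \<open>'h\<close>.
\<close>

definition field_hom :: "('a::field \<Rightarrow> 'b::field) \<Rightarrow> bool" where
  "field_hom f \<longleftrightarrow> f 1 = 1 \<and> (\<forall>a b. f (a + b) = f a + f b) \<and> (\<forall>a b. f (a * b) = f a * f b)"

definition is_subring :: "'h::field set \<Rightarrow> bool" where
  "is_subring S \<longleftrightarrow> 1 \<in> S \<and> (\<forall>a\<in>S. \<forall>b\<in>S. a - b \<in> S \<and> a * b \<in> S)"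

definition is_subfield :: "'h::field set \<Rightarrow> bool" where
  "is_subfield S \<longleftrightarrow> is_subring S \<and> (\<forall>a\<in>S. inverse a \<in> S)"

definition generated_field :: "'h::field set \<Rightarrow> 'h set" where
  "generated_field X = \<Inter> {S. is_subfield S \<and> X \<subseteq> S}"

definition transcendental_over :: "('k::field \<Rightarrow> 'h::field) \<Rightarrow> 'h \<Rightarrow> bool" where
  "transcendental_over \<iota> x \<longleftrightarrow> (\<forall>p. poly (map_poly \<iota> p) x = 0 \<longrightarrow> p = 0)"

definition primitive_root_of_unity :: "nat \<Rightarrow> 'a::field \<Rightarrow> bool" where
  "primitive_root_of_unity n a \<longleftrightarrow> 0 < n \<and> a ^ n = 1 \<and> (\<forall>j. 0 < j \<and> j < n \<longrightarrow> a ^ j \<noteq> 1)"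

text \<open>
  The dimension of the quotient \<open>V / W\<close> of \<open>'k\<close>-subspaces of \<open>'h\<close>.  The set \<open>B\<close> consists of
  representatives of a basis of \<open>V / W\<close>: every class has exactly one coordinate vector
  with respect to \<open>B\<close> (the coordinate functions are normalised to vanish outside \<open>B\<close>).
\<close>

definition quotient_dim :: "('k::field \<Rightarrow> 'h::field) \<Rightarrow> 'h set \<Rightarrow> 'h set \<Rightarrow> nat" where
  "quotient_dim \<iota> V W =
     (THE n. \<exists>B. B \<subseteq> V \<and> finite B \<and> card B = n \<and>
        (\<forall>v\<in>V. \<exists>!f. (\<forall>b. b \<notin> B \<longrightarrow> f b = 0) \<and> v - (\<Sum>b\<in>B. \<iota> (f b) * b) \<in> W))"

definition valuation_ring :: "('k::field \<Rightarrow> 'h::field) \<Rightarrow> 'h set \<Rightarrow> 'h set \<Rightarrow> bool" where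
  "valuation_ring \<iota> F R \<longleftrightarrow>
     is_subring R \<and> range \<iota> \<subset> R \<and> R \<subset> F \<and> (\<forall>z\<in>F. z \<noteq> 0 \<longrightarrow> z \<in> R \<or> inverse z \<in> R)"

definition ideal_of :: "'h::field set \<Rightarrow> 'h set \<Rightarrow> bool" where
  "ideal_of R I \<longleftrightarrow>
     I \<subseteq> R \<and> 0 \<in> I \<and> (\<forall>a\<in>I. \<forall>b\<in>I. a + b \<in> I) \<and> (\<forall>r\<in>R. \<forall>a\<in>I. r * a \<in> I)"

definition maximal_ideal_of :: "'h::field set \<Rightarrow> 'h set \<Rightarrow> bool" where
  "maximal_ideal_of R I \<longleftrightarrow>
     ideal_of R I \<and> I \<noteq> R \<and> (\<forall>J. ideal_of R J \<and> I \<subseteq> J \<longrightarrow> J = I \<or> J = R)"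

definition is_place :: "('k::field \<Rightarrow> 'h::field) \<Rightarrow> 'h set \<Rightarrow> 'h set \<Rightarrow> bool" where
  "is_place \<iota> F P \<longleftrightarrow> (\<exists>R. valuation_ring \<iota> F R \<and> maximal_ideal_of R P)"

text \<open>
  The valuation ring of a place, recovered from the place.  Zero needs separate treatment
  because \<open>inverse 0 = 0\<close>.
\<close>

definition place_ring :: "'h::field set \<Rightarrow> 'h set \<Rightarrow> 'h set" where
  "place_ring F P = {z \<in> F. z = 0 \<or> inverse z \<notin> P}"

definition place_degree :: "('k::field \<Rightarrow> 'h::field) \<Rightarrow> 'h set \<Rightarrow> 'h set \<Rightarrow> nat" where
  "place_degree \<iota> F P = quotient_dim \<iota> (place_ring F P) P"

text \<open>
  The discrete valuation of a place: \<open>z = t\<^sup>n u\<close> with \<open>t\<close> a prime element and \<open>u\<close> a unit.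
  It is only meaningful for \<open>z \<noteq> 0\<close>; the value \<open>\<infinity>\<close> at \<open>0\<close> is never referred to.
\<close>

definition place_val :: "'h::field set \<Rightarrow> 'h set \<Rightarrow> 'h \<Rightarrow> int" where
  "place_val F P z =
     (THE n. \<exists>t u. t \<in> P \<and> P = (*) t ` place_ring F P \<and>
        u \<in> place_ring F P \<and> u \<notin> P \<and> z = t powi n * u)"

definition is_divisor :: "('k::field \<Rightarrow> 'h::field) \<Rightarrow> 'h set \<Rightarrow> ('h set \<Rightarrow> int) \<Rightarrow> bool" where
  "is_divisor \<iota> F A \<longleftrightarrow> finite {P. A P \<noteq> 0} \<and> (\<forall>P. A P \<noteq> 0 \<longrightarrow> is_place \<iota> F P)"

definition divisor_degree :: "('k::field \<Rightarrow> 'h::field) \<Rightarrow> 'h set \<Rightarrow> ('h set \<Rightarrow> int) \<Rightarrow> int" where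
  "divisor_degree \<iota> F A = (\<Sum>P | A P \<noteq> 0. A P * int (place_degree \<iota> F P))"

definition riemann_roch_space :: "('k::field \<Rightarrow> 'h::field) \<Rightarrow> 'h set \<Rightarrow> ('h set \<Rightarrow> int) \<Rightarrow> 'h set" where
  "riemann_roch_space \<iota> F A =
     {z \<in> F. z = 0 \<or> (\<forall>P. is_place \<iota> F P \<longrightarrow> place_val F P z \<ge> - A P)}"

definition divisor_dim :: "('k::field \<Rightarrow> 'h::field) \<Rightarrow> 'h set \<Rightarrow> ('h set \<Rightarrow> int) \<Rightarrow> nat" where
  "divisor_dim \<iota> F A = vector_space.dim (\<lambda>c v. \<iota> c * v) (riemann_roch_space \<iota> F A)"

definition genus :: "('k::field \<Rightarrow> 'h::field) \<Rightarrow> 'h set \<Rightarrow> int" where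
  "genus \<iota> F =
     (GREATEST g. \<exists>A. is_divisor \<iota> F A \<and> g = divisor_degree \<iota> F A - int (divisor_dim \<iota> F A) + 1)"

definition constant_automorphism :: "('k::field \<Rightarrow> 'h::field) \<Rightarrow> ('h \<Rightarrow> 'h) \<Rightarrow> bool" where
  "constant_automorphism \<iota> \<sigma> \<longleftrightarrow> field_hom \<sigma> \<and> bij \<sigma> \<and> (\<forall>c. \<sigma> (\<iota> c) = \<iota> c)"

definition aut_group :: "('k::field \<Rightarrow> 'h::field) \<Rightarrow> ('h \<Rightarrow> 'h) monoid" where
  "aut_group \<iota> = \<lparr>carrier = {\<sigma>. constant_automorphism \<iota> \<sigma>}, mult = (\<circ>), one = id\<rparr>"

definition fixed_field :: "('h \<Rightarrow> 'h) set \<Rightarrow> 'h set" where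
  "fixed_field G = {z. \<forall>\<tau>\<in>G. \<tau> z = z}"

text \<open>
  The whole type \<open>'h\<close> is the Hermitian function field with generators \<open>x\<close> and \<open>y\<close>.  As the
  polynomial \<open>T\<^sup>q + T - x\<^bsup>q+1\<^esup>\<close> is irreducible over \<open>'k(x)\<close>, the conditions determine
  \<open>'h\<close> up to isomorphism.
\<close>

definition hermitian_function_field :: "nat \<Rightarrow> ('k::field \<Rightarrow> 'h::field) \<Rightarrow> 'h \<Rightarrow> 'h \<Rightarrow> bool" where
  "hermitian_function_field q \<iota> x y \<longleftrightarrow>
     card (UNIV :: 'k set) = q ^ 2 \<and> field_hom \<iota> \<and> transcendental_over \<iota> x \<and>
     y ^ q + y = x ^ (q + 1) \<and> generated_field (range \<iota> \<union> {x, y}) = UNIV"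

end

(*
The automorphism sigma is induced by a homology of the projective plane: the linear forms x and
a^q y + 1 are eigenforms for the eigenvalue a, and a y + 1 is one for a^q.  In coordinates (u, v)
in which sigma fixes the point at infinity, the curve is again v^q + v = u^(q+1), and
sigma (u, v) = (a^(q-1) u, v).  Hence the fixed field is k(t, v) with t = u^m and
v^q + v = t^n, n = (q+1)/m.

For the genus, k[t, v] has the basis t^i v^j (j < q), whose elements have distinct pole orders
q i + n j at the unique place at infinity, which has degree 1.  Counting the pole orders up to N gives
N + 1 - (n-1)(q-1)/2.  Since k is finite and v = v^q + t^n, every element of k[t, v] is a square
modulo f = t^(2^M) + t, so k[t, v]/(f) is reduced.  Consequently f is a uniformizer at each
finite place that contains it, the degrees of these places sum up to at most q 2^M, and k[t, v] is
integrally closed.  As every divisor is dominated by a multiple of the zeros of some such f plus a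
multiple of the infinite place, Riemann's inequality and its sharpness follow by counting.
*)
theory Submission
  imports Defs
begin

section \<open>Valuation rings\<close>

text \<open>\<open>genus\<close> is a greatest value of deg A - dim L(A) + 1, so it has to be
  attained and also bounded over all divisors. Moreover \<open>place_val\<close> and
  \<open>quotient_dim\<close> are definite descriptions: they mean something only once every place
  is shown to be discrete with finite residue field. Finiteness of k serves both ends: |V| = Q^dim
  turns dimensions into cardinalities, and pigeonhole arguments in k[t, v]/(r) take the place of
  prime factorisation. The polynomial t^(2^M) + t is the product of t - b over the field with 2^M
  elements. It is squarefree, and every nonzero element of k[t, v] divides a power of one of these
  polynomials. Since v^q + v has derivative 1 in v, the covering of the affine t-line is unramified;
  v = v^q + t^n, read as "v is a square up to a power of t", is the elementary form of this fact. At
  infinity, coprimality of n and q is what separates the pole orders. Places are produced by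
  Chevalley's extension theorem: from k[1/t] for the infinite place, and from k[t, v][1/r] to show
  that functions regular at all finite places lie in k[t, v].\<close>

lemma field_hom_simps:
  assumes "field_hom f"
  shows "f 1 = 1" "f (a + b) = f a + f b" "f (a * b) = f a * f b" "f 0 = 0"
    "f (- a) = - f a" "f (a - b) = f a - f b" "f (a ^ n) = f a ^ n"
    "f (inverse a) = inverse (f a)" "f (a / b) = f a / f b" "f a = f b \<longleftrightarrow> a = b"
    "f a = 0 \<longleftrightarrow> a = 0" "f (sum g A) = (\<Sum>x\<in>A. f (g x))"
proof -
  have 1: "f 1 = 1" and add: "\<And>a b. f (a + b) = f a + f b" and mult: "\<And>a b. f (a * b) = f a * f b"
    using assms by (auto simp: field_hom_def)
  have 0: "f 0 = 0" using add[of 0 0] by (metis add.right_neutral add_left_cancel)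
  have neg: "f (- a) = - f a" for a using add[of a "- a"] 0 by (simp add: eq_neg_iff_add_eq_0 add.commute)
  have diff: "f (a - b) = f a - f b" for a b using add[of a "- b"] neg by simp
  have inv: "f (inverse a) = inverse (f a)" for a
  proof (cases "a = 0")
    case False
    then have "f a * f (inverse a) = 1" using mult[of a "inverse a"] 1 by simp
    then show ?thesis by (metis inverse_unique)
  qed (simp add: 0)
  have inj0: "f a = 0 \<longleftrightarrow> a = 0" for a
    using mult[of a "inverse a"] 1 0 by (metis mult_zero_left right_inverse zero_neq_one)
  show "f 1 = 1" "f (a + b) = f a + f b" "f (a * b) = f a * f b" "f 0 = 0"
    "f (- a) = - f a" "f (a - b) = f a - f b" "f (inverse a) = inverse (f a)"
    "f a = 0 \<longleftrightarrow> a = 0"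
    using 1 add mult 0 neg diff inv inj0 by auto
  show "f (a / b) = f a / f b" by (simp add: divide_inverse mult inv)
  show "f a = f b \<longleftrightarrow> a = b" using inj0[of "a - b"] diff[of a b] by simp
  show "f (a ^ n) = f a ^ n" by (induction n) (auto simp: 1 mult)
  show "f (sum g A) = (\<Sum>x\<in>A. f (g x))"
    by (induction A rule: infinite_finite_induct) (auto simp: 0 add)
qed

lemma subring_closed:
  assumes "is_subring S"
  shows subring_1: "1 \<in> S" and subring_0: "0 \<in> S"
    and subring_diff: "a \<in> S \<Longrightarrow> b \<in> S \<Longrightarrow> a - b \<in> S"
    and subring_mult: "a \<in> S \<Longrightarrow> b \<in> S \<Longrightarrow> a * b \<in> S"
    and subring_uminus: "a \<in> S \<Longrightarrow> - a \<in> S"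
    and subring_add: "a \<in> S \<Longrightarrow> b \<in> S \<Longrightarrow> a + b \<in> S"
    and subring_power: "a \<in> S \<Longrightarrow> a ^ n \<in> S"
    and subring_sum: "(\<And>x. x \<in> A \<Longrightarrow> g x \<in> S) \<Longrightarrow> sum g A \<in> S"
    and subring_prod: "(\<And>x. x \<in> A \<Longrightarrow> g x \<in> S) \<Longrightarrow> prod g A \<in> S"
proof -
  show 1: "1 \<in> S" and diff: "\<And>a b. a \<in> S \<Longrightarrow> b \<in> S \<Longrightarrow> a - b \<in> S"
    and mult: "\<And>a b. a \<in> S \<Longrightarrow> b \<in> S \<Longrightarrow> a * b \<in> S"
    using assms by (auto simp: is_subring_def)
  show 0: "0 \<in> S" using diff[OF 1 1] by simp
  show neg: "\<And>a. a \<in> S \<Longrightarrow> - a \<in> S" using diff[OF 0] by force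
  show add: "\<And>a b. a \<in> S \<Longrightarrow> b \<in> S \<Longrightarrow> a + b \<in> S" using diff neg by force
  show "a \<in> S \<Longrightarrow> a ^ n \<in> S" by (induction n) (auto intro: 1 mult)
  show "(\<And>x. x \<in> A \<Longrightarrow> g x \<in> S) \<Longrightarrow> sum g A \<in> S"
    by (induction A rule: infinite_finite_induct) (auto intro: 0 add)
  show "(\<And>x. x \<in> A \<Longrightarrow> g x \<in> S) \<Longrightarrow> prod g A \<in> S"
    by (induction A rule: infinite_finite_induct) (auto intro: 1 mult)
qed

lemma subfield_closed:
  assumes "is_subfield S"
  shows subfield_subring: "is_subring S"
    and subfield_inverse: "a \<in> S \<Longrightarrow> inverse a \<in> S"
    and subfield_divide: "a \<in> S \<Longrightarrow> b \<in> S \<Longrightarrow> a / b \<in> S"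
    and subfield_powi: "a \<in> S \<Longrightarrow> a powi i \<in> S"
  using assms subring_closed[of S]
  by (auto simp: is_subfield_def divide_inverse power_int_def)

lemma is_subfield_generated_field: "is_subfield (generated_field X)"
  by (auto simp: generated_field_def is_subfield_def is_subring_def)

lemma generated_field_superset: "X \<subseteq> generated_field X"
  by (auto simp: generated_field_def)

lemma generated_field_minimal: "is_subfield S \<Longrightarrow> X \<subseteq> S \<Longrightarrow> generated_field X \<subseteq> S"
  by (auto simp: generated_field_def)

lemma is_subfield_fractions:
  assumes S: "is_subring S"
  shows "is_subfield {r / s | r s. r \<in> S \<and> s \<in> S \<and> s \<noteq> 0}"
proof -
  define K where "K = {r / s | r s. r \<in> S \<and> s \<in> S \<and> s \<noteq> 0}"
  have KI: "r / s \<in> K" if "r \<in> S" "s \<in> S" "s \<noteq> 0" for r s using that unfolding K_def by blast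
  show ?thesis unfolding K_def[symmetric] is_subfield_def is_subring_def
  proof (intro conjI ballI)
    show "1 \<in> K" using KI[of 1 1] subring_1[OF S] by simp
    fix a assume a: "a \<in> K"
    then obtain r s where rs: "r \<in> S" "s \<in> S" "s \<noteq> 0" "a = r / s" unfolding K_def by blast
    show "inverse a \<in> K"
    proof (cases "r = 0")
      case True then show ?thesis using rs a by simp
    next
      case False then show ?thesis using rs KI[of s r] by simp
    qed
    fix b assume "b \<in> K"
    then obtain r' s' where rs': "r' \<in> S" "s' \<in> S" "s' \<noteq> 0" "b = r' / s'" unfolding K_def by blast
    have "(r * s' - r' * s) / (s * s') \<in> K" "(r * r') / (s * s') \<in> K"
      using rs rs' S by (auto intro!: KI simp: subring_closed)
    moreover have "a - b = (r * s' - r' * s) / (s * s')" "a * b = (r * r') / (s * s')"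
      using rs rs' by (simp_all add: diff_frac_eq)
    ultimately show "a - b \<in> K" "a * b \<in> K" by metis+
  qed
qed

lemma fractions_superset:
  assumes "is_subring S"
  shows "S \<subseteq> {r / s | r s. r \<in> S \<and> s \<in> S \<and> s \<noteq> 0}"
proof
  fix z assume "z \<in> S"
  then show "z \<in> {r / s | r s. r \<in> S \<and> s \<in> S \<and> s \<noteq> 0}"
    using subring_1[OF assms] by (intro CollectI exI[of _ z] exI[of _ 1]) auto
qed

text \<open>The disjunct for zero is necessary because \<open>inverse 0 = 0\<close> lies in R, so 0
  would otherwise count as a unit.\<close>

definition nonunits :: "'h::field set \<Rightarrow> 'h set" where
  "nonunits R = {z \<in> R. z = 0 \<or> inverse z \<notin> R}"

locale valuation =
  fixes \<iota> :: "'k::field \<Rightarrow> 'h::field" and F R :: "'h set"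
  assumes subfield: "is_subfield F" and valuation_ring: "valuation_ring \<iota> F R"
begin

lemma subring: "is_subring R"
  using valuation_ring by (simp add: valuation_ring_def)

lemmas R_1 = subring_1[OF subring] and R_0 = subring_0[OF subring]
  and R_diff = subring_diff[OF subring] and R_mult = subring_mult[OF subring]
  and R_uminus = subring_uminus[OF subring] and R_add = subring_add[OF subring]
  and R_power = subring_power[OF subring] and R_sum = subring_sum[OF subring]

lemma R_F: "R \<subseteq> F" and const_R: "\<iota> a \<in> R"
  using valuation_ring by (auto simp: valuation_ring_def)

lemma total: "z \<in> F \<Longrightarrow> z \<in> R \<or> inverse z \<in> R"
  using valuation_ring R_0 by (cases "z = 0") (auto simp: valuation_ring_def)

lemma nonunits_R: "nonunits R \<subseteq> R" and nonunits_0: "0 \<in> nonunits R"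
  and nonunits_1: "1 \<notin> nonunits R"
  using R_0 R_1 by (auto simp: nonunits_def)

lemma unit_inverse:
  assumes "z \<in> R" "z \<notin> nonunits R"
  shows "inverse z \<in> R" "inverse z \<notin> nonunits R" "z \<noteq> 0"
  using assms by (auto simp: nonunits_def)

lemma nonunits_mult:
  assumes "a \<in> R" "b \<in> nonunits R"
  shows "a * b \<in> nonunits R"
proof (cases "a * b = 0")
  case False
  have "inverse (a * b) \<notin> R"
  proof
    assume "inverse (a * b) \<in> R"
    then have "a * inverse (a * b) \<in> R" using assms(1) R_mult by blast
    moreover have "a * inverse (a * b) = inverse b" using False by (simp add: field_simps)
    ultimately have "inverse b \<in> R" by metis
    then show False using assms False by (auto simp: nonunits_def)
  qed
  then show ?thesis using assms R_mult by (auto simp: nonunits_def)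
qed (use nonunits_0 in auto)

lemma nonunits_mult': "b \<in> nonunits R \<Longrightarrow> a \<in> R \<Longrightarrow> b * a \<in> nonunits R"
  using nonunits_mult by (simp add: mult.commute)

text \<open>In a valuation ring one of a/b and b/a lies in R, so a + b is an element of R times one
  of the two nonunits: a + b = (1 + a/b) b.\<close>

lemma nonunits_add:
  assumes "a \<in> nonunits R" "b \<in> nonunits R"
  shows "a + b \<in> nonunits R"
proof -
  have *: "a + b \<in> nonunits R" if a: "a \<in> nonunits R" and b: "b \<in> nonunits R" "b \<noteq> 0" and "a / b \<in> R" for a b
  proof -
    have "(1 + a / b) * b \<in> nonunits R" using that R_1 R_add by (intro nonunits_mult) auto
    moreover have "(1 + a / b) * b = a + b" using b by (simp add: field_simps)
    ultimately show ?thesis by metis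
  qed
  have "a / b \<in> F" using assms R_F nonunits_R subfield_divide[OF subfield] by (meson subsetD)
  then have "a / b \<in> R \<or> b / a \<in> R" using total[of "a / b"] by (simp add: field_simps)
  then show ?thesis
    using *[of a b] *[of b a] assms by (cases "a = 0"; cases "b = 0") (auto simp: add.commute)
qed

lemma nonunits_uminus: "a \<in> nonunits R \<Longrightarrow> - a \<in> nonunits R"
  using nonunits_mult[of "-1" a] R_1 R_uminus by simp

lemma nonunits_diff: "a \<in> nonunits R \<Longrightarrow> b \<in> nonunits R \<Longrightarrow> a - b \<in> nonunits R"
  using nonunits_add[of a "- b"] nonunits_uminus by simp

lemma nonunits_sum: "(\<And>x. x \<in> A \<Longrightarrow> g x \<in> nonunits R) \<Longrightarrow> sum g A \<in> nonunits R"
  by (induction A rule: infinite_finite_induct) (auto intro: nonunits_add nonunits_0)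

lemma nonunits_prime: "a \<in> R \<Longrightarrow> b \<in> R \<Longrightarrow> a * b \<in> nonunits R \<Longrightarrow> a \<in> nonunits R \<or> b \<in> nonunits R"
  by (auto simp: nonunits_def intro: R_mult)

lemma nonunits_power: "a \<in> R \<Longrightarrow> a ^ n \<in> nonunits R \<Longrightarrow> a \<in> nonunits R"
  by (induction n) (use nonunits_1 nonunits_prime R_power in auto)

lemma power_nonunits: "a \<in> nonunits R \<Longrightarrow> n > 0 \<Longrightarrow> a ^ n \<in> nonunits R"
  by (induction n) (use nonunits_R R_power nonunits_mult' in auto)

lemma unit_mult: "a \<in> R - nonunits R \<Longrightarrow> b \<in> R - nonunits R \<Longrightarrow> a * b \<in> R - nonunits R"
  using nonunits_prime R_mult by auto

lemma unit_power: "a \<in> R - nonunits R \<Longrightarrow> a ^ n \<in> R - nonunits R"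
  by (induction n) (use unit_mult R_1 nonunits_1 in auto)

lemma unit_add_nonunit: "a \<in> R - nonunits R \<Longrightarrow> b \<in> nonunits R \<Longrightarrow> a + b \<in> R - nonunits R"
  using nonunits_diff[of "a + b" b] nonunits_R R_add by auto

lemma not_in_R_inverse: "z \<in> F \<Longrightarrow> z \<notin> R \<Longrightarrow> inverse z \<in> nonunits R"
  using total by (auto simp: nonunits_def)

lemma unit_powi: "a \<in> R - nonunits R \<Longrightarrow> a powi i \<in> R - nonunits R"
  using unit_power unit_inverse by (auto simp: power_int_def)

text \<open>A proper ideal contains no unit, so the nonunits absorb every proper ideal. Places and
  valuation rings thereby become interchangeable.\<close>

lemma maximal_ideal_iff: "maximal_ideal_of R P \<longleftrightarrow> P = nonunits R"
proof -
  have ideal: "ideal_of R (nonunits R)"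
    by (auto simp: ideal_of_def nonunits_0 nonunits_add nonunits_mult intro: subsetD[OF nonunits_R])
  have sub: "J \<subseteq> nonunits R" if J: "ideal_of R J" "J \<noteq> R" for J
  proof
    fix z assume z: "z \<in> J"
    show "z \<in> nonunits R"
    proof (rule ccontr)
      assume u: "z \<notin> nonunits R"
      have "z \<in> R" using z J by (auto simp: ideal_of_def)
      note v = unit_inverse[OF this u]
      have "r * inverse z * z \<in> J" if "r \<in> R" for r using v z J that R_mult by (auto simp: ideal_of_def)
      moreover have "r * inverse z * z = r" for r using v by simp
      ultimately have "R \<subseteq> J" by (metis subsetI)
      then show False using J by (auto simp: ideal_of_def)
    qed
  qed
  have ne: "nonunits R \<noteq> R" using nonunits_1 R_1 by auto
  show ?thesis
  proof
    assume "maximal_ideal_of R P"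
    then show "P = nonunits R" using sub[of P] ideal ne by (auto simp: maximal_ideal_of_def)
  next
    assume "P = nonunits R"
    then show "maximal_ideal_of R P" using sub ideal ne by (auto simp: maximal_ideal_of_def)
  qed
qed

lemma place_ring_nonunits: "place_ring F (nonunits R) = R"
proof -
  have "inverse z \<in> nonunits R \<longleftrightarrow> z \<notin> R" if "z \<in> F" "z \<noteq> 0" for z
    using that not_in_R_inverse by (auto simp: nonunits_def)
  then show ?thesis using R_F R_0 by (auto simp: place_ring_def)
qed

lemma is_place_nonunits: "is_place \<iota> F (nonunits R)"
  using valuation_ring maximal_ideal_iff by (auto simp: is_place_def)

end

lemma placeD:
  assumes "is_subfield F" "is_place \<iota> F P"
  shows "valuation \<iota> F (place_ring F P)" "nonunits (place_ring F P) = P"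
proof -
  from assms(2) obtain R where R: "valuation_ring \<iota> F R" "maximal_ideal_of R P"
    by (auto simp: is_place_def)
  interpret valuation \<iota> F R using assms(1) R(1) by unfold_locales
  have "P = nonunits R" using R(2) maximal_ideal_iff by blast
  then show "valuation \<iota> F (place_ring F P)" "nonunits (place_ring F P) = P"
    using place_ring_nonunits valuation_axioms by auto
qed

section \<open>Chevalley's theorem: valuation rings above a given subring\<close>

lemma is_subring_adjoin:
  assumes S: "is_subring S"
  shows "is_subring {poly p z | p. \<forall>i. coeff p i \<in> S}" (is "is_subring ?A")
proof -
  have "1 \<in> ?A" using S by (intro CollectI exI[of _ 1]) (auto simp: subring_closed coeff_1)
  moreover have "poly p z - poly p' z \<in> ?A" "poly p z * poly p' z \<in> ?A"
    if "\<forall>i. coeff p i \<in> S" "\<forall>i. coeff p' i \<in> S" for p p'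
    using that S
    by (auto intro: exI[of _ "p - p'"] simp: subring_diff)
      (auto intro!: exI[of _ "p * p'"] subring_sum subring_mult simp: coeff_mult)
  ultimately show ?thesis unfolding is_subring_def by blast
qed

lemma adjoin_superset:
  assumes S: "is_subring S"
  shows "S \<subseteq> {poly p z | p. \<forall>i. coeff p i \<in> S}" "z \<in> {poly p z | p. \<forall>i. coeff p i \<in> S}"
proof -
  show "S \<subseteq> {poly p z | p. \<forall>i. coeff p i \<in> S}"
  proof
    fix a assume "a \<in> S"
    then show "a \<in> {poly p z | p. \<forall>i. coeff p i \<in> S}"
      using S by (intro CollectI exI[of _ "[:a:]"]) (auto simp: coeff_pCons subring_0 split: nat.split)
  qed
  show "z \<in> {poly p z | p. \<forall>i. coeff p i \<in> S}"
    using S by (intro CollectI exI[of _ "[:0, 1:]"]) (auto simp: coeff_pCons subring_0 subring_1 split: nat.split)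
qed

text \<open>A relation for \<open>1/z\<close> whose constant term is killed by a unit makes \<open>z\<close> integral, which
  lowers the degree of any relation for \<open>z\<close>.\<close>

lemma inverse_relation_degree_reduction:
  fixes s z :: "'h::field"
  assumes S: "is_subring S" and s: "s \<in> S" "s \<noteq> 0" "inverse s \<notin> S"
    and unit: "\<And>b. b \<in> S \<Longrightarrow> inverse (1 - s * b) \<in> S"
    and z: "z \<noteq> 0"
    and p: "\<forall>i. coeff p i \<in> S" "poly p z = inverse s"
    and r: "\<forall>i. coeff r i \<in> S" "poly r (inverse z) = inverse s"
    and deg: "degree r \<le> degree p"
  shows "\<exists>p'. (\<forall>i. coeff p' i \<in> S) \<and> poly p' z = inverse s \<and> degree p' < degree p"
proof -
  define n m where "n = degree p" and "m = degree r"
  have n0: "n > 0"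
  proof (rule ccontr)
    assume "\<not> n > 0"
    then obtain a where "p = [:a:]" using n_def degree_eq_zeroE[of p] by auto
    then have "inverse s = coeff p 0" using p(2) by simp
    then show False using p(1) s(3) by metis
  qed
  \<comment> \<open>The inverse of d lies in S by \<open>unit\<close>. Multiplying the relation for
    1/z by s and by z^n then expresses z^n through lower powers of z.\<close>
  define d where "d = 1 - s * coeff r 0"
  have d0: "d \<noteq> 0"
  proof
    assume "d = 0"
    then have "coeff r 0 = inverse s" using s(2) by (simp add: d_def field_simps)
    then show False using r(1) s(3) by metis
  qed
  have "poly r (inverse z) = (\<Sum>i\<le>m. coeff r i * inverse z ^ i)"
    by (simp add: poly_altdef m_def)
  also have "{..m} = insert 0 {1..m}" by auto
  finally have "d = s * (\<Sum>i=1..m. coeff r i * inverse z ^ i)"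
    using r(2) s(2) by (simp add: d_def field_simps)
  then have "d * z ^ n = s * (\<Sum>i=1..m. coeff r i * (inverse z ^ i * z ^ n))"
    by (simp add: sum_distrib_right sum_distrib_left mult.assoc)
  also have "(\<Sum>i=1..m. coeff r i * (inverse z ^ i * z ^ n)) = (\<Sum>i=1..m. coeff r i * z ^ (n - i))"
    using deg z by (intro sum.cong) (auto simp: n_def m_def power_diff field_simps)
  finally have zn: "z ^ n = s * inverse d * (\<Sum>i=1..m. coeff r i * z ^ (n - i))"
    using d0 by (simp add: field_simps)
  \<comment> \<open>The leading monomial of p is replaced by that expression; as i starts at 1, only
    exponents below n come in.\<close>
  define a where "a = coeff p n * s * inverse d"
  define p' where "p' = p - monom (coeff p n) n + smult a (\<Sum>i=1..m. monom (coeff r i) (n - i))"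
  have aS: "a \<in> S" unfolding a_def using p(1) s(1) unit[of "coeff r 0"] r(1) S
    by (auto simp: d_def subring_mult)
  have c1: "\<forall>i. coeff p' i \<in> S"
    unfolding p'_def using aS p(1) r(1) S
    by (auto simp: coeff_sum subring_closed intro!: subring_add subring_mult subring_diff subring_sum)
  have c2: "poly p' z = inverse s"
    unfolding p'_def using p(2) zn by (simp add: poly_monom poly_sum a_def)
  have "coeff p' i = 0" if "i \<ge> n" for i
  proof -
    have "coeff p i = coeff (monom (coeff p n) n) i"
      using that coeff_eq_0[of p i] by (cases "i = n") (auto simp: n_def)
    moreover have "coeff (monom (coeff r j) (n - j)) i = 0" if "j \<in> {1..m}" for j
      using that \<open>i \<ge> n\<close> n0 by auto
    ultimately show ?thesis unfolding p'_def by (simp add: coeff_sum)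
  qed
  then have "degree p' < n" using n0
    by (metis bot_nat_0.not_eq_extremum degree_0 leading_coeff_0_iff linorder_not_less)
  then show ?thesis using c1 c2 n_def by blast
qed

text \<open>Zorn's lemma gives a subring R of F that is maximal among those containing A but not
  1/s; maximality makes it a valuation ring. It will have s as a nonunit, so s vanishes at the
  resulting place.\<close>

lemma exists_valuation_ring:
  fixes \<iota> :: "'k::field \<Rightarrow> 'h::field"
  assumes \<iota>: "field_hom \<iota>" and F: "is_subfield F" and A: "is_subring A" "A \<subseteq> F" "range \<iota> \<subseteq> A"
    and s: "s \<in> A" "s \<noteq> 0" "inverse s \<notin> A"
  obtains R where "valuation_ring \<iota> F R" "A \<subseteq> R" "inverse s \<notin> R"
proof -
  define \<S> where "\<S> = {S. is_subring S \<and> A \<subseteq> S \<and> S \<subseteq> F \<and> inverse s \<notin> S}"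
  have "\<exists>M\<in>\<S>. \<forall>X\<in>\<S>. M \<subseteq> X \<longrightarrow> X = M"
  proof (rule subset_Zorn_nonempty)
    show "\<S> \<noteq> {}" using A s by (auto simp: \<S>_def)
  next
    fix C assume C: "C \<noteq> {}" "subset.chain \<S> C"
    have *: "is_subring S \<and> A \<subseteq> S \<and> S \<subseteq> F \<and> inverse s \<notin> S" if "S \<in> C" for S
      using C that by (auto simp: subset.chain_def \<S>_def)
    have "is_subring (\<Union>C)" unfolding is_subring_def
    proof (intro conjI ballI)
      show "1 \<in> \<Union>C" using C * by (auto simp: is_subring_def)
      fix a b assume "a \<in> \<Union>C" "b \<in> \<Union>C"
      then obtain S T where ST: "S \<in> C" "a \<in> S" "T \<in> C" "b \<in> T" by blast
      then have "S \<subseteq> T \<or> T \<subseteq> S" using C by (auto simp: subset.chain_def)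
      then have "\<exists>S\<in>C. a \<in> S \<and> b \<in> S" using ST by blast
      then show "a - b \<in> \<Union>C" "a * b \<in> \<Union>C" using * unfolding is_subring_def by blast+
    qed
    moreover have "A \<subseteq> \<Union>C" using C * by blast
    ultimately show "\<Union>C \<in> \<S>" using * by (auto simp: \<S>_def)
  qed
  then obtain R where R: "R \<in> \<S>" and max: "\<And>X. X \<in> \<S> \<Longrightarrow> R \<subseteq> X \<Longrightarrow> X = R" by blast
  have R': "is_subring R" "A \<subseteq> R" "R \<subseteq> F" "inverse s \<notin> R" using R by (auto simp: \<S>_def)
  have Fs: "is_subring F" using F subfield_subring by blast
  \<comment> \<open>Maximality in usable form: any proper enlargement R[z] inside F must contain
    1/s.\<close>
  have adjoin: "inverse s \<in> {poly p z | p. \<forall>i. coeff p i \<in> R}" if z: "z \<in> F" "z \<notin> R" for z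
  proof (rule ccontr)
    assume n: "inverse s \<notin> {poly p z | p. \<forall>i. coeff p i \<in> R}" (is "_ \<notin> ?X")
    have "?X \<subseteq> F" using z(1) R' Fs
      by (auto simp: poly_altdef intro!: subring_sum subring_mult subring_power)
    then have "?X \<in> \<S>" using n R' is_subring_adjoin[OF R'(1), of z] adjoin_superset(1)[OF R'(1), of z]
      by (auto simp: \<S>_def)
    then have "?X = R" using max adjoin_superset(1)[OF R'(1), of z] by blast
    then show False using adjoin_superset(2)[OF R'(1), of z] z by blast
  qed
  \<comment> \<open>If 1/w were missing for w = 1 - s b, then 1/s would be a polynomial in 1/w, so
    (1/s) w^d would lie in R. But w^d has the form 1 - s b', whence 1/s = (1/s) w^d + b' would lie
    in R too.\<close>
  have unit: "inverse (1 - s * b) \<in> R" if b: "b \<in> R" for b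
  proof (rule ccontr)
    define w where "w = 1 - s * b"
    assume "inverse (1 - s * b) \<notin> R"
    moreover have sR: "s \<in> R" using s R' by auto
    then have wR: "w \<in> R" using b R' by (auto simp: w_def subring_closed)
    ultimately obtain p where p: "\<forall>i. coeff p i \<in> R" "poly p (inverse w) = inverse s"
      using adjoin[of "inverse w"] R' F subfield_inverse[OF F] unfolding w_def by force
    have w0: "w \<noteq> 0"
    proof
      assume "w = 0"
      then have "b = inverse s" using s by (simp add: w_def field_simps)
      then show False using b R' by blast
    qed
    have "inverse s * w ^ degree p = (\<Sum>i\<le>degree p. coeff p i * (inverse w ^ i * w ^ degree p))"
      by (simp add: p(2)[symmetric] poly_altdef sum_distrib_right mult.assoc)
    also have "\<dots> = (\<Sum>i\<le>degree p. coeff p i * w ^ (degree p - i))"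
      using w0 by (intro sum.cong) (auto simp: power_diff field_simps)
    also have "\<dots> \<in> R" using p(1) wR R' by (auto intro!: subring_sum subring_mult subring_power)
    finally have 1: "inverse s * w ^ degree p \<in> R" .
    have "\<exists>b'\<in>R. w ^ k = 1 - s * b'" for k
    proof (induction k)
      case 0 then show ?case using R' by (intro bexI[of _ 0]) (auto simp: subring_closed)
    next
      case (Suc k)
      then obtain b' where "b' \<in> R" "w ^ k = 1 - s * b'" by blast
      moreover from this have "w ^ Suc k = (1 - s * b) * (1 - s * b')" by (simp add: w_def)
      then have "w ^ Suc k = 1 - s * (b + b' - s * b * b')" by (simp add: algebra_simps)
      ultimately have "w ^ Suc k = 1 - s * (b + b' - s * b * b')" "b + b' - s * b * b' \<in> R"
        using b sR R' by (auto simp: subring_closed)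
      then show ?case by blast
    qed
    then obtain b' where "b' \<in> R" "w ^ degree p = 1 - s * b'" by blast
    then have "inverse s = inverse s * w ^ degree p + b'" using s by (simp add: field_simps)
    then show False using 1 \<open>b' \<in> R\<close> R' by (metis subring_add)
  qed
  have "z \<in> R \<or> inverse z \<in> R" if z: "z \<in> F" "z \<noteq> 0" for z
  proof (rule ccontr)
    assume nz: "\<not> (z \<in> R \<or> inverse z \<in> R)"
    define Rel where "Rel w p \<longleftrightarrow> (\<forall>i. coeff p i \<in> R) \<and> poly p w = inverse s" for w p
    have ex: "\<exists>p. Rel z p" "\<exists>p. Rel (inverse z) p"
      using adjoin[of z] adjoin[of "inverse z"] z nz subfield_inverse[OF F] by (force simp: Rel_def)+
    obtain p where p: "Rel z p" "\<And>p'. Rel z p' \<Longrightarrow> degree p \<le> degree p'"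
      using ex(1) ex_has_least_nat[of "Rel z" _ degree] by blast
    obtain r where r: "Rel (inverse z) r" "\<And>p'. Rel (inverse z) p' \<Longrightarrow> degree r \<le> degree p'"
      using ex(2) ex_has_least_nat[of "Rel (inverse z)" _ degree] by blast
    have sR: "s \<in> R" using s R' by auto
    \<comment> \<open>Both relations have least degree, but the one of larger degree can be
      shortened by means of the other; z and 1/z exchange roles in the second case.\<close>
    show False
    proof (cases "degree r \<le> degree p")
      case True
      from inverse_relation_degree_reduction[OF R'(1) sR s(2) R'(4) unit z(2) _ _ _ _ True] p r
      show False unfolding Rel_def by (meson linorder_not_less)
    next
      case False
      then have "degree p \<le> degree r" by simp
      from inverse_relation_degree_reduction[OF R'(1) sR s(2) R'(4) unit _ _ _ _ _ this, of "inverse z"] p r z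
      show False unfolding Rel_def by (metis inverse_inverse_eq inverse_nonzero_iff_nonzero linorder_not_less)
    qed
  qed
  moreover have "s \<notin> range \<iota>"
  proof
    assume "s \<in> range \<iota>"
    then obtain d where "s = \<iota> d" by blast
    then have "inverse s = \<iota> (inverse d)" using field_hom_simps(8)[OF \<iota>, of d] by simp
    then have "inverse s \<in> range \<iota>" by blast
    then show False using A s by blast
  qed
  then have "range \<iota> \<subset> R" using s R' A by blast
  moreover have "inverse s \<in> F" using s A subfield_inverse[OF F] by blast
  then have "R \<subset> F" using R' by blast
  ultimately have "valuation_ring \<iota> F R" using R' by (auto simp: valuation_ring_def)
  then show ?thesis using that R' by blast
qed

section \<open>Dimensions over a finite field\<close>

lemma vector_space_field_hom:
  assumes "field_hom \<iota>"
  shows "vector_space (\<lambda>c v. \<iota> c * v)"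
  by unfold_locales (auto simp: field_hom_simps[OF assms] algebra_simps)

text \<open>Vanishing outside B is the normalisation used in \<open>quotient_dim\<close>; it makes
  the coordinate vectors a finite set that can be counted.\<close>

definition coordinates :: "'a set \<Rightarrow> ('a \<Rightarrow> 'k::zero) set" where
  "coordinates B = {f. \<forall>b. b \<notin> B \<longrightarrow> f b = 0}"

lemma card_coordinates:
  assumes "finite B"
  shows "card (coordinates B :: ('a \<Rightarrow> 'k::zero) set) = card (UNIV :: 'k set) ^ card B"
proof -
  have "bij_betw (\<lambda>f. restrict f B) (coordinates B) (B \<rightarrow>\<^sub>E (UNIV :: 'k set))"
  proof (rule bij_betwI[where g = "\<lambda>f b. if b \<in> B then f b else 0"])
    show "(\<lambda>b. if b \<in> B then restrict f B b else 0) = f" if "f \<in> coordinates B" for f :: "'a \<Rightarrow> 'k"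
      using that by (intro ext) (simp add: coordinates_def)
    show "restrict (\<lambda>b. if b \<in> B then f b else 0) B = f" if "f \<in> B \<rightarrow>\<^sub>E (UNIV :: 'k set)" for f
      using that by (intro ext) (simp add: PiE_def extensional_def)
  qed (auto simp: coordinates_def)
  then show ?thesis using assms by (simp add: bij_betw_same_card card_PiE)
qed

definition quotient_basis :: "('k::field \<Rightarrow> 'h::field) \<Rightarrow> 'h set \<Rightarrow> 'h set \<Rightarrow> 'h set \<Rightarrow> bool" where
  "quotient_basis \<iota> V W B \<longleftrightarrow> B \<subseteq> V \<and> finite B \<and>
     (\<forall>v\<in>V. \<exists>!f. f \<in> coordinates B \<and> v - (\<Sum>b\<in>B. \<iota> (f b) * b) \<in> W)"

lemma quotient_dim_basis:
  "quotient_dim \<iota> V W = (THE n. \<exists>B. quotient_basis \<iota> V W B \<and> card B = n)"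
  unfolding quotient_dim_def quotient_basis_def coordinates_def
  by (intro arg_cong[where f = The] ext) auto

locale finite_constants =
  fixes \<iota> :: "'k::field \<Rightarrow> 'h::field"
  assumes hom: "field_hom \<iota>" and finite_const: "finite (UNIV :: 'k set)"
begin

sublocale vs: vector_space "\<lambda>c v. \<iota> c * v"
  by (rule vector_space_field_hom[OF hom])

lemmas \<iota>_simps = field_hom_simps[OF hom]

definition Q :: nat where "Q = card (range \<iota>)"

lemma card_const: "card (UNIV :: 'k set) = Q"
  unfolding Q_def by (rule card_image[symmetric]) (simp add: inj_def \<iota>_simps)

lemma Q_gt_1: "Q > 1"
proof -
  have "card {0, 1 :: 'k} \<le> card (UNIV :: 'k set)" using finite_const by (intro card_mono) auto
  then show ?thesis by (simp add: card_const)
qed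

lemma card_coordinates_const: "finite B \<Longrightarrow> card (coordinates B :: ('a \<Rightarrow> 'k) set) = Q ^ card B"
  by (simp add: card_coordinates card_const)

lemma finite_coordinates: "finite B \<Longrightarrow> finite (coordinates B :: ('a \<Rightarrow> 'k) set)"
  using card_coordinates_const[of B] Q_gt_1 by (intro card_ge_0_finite) auto

definition comb :: "'h set \<Rightarrow> ('h \<Rightarrow> 'k) \<Rightarrow> 'h" where
  "comb B f = (\<Sum>b\<in>B. \<iota> (f b) * b)"

lemma comb_diff: "comb B f - comb B g = comb B (\<lambda>b. f b - g b)"
  by (simp add: comb_def \<iota>_simps sum_subtractf algebra_simps)

lemma comb_in: "vs.subspace V \<Longrightarrow> B \<subseteq> V \<Longrightarrow> comb B f \<in> V"
  unfolding comb_def by (intro vs.subspace_sum vs.subspace_scale) auto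

lemma quotient_basis_unique_comb:
  assumes "quotient_basis \<iota> V W B" "v \<in> V" "f \<in> coordinates B" "g \<in> coordinates B"
    "v - comb B f \<in> W" "v - comb B g \<in> W"
  shows "f = g"
  using assms unfolding quotient_basis_def comb_def by blast

text \<open>Counting replaces an exchange argument: rewriting a class from B-coordinates to
  B'-coordinates is injective, so Q^|B| is at most Q^|B'|.\<close>

lemma quotient_basis_card_le:
  assumes V: "vs.subspace V" and W: "vs.subspace W"
    and B: "quotient_basis \<iota> V W B" and B': "quotient_basis \<iota> V W B'"
  shows "card B \<le> card B'"
proof -
  have fin: "finite B" "finite B'" and sub: "B \<subseteq> V" using B B' by (auto simp: quotient_basis_def)
  have "\<forall>f. \<exists>g\<in>coordinates B'. comb B f - comb B' g \<in> W"
    using B' comb_in[OF V sub] unfolding quotient_basis_def comb_def by blast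
  then obtain h where h: "\<And>f. h f \<in> coordinates B'" "\<And>f. comb B f - comb B' (h f) \<in> W" by metis
  have "inj_on h (coordinates B)"
  proof (rule inj_onI)
    fix f g assume fg: "f \<in> coordinates B" "g \<in> coordinates B" "h f = h g"
    have "(comb B f - comb B' (h f)) - (comb B g - comb B' (h g)) \<in> W"
      by (rule vs.subspace_diff[OF W h(2) h(2)])
    then have "comb B f - comb B g \<in> W" using fg by simp
    moreover have "comb B f - comb B f \<in> W" using W vs.subspace_0 by simp
    ultimately show "f = g" using quotient_basis_unique_comb[OF B comb_in[OF V sub]] fg by blast
  qed
  then have "card (coordinates B :: ('h \<Rightarrow> 'k) set) \<le> card (coordinates B' :: ('h \<Rightarrow> 'k) set)"
    using h(1) finite_coordinates[OF fin(2)] by (intro card_inj_on_le[of h]) auto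
  then show ?thesis using Q_gt_1 by (simp add: card_coordinates_const fin)
qed

lemma quotient_dim_eq:
  assumes "vs.subspace V" "vs.subspace W" "quotient_basis \<iota> V W B"
  shows "quotient_dim \<iota> V W = card B"
  unfolding quotient_dim_basis
  by (rule the_equality) (use assms quotient_basis_card_le in \<open>auto intro: antisym\<close>)

text \<open>The sizes of such sets measure a quotient by W without forming the quotient.\<close>

definition incongruent :: "'h set \<Rightarrow> 'h set \<Rightarrow> bool" where
  "incongruent W X \<longleftrightarrow> (\<forall>x\<in>X. \<forall>y\<in>X. x - y \<in> W \<longrightarrow> x = y)"

text \<open>A set B that is independent modulo W yields Q^|B| incongruent combinations, so N bounds
  |B|. An independent set of greatest size then spans: a class outside its span could be added to
  it.\<close>

lemma quotient_basis_exists: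
  assumes V: "vs.subspace V" and W: "vs.subspace W"
    and N: "\<And>X. X \<subseteq> V \<Longrightarrow> finite X \<Longrightarrow> incongruent W X \<Longrightarrow> card X \<le> N"
  obtains B where "quotient_basis \<iota> V W B"
proof -
  define ind where "ind B \<longleftrightarrow> B \<subseteq> V \<and> finite B \<and> (\<forall>f\<in>coordinates B. comb B f \<in> W \<longrightarrow> f = (\<lambda>_. 0))" for B
  have bound: "card B \<le> N" if B: "ind B" for B
  proof -
    have eq: "f = g" if fg: "f \<in> coordinates B" "g \<in> coordinates B" "comb B f - comb B g \<in> W" for f g
    proof -
      have "(\<lambda>b. f b - g b) \<in> coordinates B" using fg by (auto simp: coordinates_def)
      then have "(\<lambda>b. f b - g b) = (\<lambda>_. 0)" using B fg(3) unfolding ind_def comb_diff by blast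
      then show "f = g" by (auto simp: fun_eq_iff)
    qed
    have "incongruent W (comb B ` coordinates B)" unfolding incongruent_def using eq by blast
    moreover have "inj_on (comb B) (coordinates B)"
      using eq W vs.subspace_0 by (intro inj_onI) auto
    ultimately have "Q ^ card B \<le> N"
      using N[of "comb B ` coordinates B"] B comb_in[OF V] finite_coordinates
      by (auto simp: ind_def card_image card_coordinates_const)
    moreover have "card B < Q ^ card B"
      using Q_gt_1 by (intro power_gt_expt) simp
    ultimately show ?thesis by simp
  qed
  have "ind {}" using W vs.subspace_0 by (auto simp: ind_def coordinates_def)
  then obtain B where B: "ind B" and max: "\<And>B'. ind B' \<Longrightarrow> card B' \<le> card B"
    using ex_has_greatest_nat[of ind "{}" card "Suc N"] bound by (metis le_imp_less_Suc)
  have ex: "\<exists>f\<in>coordinates B. v - comb B f \<in> W" if v: "v \<in> V" for v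
  proof (rule ccontr)
    assume no: "\<not> ?thesis"
    have vB: "v \<notin> B"
    proof
      assume "v \<in> B"
      then have "comb B (\<lambda>b. if b = v then 1 else 0) = (\<Sum>b\<in>B. if b = v then b else 0)"
        unfolding comb_def by (intro sum.cong) (auto simp: \<iota>_simps)
      also have "\<dots> = v" using B \<open>v \<in> B\<close> by (simp add: ind_def)
      finally have "v - comb B (\<lambda>b. if b = v then 1 else 0) \<in> W" using W vs.subspace_0 by simp
      moreover have "(\<lambda>b. if b = v then 1 else 0) \<in> coordinates B"
        using \<open>v \<in> B\<close> by (auto simp: coordinates_def)
      ultimately show False using no by blast
    qed
    have "ind (insert v B)" unfolding ind_def
    proof (intro conjI ballI impI)
      show "insert v B \<subseteq> V" "finite (insert v B)" using v B by (auto simp: ind_def)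
      fix f assume f: "f \<in> coordinates (insert v B)" "comb (insert v B) f \<in> W"
      have split: "comb (insert v B) f = \<iota> (f v) * v + comb B f"
        using vB B by (simp add: comb_def ind_def)
      show "f = (\<lambda>_. 0)"
      proof (cases "f v = 0")
        case True
        then have "f \<in> coordinates B" using f by (auto simp: coordinates_def)
        then show ?thesis using f B split True by (auto simp: ind_def \<iota>_simps)
      next
        case False
        define g where "g b = (if b \<in> B then - (f b / f v) else 0)" for b
        have "comb B g = - (inverse (\<iota> (f v)) * comb B f)"
          unfolding comb_def g_def sum_distrib_left sum_negf[symmetric]
          by (intro sum.cong) (auto simp: \<iota>_simps divide_inverse)
        then have "v - comb B g = \<iota> (inverse (f v)) * comb (insert v B) f"
          using False by (simp add: split \<iota>_simps field_simps)
        then have "v - comb B g \<in> W" using W f vs.subspace_scale by simp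
        moreover have "g \<in> coordinates B" by (auto simp: coordinates_def g_def)
        ultimately show ?thesis using no by blast
      qed
    qed
    then have "card (insert v B) \<le> card B" using max by blast
    then show False using vB B by (simp add: ind_def)
  qed
  have uniq: "f = g" if v: "f \<in> coordinates B" "g \<in> coordinates B" "v - comb B f \<in> W" "v - comb B g \<in> W" for v f g
  proof -
    have "(v - comb B g) - (v - comb B f) \<in> W" by (rule vs.subspace_diff[OF W v(4,3)])
    then have "comb B (\<lambda>b. f b - g b) \<in> W" by (simp add: comb_diff)
    moreover have "(\<lambda>b. f b - g b) \<in> coordinates B" using v by (auto simp: coordinates_def)
    ultimately have "(\<lambda>b. f b - g b) = (\<lambda>_. 0)" using B by (auto simp: ind_def)
    then show "f = g" by (auto simp: fun_eq_iff)
  qed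
  have "quotient_basis \<iota> V W B"
    unfolding quotient_basis_def comb_def[symmetric] Ex1_def
    using B ex uniq unfolding ind_def by blast
  then show ?thesis using that by blast
qed

lemma subspace_place:
  assumes "is_subfield F" "is_place \<iota> F P"
  shows "vs.subspace (place_ring F P)" "vs.subspace P"
proof -
  interpret valuation \<iota> F "place_ring F P" using placeD[OF assms] by blast
  show "vs.subspace (place_ring F P)"
    by (auto intro!: vs.subspaceI R_0 R_add R_mult const_R)
  have "vs.subspace (nonunits (place_ring F P))"
    by (auto intro!: vs.subspaceI nonunits_0 nonunits_add nonunits_mult const_R)
  then show "vs.subspace P" using placeD[OF assms] by simp
qed

lemma place_degree_eq:
  assumes "is_subfield F" "is_place \<iota> F P" "quotient_basis \<iota> (place_ring F P) P B"
  shows "place_degree \<iota> F P = card B"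
  unfolding place_degree_def by (rule quotient_dim_eq[OF subspace_place[OF assms(1,2)] assms(3)])

text \<open>The bridge from \<open>vs.dim\<close> to cardinalities; the comparisons of dimensions of
  Riemann-Roch spaces pass through it.\<close>

lemma card_subspace:
  assumes V: "vs.subspace V" and fin: "finite V"
  shows "card V = Q ^ vs.dim V"
proof -
  have W: "vs.subspace {0}" by (rule vs.subspace_single_0)
  obtain B where B: "B \<subseteq> V" "vs.independent B" "V \<subseteq> vs.span B" "card B = vs.dim V"
    using vs.basis_exists by blast
  have finB: "finite B" using B fin finite_subset by blast
  have "bij_betw (comb B) (coordinates B) V" unfolding bij_betw_def
  proof
    show "inj_on (comb B) (coordinates B)"
    proof (rule inj_onI)
      fix f g assume fg: "f \<in> coordinates B" "g \<in> coordinates B" "comb B f = comb B g"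
      then have "(\<Sum>b\<in>B. \<iota> (f b - g b) * b) = 0" using comb_diff[of B f g] by (simp add: comb_def)
      then have "f b - g b = 0" if "b \<in> B" for b
        using vs.independentD[OF B(2) finB order_refl, of "\<lambda>b. f b - g b"] that by blast
      then show "f = g" using fg by (force simp: coordinates_def)
    qed
    show "comb B ` coordinates B = V"
    proof
      show "comb B ` coordinates B \<subseteq> V" using comb_in[OF V B(1)] by blast
      show "V \<subseteq> comb B ` coordinates B"
      proof
        fix v assume "v \<in> V"
        then obtain u where "v = (\<Sum>b\<in>B. \<iota> (u b) * b)" using B(3) vs.span_finite[OF finB] by auto
        then have "v = comb B (\<lambda>b. if b \<in> B then u b else 0)" by (simp add: comb_def)
        then show "v \<in> comb B ` coordinates B" by (auto simp: coordinates_def)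
      qed
    qed
  qed
  then show ?thesis using B(4) by (simp add: bij_betw_same_card[symmetric] card_coordinates_const finB)
qed

end

section \<open>Discrete places\<close>

text \<open>The last assumption says that each nonzero z is a unit times a power of \<pi>, which is
  exactly what the definite description in \<open>place_val\<close> requires.\<close>

locale discrete_place = valuation \<iota> F R
  for \<iota> :: "'k::field \<Rightarrow> 'h::field" and F R +
  fixes \<pi> :: 'h
  assumes \<pi>: "\<pi> \<in> nonunits R" "\<pi> \<noteq> 0"
    and discrete: "z \<in> F \<Longrightarrow> z \<noteq> 0 \<Longrightarrow> \<exists>n. z * \<pi> powi (- n) \<in> R - nonunits R"
begin

lemma \<pi>_R: "\<pi> \<in> R"
  using \<pi> nonunits_R by blast

lemma \<pi>_powi_add: "\<pi> powi (i + j) = \<pi> powi i * \<pi> powi j"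
  using \<pi> by (simp add: power_int_add)

lemma \<pi>_powi_nonunit: "n > 0 \<Longrightarrow> \<pi> powi n \<in> nonunits R"
  using power_nonunits[OF \<pi>(1)] by (simp add: power_int_def)

lemma \<pi>_powi_R: "\<pi> powi n \<in> R \<longleftrightarrow> n \<ge> 0"
proof
  assume R: "\<pi> powi n \<in> R"
  show "n \<ge> 0"
  proof (rule ccontr)
    assume "\<not> n \<ge> 0"
    then have "\<pi> powi n * \<pi> powi (- n) \<in> nonunits R" using R \<pi>_powi_nonunit nonunits_mult by simp
    then show False using nonunits_1 \<pi> by (simp flip: \<pi>_powi_add)
  qed
next
  assume "n \<ge> 0" then show "\<pi> powi n \<in> R" using R_power[OF \<pi>_R] by (simp add: power_int_def)
qed

lemma unit_times_\<pi>_powi: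
  assumes "u \<in> R - nonunits R"
  shows "u * \<pi> powi n \<in> R \<longleftrightarrow> n \<ge> 0" "u * \<pi> powi n \<in> nonunits R \<longleftrightarrow> n > 0"
proof -
  show 1: "u * \<pi> powi n \<in> R \<longleftrightarrow> n \<ge> 0"
  proof
    assume "u * \<pi> powi n \<in> R"
    then have "inverse u * (u * \<pi> powi n) \<in> R" using assms unit_inverse R_mult by blast
    then show "n \<ge> 0" using assms unit_inverse(3) \<pi>_powi_R by (simp flip: mult.assoc)
  qed (use assms R_mult \<pi>_powi_R in auto)
  show "u * \<pi> powi n \<in> nonunits R \<longleftrightarrow> n > 0"
  proof
    assume *: "u * \<pi> powi n \<in> nonunits R"
    then have "n \<ge> 0" using 1 nonunits_R by blast
    moreover have "n \<noteq> 0" using * assms by auto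
    ultimately show "n > 0" by simp
  qed (use assms nonunits_mult \<pi>_powi_nonunit in auto)
qed

lemma generator: "nonunits R = (*) \<pi> ` R"
proof
  show "(*) \<pi> ` R \<subseteq> nonunits R" using \<pi> nonunits_mult' by blast
  show "nonunits R \<subseteq> (*) \<pi> ` R"
  proof
    fix z assume z: "z \<in> nonunits R"
    show "z \<in> (*) \<pi> ` R"
    proof (cases "z = 0")
      case True then show ?thesis using R_0 by force
    next
      case False
      then obtain n where n: "z * \<pi> powi (- n) \<in> R - nonunits R"
        using discrete z nonunits_R R_F by blast
      define u where "u = z * \<pi> powi (- n)"
      have zu: "z = u * \<pi> powi n" using \<pi> by (simp add: u_def power_int_minus)
      then have "n > 0" using z unit_times_\<pi>_powi(2) n u_def by metis
      moreover have "z = \<pi> * (u * \<pi> powi (n - 1))" using zu \<pi>_powi_add[of "n - 1" 1] by simp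
      moreover have "u * \<pi> powi (n - 1) \<in> R"
        using unit_times_\<pi>_powi(1)[of u "n - 1"] n u_def \<open>n > 0\<close> by simp
      ultimately show ?thesis by blast
    qed
  qed
qed

text \<open>\<open>place_val\<close> admits every prime element t; two of them differ by a unit, so
  the exponent does not depend on the choice.\<close>

lemma generator_associate:
  assumes t: "t \<in> nonunits R" "nonunits R = (*) t ` R"
  obtains u where "u \<in> R - nonunits R" "t = \<pi> * u"
proof -
  obtain a b where ab: "a \<in> R" "t = \<pi> * a" "b \<in> R" "\<pi> = t * b"
    using t generator \<pi>(1) by (metis imageE)
  then have "a * b = 1" using \<pi> by (metis mult.assoc mult_cancel_left mult.right_neutral)
  then have "a \<notin> nonunits R" using ab nonunits_mult' nonunits_1 by metis
  then show ?thesis using that ab by blast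
qed

lemma place_val_eq:
  assumes u: "u \<in> R - nonunits R" and z: "z = u * \<pi> powi n"
  shows "place_val F (nonunits R) z = n"
  unfolding place_val_def place_ring_nonunits
proof (rule the_equality)
  show "\<exists>t u. t \<in> nonunits R \<and> nonunits R = (*) t ` R \<and> u \<in> R \<and> u \<notin> nonunits R \<and> z = t powi n * u"
    using \<pi> generator u z by (metis DiffD1 DiffD2 mult.commute)
next
  fix n' assume "\<exists>t u. t \<in> nonunits R \<and> nonunits R = (*) t ` R \<and> u \<in> R \<and> u \<notin> nonunits R \<and> z = t powi n' * u"
  then obtain t v where t: "t \<in> nonunits R" "nonunits R = (*) t ` R" "v \<in> R - nonunits R" "z = t powi n' * v" by blast
  obtain w where w: "w \<in> R - nonunits R" "t = \<pi> * w" using generator_associate t by blast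
  define x where "x = w powi n' * v"
  have x: "x \<in> R - nonunits R" unfolding x_def using w t unit_mult unit_powi by blast
  have zx: "z = x * \<pi> powi n'" unfolding x_def using t w by (simp add: power_int_mult_distrib)
  have "u * \<pi> powi (n - n') = x" "x * \<pi> powi (n' - n) = u"
    using z zx \<pi> by (auto simp: power_int_diff field_simps)
  then have "n - n' \<ge> 0" "n' - n \<ge> 0" using unit_times_\<pi>_powi(1) u x by (metis DiffD1)+
  then show "n' = n" by simp
qed

text \<open>Pole bounds become membership in R after multiplication by a power of \<pi>. In this
  form the condition is visibly linear in z.\<close>

lemma place_val_ge_iff:
  assumes z: "z \<in> F" "z \<noteq> 0"
  shows "place_val F (nonunits R) z \<ge> - n \<longleftrightarrow> z * \<pi> powi n \<in> R"
proof -
  obtain k where k: "z * \<pi> powi (- k) \<in> R - nonunits R" using discrete[OF z] by blast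
  define u where "u = z * \<pi> powi (- k)"
  have zu: "z = u * \<pi> powi k" using \<pi> by (simp add: u_def power_int_minus)
  have u: "u \<in> R - nonunits R" using k u_def by simp
  have "z * \<pi> powi n = u * \<pi> powi (k + n)" using zu \<pi>_powi_add by simp
  then have "z * \<pi> powi n \<in> R \<longleftrightarrow> k + n \<ge> 0" using unit_times_\<pi>_powi(1)[OF u] by metis
  then show ?thesis unfolding place_val_eq[OF u zu] by linarith
qed

end

section \<open>Riemann--Roch spaces\<close>

text \<open>\<open>disc\<close> gives meaning to the valuation and \<open>residue\<close> to the
  degree at each place; together they support the comparison of divisors below.\<close>

locale discrete_function_field = finite_constants \<iota> for \<iota> :: "'k::field \<Rightarrow> 'h::field" +
  fixes F :: "'h set" and \<pi> :: "'h set \<Rightarrow> 'h"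
  assumes F: "is_subfield F"
    and disc: "is_place \<iota> F P \<Longrightarrow> discrete_place \<iota> F (place_ring F P) (\<pi> P)"
    and residue: "is_place \<iota> F P \<Longrightarrow> \<exists>B. quotient_basis \<iota> (place_ring F P) P B"
begin

abbreviation "L \<equiv> riemann_roch_space \<iota> F"
abbreviation "deg \<equiv> place_degree \<iota> F"
abbreviation "Deg \<equiv> divisor_degree \<iota> F"

lemma L_eq:
  assumes "range \<iota> \<subseteq> F"
  shows "L A = {z \<in> F. \<forall>P. is_place \<iota> F P \<longrightarrow> z * \<pi> P powi A P \<in> place_ring F P}"
proof -
  have "0 \<in> place_ring F P" if "is_place \<iota> F P" for P
    using valuation.R_0 placeD[OF F that] by blast
  moreover have "place_val F P z \<ge> - A P \<longleftrightarrow> z * \<pi> P powi A P \<in> place_ring F P"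
    if "is_place \<iota> F P" "z \<in> F" "z \<noteq> 0" for P z
    using discrete_place.place_val_ge_iff[OF disc[OF that(1)] that(2,3)] placeD(2)[OF F that(1)] by simp
  ultimately have "(z = 0 \<or> (\<forall>P. is_place \<iota> F P \<longrightarrow> place_val F P z \<ge> - A P)) \<longleftrightarrow>
      (\<forall>P. is_place \<iota> F P \<longrightarrow> z * \<pi> P powi A P \<in> place_ring F P)" if "z \<in> F" for z
    using that by (cases "z = 0") auto
  then show ?thesis unfolding riemann_roch_space_def by blast
qed

context
  assumes const_F: "range \<iota> \<subseteq> F"
begin

lemma subspace_L: "vs.subspace (L A)"
proof (rule vs.subspaceI)
  have sub: "is_subring F" using F subfield_subring by blast
  show "0 \<in> L A" using sub by (auto simp: riemann_roch_space_def subring_0)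
  show "x + y \<in> L A" if "x \<in> L A" "y \<in> L A" for x y
    using that sub subspace_place(1)[OF F] unfolding L_eq[OF const_F]
    by (auto simp: subring_add distrib_right intro!: vs.subspace_add)
  show "\<iota> c * x \<in> L A" if "x \<in> L A" for x c
    using that const_F subring_mult[OF sub] vs.subspace_scale[OF subspace_place(1)[OF F]]
    unfolding L_eq[OF const_F] by (auto simp: mult.assoc)
qed

lemma L_mono:
  assumes "A \<le> A'"
  shows "L A \<subseteq> L A'"
proof -
  have "- A' P \<le> v" if "- A P \<le> v" for P v using le_funD[OF assms, of P] that by linarith
  then show ?thesis unfolding riemann_roch_space_def by blast
qed

text \<open>Multiplication by \<open>\<pi> P powi (A P + 1)\<close> followed by reduction modulo P
  maps L(A + P) to the residue field, and elements with equal residue differ by an element of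
  L(A).\<close>

lemma dim_L_Suc:
  assumes P: "is_place \<iota> F P" and fin: "finite (L (A(P := A P + 1)))"
  shows "divisor_dim \<iota> F (A(P := A P + 1)) \<le> divisor_dim \<iota> F A + deg P"
proof -
  define A' where "A' = A(P := A P + 1)"
  define R where "R = place_ring F P"
  interpret discrete_place \<iota> F R "\<pi> P" unfolding R_def using disc[OF P] .
  have nu: "nonunits R = P" unfolding R_def using placeD(2)[OF F P] .
  obtain B where B: "quotient_basis \<iota> R P B" using residue[OF P] R_def by blast
  have finB: "finite B" using B by (auto simp: quotient_basis_def)
  have deg: "deg P = card B" using place_degree_eq[OF F P] B R_def by blast
  have sub: "L A \<subseteq> L A'" by (rule L_mono) (auto simp: A'_def le_fun_def)
  then have fin': "finite (L A)" "finite (L A')" using fin A'_def finite_subset by blast+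
  define s where "s = \<pi> P powi (A P + 1)"
  have s0: "s \<noteq> 0" using \<pi> by (simp add: s_def)
  have "z * s \<in> R" if "z \<in> L A'" for z
    using that P by (auto simp: L_eq[OF const_F] A'_def s_def R_def)
  then have "\<forall>z\<in>L A'. \<exists>f\<in>coordinates B. z * s - comb B f \<in> P"
    using B unfolding quotient_basis_def comb_def by blast
  then obtain h where h: "\<And>z. z \<in> L A' \<Longrightarrow> h z \<in> coordinates B"
    "\<And>z. z \<in> L A' \<Longrightarrow> z * s - comb B (h z) \<in> P" by metis
  \<comment> \<open>Subtracting a fixed member z0 of the fibre embeds the fibre into L(A). The
    residues are labelled by coordinate vectors f, of which there are Q^(deg P).\<close>
  have fib: "card {z \<in> L A'. h z = f} \<le> card (L A)" for f
  proof (cases "{z \<in> L A'. h z = f} = {}")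
    case False
    then obtain z0 where z0: "z0 \<in> L A'" "h z0 = f" by blast
    have "z - z0 \<in> L A" if z: "z \<in> L A'" "h z = f" for z
    proof -
      have zz: "z - z0 \<in> L A'" using z z0 subspace_L vs.subspace_diff by blast
      have "(z * s - comb B f) - (z0 * s - comb B f) \<in> P"
        using nonunits_diff[of "z * s - comb B f" "z0 * s - comb B f"] h(2)[of z] h(2)[of z0] z z0 nu
        by metis
      then have "(z - z0) * s \<in> nonunits R" using nu by (simp add: algebra_simps)
      then obtain r where r: "r \<in> R" "(z - z0) * s = \<pi> P * r" using generator by blast
      have "(z - z0) * \<pi> P powi A P * \<pi> P = \<pi> P * r"
        using r \<pi>_powi_add[of "A P" 1] by (simp add: s_def mult.assoc)
      then have "(z - z0) * \<pi> P powi A P = r" using \<pi> by simp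
      then have zP: "(z - z0) * \<pi> P powi A P \<in> place_ring F P" using r R_def by simp
      show ?thesis unfolding L_eq[OF const_F]
      proof (intro CollectI conjI allI impI)
        show "z - z0 \<in> F" using zz by (auto simp: riemann_roch_space_def)
        fix P' assume P': "is_place \<iota> F P'"
        show "(z - z0) * \<pi> P' powi A P' \<in> place_ring F P'"
        proof (cases "P' = P")
          case True then show ?thesis using zP by simp
        next
          case False
          then have "A' P' = A P'" by (simp add: A'_def)
          moreover have "(z - z0) * \<pi> P' powi A' P' \<in> place_ring F P'"
            using zz P' by (auto simp: L_eq[OF const_F])
          ultimately show ?thesis by simp
        qed
      qed
    qed
    then have "(\<lambda>z. z - z0) ` {z \<in> L A'. h z = f} \<subseteq> L A" by blast
    moreover have "inj_on (\<lambda>z. z - z0) {z \<in> L A'. h z = f}" by (auto intro: inj_onI)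
    ultimately show ?thesis using fin' by (metis card_inj_on_le)
  qed (metis card.empty zero_le)
  have "L A' = (\<Union>f\<in>coordinates B. {z \<in> L A'. h z = f})" using h(1) by blast
  then have "card (L A') = card (\<Union>f\<in>coordinates B. {z \<in> L A'. h z = f})" by (rule arg_cong)
  also have "\<dots> \<le> (\<Sum>f\<in>coordinates B. card {z \<in> L A'. h z = f})"
    by (rule card_UN_le[OF finite_coordinates[OF finB]])
  also have "\<dots> \<le> (\<Sum>f\<in>(coordinates B :: ('h \<Rightarrow> 'k) set). card (L A))" by (intro sum_mono fib)
  also have "\<dots> = Q ^ (vs.dim (L A) + deg P)"
    using card_subspace[OF subspace_L fin'(1)] finB deg by (simp add: card_coordinates_const power_add)
  finally have "Q ^ vs.dim (L A') \<le> Q ^ (vs.dim (L A) + deg P)"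
    using card_subspace[OF subspace_L fin'(2)] by simp
  then show ?thesis using Q_gt_1 unfolding divisor_dim_def A'_def by simp
qed

lemma Deg_eq_sum: "finite S \<Longrightarrow> {P. A P \<noteq> 0} \<subseteq> S \<Longrightarrow> Deg A = (\<Sum>P\<in>S. A P * int (deg P))"
  unfolding divisor_degree_def by (rule sum.mono_neutral_left) auto

text \<open>Adding one place raises the degree by deg P and the dimension by at most as much.
  Induction on the total gap between A and A' over S.\<close>

lemma Deg_minus_dim_mono:
  assumes S: "finite S" "\<And>P. P \<in> S \<Longrightarrow> is_place \<iota> F P"
    and supp: "{P. A P \<noteq> 0} \<subseteq> S" "{P. A' P \<noteq> 0} \<subseteq> S" and le: "A \<le> A'" and fin: "finite (L A')"
  shows "Deg A - int (divisor_dim \<iota> F A) \<le> Deg A' - int (divisor_dim \<iota> F A')"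
  using supp le
proof (induction "nat (\<Sum>P\<in>S. A' P - A P)" arbitrary: A rule: less_induct)
  case less
  show ?case
  proof (cases "A = A'")
    case False
    then obtain P where P: "A P < A' P" using less(4) by (metis antisym le_funD le_funI linorder_not_le)
    then have "A P \<noteq> 0 \<or> A' P \<noteq> 0" by auto
    then have PS: "P \<in> S" using less by blast
    define C where "C = A(P := A P + 1)"
    have C: "{P. C P \<noteq> 0} \<subseteq> S" "C \<le> A'" using less PS P by (auto simp: C_def le_fun_def)
    have "(\<Sum>P\<in>S. A' P - C P) < (\<Sum>P\<in>S. A' P - A P)"
      using S PS P by (intro sum_strict_mono_ex1) (auto simp: C_def)
    moreover have "(\<Sum>P\<in>S. A' P - C P) \<ge> 0" using C by (intro sum_nonneg) (auto simp: le_fun_def)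
    ultimately have "Deg C - int (divisor_dim \<iota> F C) \<le> Deg A' - int (divisor_dim \<iota> F A')"
      using less C by (intro less.hyps) auto
    moreover have "divisor_dim \<iota> F C \<le> divisor_dim \<iota> F A + deg P" unfolding C_def
    proof (rule dim_L_Suc)
      show "is_place \<iota> F P" using S PS by blast
      have "L C \<subseteq> L A'" using C by (intro L_mono)
      then show "finite (L (A(P := A P + 1)))" using fin finite_subset unfolding C_def by blast
    qed
    moreover have "Deg C = Deg A + int (deg P)"
    proof -
      have "Deg C = C P * int (deg P) + (\<Sum>P\<in>S - {P}. C P * int (deg P))"
        using Deg_eq_sum[OF S(1) C(1)] S(1) PS by (simp add: sum.remove)
      also have "(\<Sum>P\<in>S - {P}. C P * int (deg P)) = (\<Sum>P\<in>S - {P}. A P * int (deg P))"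
        by (intro sum.cong) (auto simp: C_def)
      also have "C P * int (deg P) + \<dots> = A P * int (deg P) + \<dots> + int (deg P)"
        by (simp add: C_def algebra_simps)
      also have "A P * int (deg P) + (\<Sum>P\<in>S - {P}. A P * int (deg P)) = Deg A"
        using Deg_eq_sum[OF S(1) less(2)] S(1) PS by (simp add: sum.remove)
      finally show ?thesis .
    qed
    ultimately show ?thesis by linarith
  qed simp
qed

end

end

section \<open>The curve y^q + y = t^n\<close>

lemma power_char2:
  fixes u v :: "'a::field"
  assumes "(1 :: 'a) + 1 = 0"
  shows "(u + v) ^ (2 ^ i) = u ^ (2 ^ i) + v ^ (2 ^ i)"
proof (induction i)
  case (Suc i)
  have 2: "(2 :: 'a) = 0" using assms by simp
  have sq: "(u + v)\<^sup>2 = u\<^sup>2 + v\<^sup>2" for u v :: 'a by (simp add: power2_sum 2)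
  have "x ^ (2 ^ Suc i) = (x ^ (2 ^ i))\<^sup>2" for x :: 'a by (simp add: mult.commute flip: power_mult)
  then show ?case using Suc sq by simp
qed simp

lemma transcendental_sum_eq_0:
  assumes \<iota>: "field_hom \<iota>" and tr: "transcendental_over \<iota> t" and I: "finite I"
    and 0: "(\<Sum>i\<in>I. \<iota> (c i) * t ^ i) = 0" and i: "i \<in> I"
  shows "c i = 0"
proof -
  define p where "p = (\<Sum>i\<in>I. monom (c i) i)"
  note s = field_hom_simps[OF \<iota>]
  have cp: "coeff p i = (if i \<in> I then c i else 0)" for i
    using I by (simp add: p_def coeff_sum)
  have "map_poly \<iota> p = (\<Sum>i\<in>I. monom (\<iota> (c i)) i)"
    by (rule poly_eqI) (use I in \<open>auto simp: coeff_map_poly s coeff_sum cp\<close>)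
  then have "poly (map_poly \<iota> p) t = 0" using 0 by (simp add: poly_sum poly_monom)
  then have "p = 0" using tr by (auto simp: transcendental_over_def)
  then show ?thesis using cp[of i] i by simp
qed

text \<open>Multiplying t = p(1/t) by t^d, d the degree of p, would give a monic equation of degree
  d + 1 for t. This is what allows a place at which 1/t vanishes.\<close>

lemma transcendental_not_in_inverse_adjoin:
  assumes \<iota>: "field_hom \<iota>" and tr: "transcendental_over \<iota> t"
    and p: "\<forall>i. coeff p i \<in> range \<iota>"
  shows "poly p (inverse t) \<noteq> t"
proof
  assume eq: "poly p (inverse t) = t"
  note s = field_hom_simps[OF \<iota>]
  have t0: "t \<noteq> 0"
  proof
    assume "t = 0"
    then have "(\<Sum>i\<in>{1}. \<iota> 1 * t ^ i) = 0" by simp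
    from transcendental_sum_eq_0[OF \<iota> tr _ this, of 1] show False by simp
  qed
  have "\<forall>i. \<exists>a. coeff p i = \<iota> a" using p by blast
  then obtain c where c: "\<And>i. coeff p i = \<iota> (c i)" by metis
  define d where "d = degree p"
  define c' where "c' i = (if i = Suc d then 1 else - c (d - i))" for i
  have "t ^ Suc d = poly p (inverse t) * t ^ d" using eq by simp
  also have "\<dots> = (\<Sum>i\<le>d. \<iota> (c i) * (inverse t ^ i * t ^ d))"
    by (simp add: poly_altdef c d_def sum_distrib_right mult.assoc)
  also have "\<dots> = (\<Sum>i\<le>d. \<iota> (c i) * t ^ (d - i))"
    using t0 by (intro sum.cong) (auto simp: power_diff field_simps)
  also have "\<dots> = (\<Sum>i\<le>d. \<iota> (c (d - i)) * t ^ i)"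
    by (rule sum.reindex_bij_witness[of _ "\<lambda>i. d - i" "\<lambda>i. d - i"]) auto
  finally have "(\<Sum>i\<le>Suc d. \<iota> (c' i) * t ^ i) = 0"
    by (simp add: c'_def s sum_negf)
  from transcendental_sum_eq_0[OF \<iota> tr _ this, of "Suc d"] show False by (simp add: c'_def)
qed

locale artin_schreier_curve = finite_constants \<iota> for \<iota> :: "'k::field \<Rightarrow> 'h::field" +
  fixes q n e :: nat and t y :: 'h and F :: "'h set"
  assumes char2: "(1 :: 'h) + 1 = 0"
    and e: "e \<ge> 1" and q: "q = 2 ^ e" and cop: "coprime n q"
    and curve: "y ^ q + y = t ^ n"
    and F_def: "F = generated_field (range \<iota> \<union> {t, y})"
    and transcendental: "transcendental_over \<iota> t"
begin

lemma double_0: "(z :: 'h) + z = 0"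
  using char2 by (metis distrib_left mult.right_neutral mult_zero_right)

lemma minus_self: "- (z :: 'h) = z"
  using double_0[of z] by (simp add: eq_neg_iff_add_eq_0 minus_unique)

lemma q_ge_2: "q \<ge> 2"
  using e q by (metis one_le_numeral power_increasing power_one_right)

lemma n_pos: "n > 0"
  using cop q_ge_2 by (cases n) auto

lemma F_subfield: "is_subfield F"
  by (simp add: F_def is_subfield_generated_field)

lemma F_gens: "\<iota> c \<in> F" "t \<in> F" "y \<in> F"
  unfolding F_def by (auto intro: subsetD[OF generated_field_superset])

lemmas F_subring = subfield_subring[OF F_subfield]

definition T :: "nat \<times> nat \<Rightarrow> 'h" where "T p = t ^ fst p * y ^ snd p"

definition weight :: "nat \<times> nat \<Rightarrow> nat" where "weight p = q * fst p + n * snd p"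

definition monomials :: "(nat \<times> nat) set" where "monomials = {p. snd p < q}"

definition monomials_upto :: "nat \<Rightarrow> (nat \<times> nat) set" where
  "monomials_upto N = {p \<in> monomials. weight p \<le> N}"

definition R :: "'h set" where "R = vs.span (T ` monomials)"

text \<open>An explicit model of the elements of \<open>R\<close> whose pole at infinity has order
  at most N; \<open>R_upto_iff\<close> confirms this.\<close>

definition R_upto :: "nat \<Rightarrow> 'h set" where "R_upto N = vs.span (T ` monomials_upto N)"

lemma subspace_R: "vs.subspace R" and subspace_R_upto: "vs.subspace (R_upto N)"
  by (simp_all add: R_def R_upto_def vs.subspace_span)

lemma R_upto_mono: "M \<le> N \<Longrightarrow> R_upto M \<subseteq> R_upto N"
  unfolding R_upto_def by (intro vs.span_mono) (auto simp: monomials_upto_def)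

lemma R_upto_R: "R_upto N \<subseteq> R"
  unfolding R_upto_def R_def by (intro vs.span_mono) (auto simp: monomials_upto_def)

lemma finite_monomials_upto: "finite (monomials_upto N)"
proof (rule finite_subset)
  show "monomials_upto N \<subseteq> {..N} \<times> {..<q}"
  proof
    fix p assume p: "p \<in> monomials_upto N"
    then have "q * fst p \<le> N" by (auto simp: monomials_upto_def weight_def)
    then have "fst p \<le> N" using q_ge_2 by (metis le_trans mult_le_mono1 mult_1 one_le_numeral)
    then show "p \<in> {..N} \<times> {..<q}" using p by (cases p) (auto simp: monomials_upto_def monomials_def)
  qed
qed auto

text \<open>The equation y^q = t^n - y trades y^j with j at least q for monomials with smaller
  exponent of y.\<close>

lemma monomial_R: "t ^ i * y ^ j \<in> R"
proof (induction j arbitrary: i rule: less_induct)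
  case (less j)
  show ?case
  proof (cases "j < q")
    case True
    then have "T (i, j) \<in> T ` monomials" by (auto simp: monomials_def)
    then show ?thesis unfolding R_def using vs.span_base by (auto simp: T_def)
  next
    case False
    have "y ^ j = y ^ q * y ^ (j - q)" using False by (simp flip: power_add)
    also have "y ^ q = t ^ n - y" using curve by (simp add: algebra_simps)
    finally have "t ^ i * y ^ j = t ^ i * ((t ^ n - y) * y ^ (j - q))" by simp
    then have "t ^ i * y ^ j = t ^ (i + n) * y ^ (j - q) - t ^ i * y ^ (j - q + 1)"
      by (simp add: algebra_simps power_add)
    moreover have "j - q < j" "j - q + 1 < j" using False q_ge_2 by auto
    ultimately show ?thesis using less vs.subspace_diff[OF subspace_R] by metis
  qed
qed

lemma R_mult_closed: "a \<in> R \<Longrightarrow> b \<in> R \<Longrightarrow> a * b \<in> R"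
proof -
  assume a: "a \<in> R" and b: "b \<in> R"
  have sub: "vs.subspace {z. z * w \<in> R}" for w
    using subspace_R by (auto intro!: vs.subspaceI
        simp: vs.subspace_0 distrib_right mult.assoc vs.subspace_add vs.subspace_scale)
  have mono: "T p * w \<in> R" if w: "w \<in> R" for p w
  proof -
    have "T p' * T p \<in> R" for p'
    proof -
      have "T p' * T p = t ^ (fst p' + fst p) * y ^ (snd p' + snd p)"
        by (simp add: T_def power_add algebra_simps)
      then show ?thesis using monomial_R by simp
    qed
    then have "R \<subseteq> {z. z * T p \<in> R}" unfolding R_def
      using sub[of "T p"] by (intro vs.span_minimal) (auto simp: R_def)
    then show ?thesis using w by (auto simp: mult.commute)
  qed
  have "R \<subseteq> {z. z * b \<in> R}"
    using sub[of b] mono[OF b] unfolding R_def by (intro vs.span_minimal) (auto simp: R_def)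
  then show ?thesis using a by blast
qed

lemma R_gens: "t \<in> R" "y \<in> R" "\<iota> c \<in> R"
proof -
  show "t \<in> R" "y \<in> R" using monomial_R[of 1 0] monomial_R[of 0 1] by auto
  show "\<iota> c \<in> R" using vs.subspace_scale[OF subspace_R monomial_R[of 0 0], of c] by simp
qed

lemma R_subring: "is_subring R"
  unfolding is_subring_def
  using R_gens(3)[of 1] R_mult_closed vs.subspace_diff[OF subspace_R] by (auto simp: \<iota>_simps)

lemma R_F: "R \<subseteq> F"
proof -
  have "vs.subspace F"
    using F_subring F_gens by (auto intro!: vs.subspaceI simp: subring_closed)
  moreover have "T p \<in> F" for p
    using F_subring F_gens by (simp add: T_def subring_closed)
  ultimately show ?thesis unfolding R_def by (intro vs.span_minimal) auto
qed

lemma fraction: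
  assumes "z \<in> F"
  obtains r s where "r \<in> R" "s \<in> R" "s \<noteq> 0" "z = r / s"
proof -
  have "range \<iota> \<union> {t, y} \<subseteq> R" using R_gens by blast
  then have "F \<subseteq> {r / s | r s. r \<in> R \<and> s \<in> R \<and> s \<noteq> 0}" unfolding F_def
    using is_subfield_fractions[OF R_subring] fractions_superset[OF R_subring]
    by (intro generated_field_minimal) blast+
  then show ?thesis using assms that by blast
qed

text \<open>Exponents (i, j) for which t^i y^j has weight -1, i.e. a simple zero at infinity. They
  give the uniformizer \<open>\<rho>\<close> below.\<close>

definition bezout :: "int \<times> int" where
  "bezout = (SOME p. int q * fst p + int n * snd p = - 1)"

lemma bezout: "int q * fst bezout + int n * snd bezout = - 1"
proof -
  have "coprime (int q) (int n)" using cop by (simp add: coprime_commute)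
  then obtain u v where "u * int q + v * int n = 1" by (metis bezout_int coprime_iff_gcd_eq_1)
  then have "int q * fst (- u, - v) + int n * snd (- u, - v) = - 1" by (simp add: algebra_simps)
  then show ?thesis unfolding bezout_def by (rule someI)
qed

definition \<rho> :: 'h where "\<rho> = t powi fst bezout * y powi snd bezout"

definition infinite_ring :: "'h set \<Rightarrow> bool" where
  "infinite_ring V \<longleftrightarrow> valuation_ring \<iota> F V \<and> t \<notin> V"

text \<open>Chevalley's theorem for A = k[1/t] and s = 1/t: since t is transcendental, t is not in
  A.\<close>

lemma infinite_ring_exists: "\<exists>V. infinite_ring V"
proof -
  define A where "A = {poly p (inverse t) | p. \<forall>i. coeff p i \<in> range \<iota>}"
  have cs: "is_subring (range \<iota>)"
    by (auto simp: is_subring_def \<iota>_simps(1)[symmetric]) (auto simp flip: \<iota>_simps)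
  have "t \<notin> A" using transcendental_not_in_inverse_adjoin[OF hom transcendental] by (force simp: A_def)
  moreover have "A \<subseteq> F"
  proof -
    have "poly p (inverse t) \<in> F" if "\<forall>i. coeff p i \<in> range \<iota>" for p
    proof -
      have "coeff p i \<in> F" for i using that F_gens(1) by (metis rangeE)
      then show ?thesis using F_subring subfield_inverse[OF F_subfield F_gens(2)]
        by (auto simp: poly_altdef intro!: subring_sum subring_mult subring_power)
    qed
    then show ?thesis by (auto simp: A_def)
  qed
  moreover have "is_subring A" "range \<iota> \<subseteq> A" "inverse t \<in> A"
    unfolding A_def using is_subring_adjoin[OF cs] adjoin_superset[OF cs] by blast+
  moreover have "inverse t \<noteq> 0"
    using \<open>t \<notin> A\<close> \<open>inverse t \<in> A\<close> by auto
  ultimately obtain V where "valuation_ring \<iota> F V" "t \<notin> V"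
    using exists_valuation_ring[OF hom F_subfield, of A "inverse t"] by (metis inverse_inverse_eq)
  then show ?thesis unfolding infinite_ring_def by blast
qed

end

section \<open>Leading terms at a pole of \<open>t\<close>\<close>

locale infinite_valuation = artin_schreier_curve \<iota> q n e t y F + valuation \<iota> F V
  for \<iota> :: "'k::field \<Rightarrow> 'h::field" and q n e t y F V +
  assumes t_notin: "t \<notin> V"
begin

abbreviation "\<mm> \<equiv> nonunits V"

lemma inverse_t: "inverse t \<in> \<mm>"
  using not_in_R_inverse F_gens t_notin by blast

text \<open>If y were regular, so would be t^n = y^q + y, and then t = t^n (1/t)^(n-1).\<close>

lemma y_notin: "y \<notin> V"
proof
  assume "y \<in> V"
  then have "t ^ n \<in> V" using R_add R_power by (simp flip: curve)
  then have "t ^ n * inverse t ^ (n - 1) \<in> V"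
    using inverse_t nonunits_R R_power R_mult by blast
  moreover have "t ^ n * inverse t ^ (n - 1) = t"
    using n_pos R_0 t_notin by (cases n) (auto simp: field_simps)
  ultimately show False using t_notin by metis
qed

lemma ty_nonzero: "t \<noteq> 0" "y \<noteq> 0"
  using t_notin y_notin R_0 by auto

lemma inverse_y: "inverse y \<in> \<mm>"
  using not_in_R_inverse F_gens y_notin by blast

text \<open>Working with residue 1, and not merely with units, lets the leading coefficient of a sum
  of monomials be read off as an element of k.\<close>

definition one_units :: "'h set" where "one_units = {z. z - 1 \<in> \<mm>}"

lemma one_units_unit: "z \<in> one_units \<Longrightarrow> z \<in> V - \<mm>"
  using unit_add_nonunit[of 1 "z - 1"] R_1 nonunits_1 by (auto simp: one_units_def)

lemma one_units_mult: "a \<in> one_units \<Longrightarrow> b \<in> one_units \<Longrightarrow> a * b \<in> one_units"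
proof -
  assume a: "a \<in> one_units" and b: "b \<in> one_units"
  have "a * (b - 1) + (a - 1) \<in> \<mm>"
    using a b one_units_unit[OF a] by (intro nonunits_add nonunits_mult) (auto simp: one_units_def)
  then show ?thesis by (simp add: one_units_def algebra_simps)
qed

lemma one_units_inverse: "a \<in> one_units \<Longrightarrow> inverse a \<in> one_units"
proof -
  assume a: "a \<in> one_units"
  note u = one_units_unit[OF a]
  have "- (inverse a * (a - 1)) \<in> \<mm>"
    using a u unit_inverse by (intro nonunits_uminus nonunits_mult) (auto simp: one_units_def)
  moreover have "- (inverse a * (a - 1)) = inverse a - 1" using u unit_inverse(3)[of a] by (simp add: field_simps)
  ultimately show ?thesis by (simp add: one_units_def)
qed

lemma one_units_powi: "a \<in> one_units \<Longrightarrow> a powi i \<in> one_units"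
proof -
  have 1: "1 \<in> one_units" using nonunits_0 by (simp add: one_units_def)
  have "a \<in> one_units \<Longrightarrow> a ^ k \<in> one_units" for a k
    by (induction k) (use 1 one_units_mult in auto)
  then show "a \<in> one_units \<Longrightarrow> a powi i \<in> one_units"
    using one_units_inverse by (simp add: power_int_def)
qed

text \<open>By the curve equation t^n / y^q = 1 + (1/y)^(q-1), and y has a pole.\<close>

lemma ratio_one_unit: "t ^ n / y ^ q \<in> one_units"
proof -
  have "t ^ n / y ^ q - 1 = inverse y ^ (q - 1)"
  proof -
    have "y ^ q = y * y ^ (q - 1)" using q_ge_2 by (cases q) auto
    then show ?thesis using ty_nonzero by (simp add: field_simps flip: curve)
  qed
  then show ?thesis
    using power_nonunits[OF inverse_y, of "q - 1"] q_ge_2 by (simp add: one_units_def)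
qed

text \<open>Coprimality forces (i, j) to be a multiple of (n, -q), so the monomial is a power of t^n
  / y^q.\<close>

lemma weight_zero_one_unit:
  assumes "int q * i + int n * j = 0"
  shows "t powi i * y powi j \<in> one_units"
proof -
  have "int n dvd int q * i" using assms by (metis dvd_0_right dvd_add_left_iff dvd_triv_left)
  then have "int n dvd i" using cop by (simp add: coprime_dvd_mult_right_iff)
  then obtain s where s: "i = int n * s" by blast
  then have "int n * (int q * s + j) = 0" using assms by (simp add: algebra_simps)
  then have j: "j = - (int q * s)" using n_pos by simp
  have "(t ^ n / y ^ q) powi s \<in> one_units" by (rule one_units_powi[OF ratio_one_unit])
  moreover have "(t ^ n / y ^ q) powi s = t powi i * y powi j"
    by (simp add: s j power_int_divide_distrib power_int_mult power_int_minus divide_inverse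
        power_int_mult_distrib power_int_inverse)
  ultimately show ?thesis by simp
qed

lemma \<rho>_nonzero: "\<rho> \<noteq> 0"
  using ty_nonzero by (simp add: \<rho>_def)

text \<open>\<open>\<rho>\<close> has weight -1, so the exponents of the product have weight
  zero.\<close>

lemma monomial_times_\<rho>: "t powi i * y powi j * \<rho> powi (int q * i + int n * j) \<in> one_units"
proof -
  define w where "w = int q * i + int n * j"
  obtain i0 j0 where b: "bezout = (i0, j0)" by (cases bezout)
  have b1: "int q * i0 + int n * j0 = - 1" using bezout b by simp
  have "int q * (i + i0 * w) + int n * (j + j0 * w) = w + w * (int q * i0 + int n * j0)"
    by (simp add: w_def algebra_simps)
  also have "\<dots> = 0" using b1 by simp
  finally have "t powi (i + i0 * w) * y powi (j + j0 * w) \<in> one_units" by (rule weight_zero_one_unit)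
  moreover have "t powi (i + i0 * w) * y powi (j + j0 * w) = t powi i * y powi j * \<rho> powi w"
    using ty_nonzero by (simp add: \<rho>_def b power_int_add power_int_mult_distrib power_int_mult)
  ultimately show ?thesis by (simp add: w_def)
qed

lemma T_times_\<rho>: "T p * \<rho> ^ weight p \<in> one_units"
  using monomial_times_\<rho>[of "int (fst p)" "int (snd p)"]
  by (simp add: T_def weight_def power_int_def nat_add_distrib nat_mult_distrib)

lemma \<rho>_in: "\<rho> \<in> F"
  using F_gens F_subring subfield_powi[OF F_subfield] by (simp add: \<rho>_def subring_mult)

text \<open>Otherwise 1/\<rho> lies in V, and t, which is (1/\<rho>)^q times a one-unit, would lie
  in V as well.\<close>

lemma \<rho>_nonunit: "\<rho> \<in> \<mm>"
proof (rule ccontr)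
  assume n: "\<rho> \<notin> \<mm>"
  have "inverse \<rho> \<in> V"
  proof (cases "\<rho> \<in> V")
    case True then show ?thesis using n unit_inverse by blast
  next
    case False then show ?thesis using total[OF \<rho>_in] by blast
  qed
  then have "inverse \<rho> ^ q * (T (1, 0) * \<rho> ^ weight (1, 0)) \<in> V"
    using T_times_\<rho> one_units_unit R_mult R_power by blast
  moreover have "inverse \<rho> ^ q * (T (1, 0) * \<rho> ^ weight (1, 0)) = t"
    using \<rho>_nonzero by (simp add: T_def weight_def field_simps)
  ultimately show False using t_notin by simp
qed

text \<open>After scaling by \<rho> to the top weight, lighter monomials acquire a positive power of
  \<rho> and vanish in the residue field.\<close>

lemma leading_term:
  assumes J: "finite J" "p \<in> J" "\<And>p'. p' \<in> J \<Longrightarrow> p' \<noteq> p \<Longrightarrow> weight p' < weight p"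
  shows "(\<Sum>p\<in>J. \<iota> (c p) * T p) * \<rho> ^ weight p - \<iota> (c p) \<in> \<mm>"
proof -
  have "(\<Sum>p'\<in>J - {p}. \<iota> (c p') * T p' * \<rho> ^ weight p) \<in> \<mm>"
  proof (rule nonunits_sum)
    fix p' assume "p' \<in> J - {p}"
    then have less: "weight p' < weight p" using J by auto
    have "\<iota> (c p') * T p' * \<rho> ^ weight p = (\<iota> (c p') * (T p' * \<rho> ^ weight p')) * \<rho> ^ (weight p - weight p')"
      using less by (simp add: mult.assoc flip: power_add)
    moreover have "\<rho> ^ (weight p - weight p') \<in> \<mm>" using less power_nonunits[OF \<rho>_nonunit] by simp
    moreover have "\<iota> (c p') * (T p' * \<rho> ^ weight p') \<in> V"
      using const_R T_times_\<rho>[of p'] one_units_unit R_mult by blast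
    ultimately show "\<iota> (c p') * T p' * \<rho> ^ weight p \<in> \<mm>" using nonunits_mult by metis
  qed
  moreover have "\<iota> (c p) * (T p * \<rho> ^ weight p - 1) \<in> \<mm>"
    using T_times_\<rho>[of p] const_R by (intro nonunits_mult) (auto simp: one_units_def)
  ultimately have "(\<Sum>p'\<in>J - {p}. \<iota> (c p') * T p' * \<rho> ^ weight p) + \<iota> (c p) * (T p * \<rho> ^ weight p - 1) \<in> \<mm>"
    by (rule nonunits_add)
  also have "(\<Sum>p'\<in>J - {p}. \<iota> (c p') * T p' * \<rho> ^ weight p) + \<iota> (c p) * (T p * \<rho> ^ weight p - 1)
      = (\<Sum>p\<in>J. \<iota> (c p) * T p) * \<rho> ^ weight p - \<iota> (c p)"
    using J by (simp add: sum.remove[of J p] sum_distrib_right right_diff_distrib distrib_right mult.assoc)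
  finally show ?thesis .
qed

end

section \<open>The monomial basis of \<open>R\<close> and the count of pole orders\<close>

context artin_schreier_curve
begin

lemma infinite_ringD: "infinite_ring V \<Longrightarrow> infinite_valuation \<iota> q n e t y F V"
  using F_subfield unfolding infinite_ring_def by unfold_locales auto

text \<open>Equal weights make q divide n (j' - j), hence j' - j, whose absolute value is below
  q.\<close>

lemma weight_inj: "inj_on weight monomials"
proof (rule inj_onI)
  fix p p' assume p: "p \<in> monomials" "p' \<in> monomials" "weight p = weight p'"
  obtain i j i' j' where ij: "p = (i, j)" "p' = (i', j')" by (cases p; cases p')
  have eq: "int q * (int i - int i') = int n * (int j' - int j)"
    using p(3) by (simp add: ij weight_def algebra_simps flip: of_nat_mult of_nat_add)
  then have "int q dvd int n * (int j' - int j)" by (metis dvd_triv_left)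
  then have d: "int q dvd int j' - int j" using cop by (simp add: coprime_commute coprime_dvd_mult_right_iff)
  have "\<bar>int j' - int j\<bar> < int q" using p by (auto simp: ij monomials_def)
  then have "int j' - int j = 0" using d by (meson abs_dvd_iff dvd_imp_le_int zdvd_not_zless linorder_not_less dvd_abs_iff zero_less_abs_iff)
  then have "j' = j" by simp
  then show "p = p'" using eq q_ge_2 by (simp add: ij)
qed

text \<open>The leading monomial p is chosen before V: it is the same for all valuation rings at
  which t has a pole. Uniqueness of the infinite place rests on this.\<close>

lemma leading_sum:
  assumes J: "finite J" "J \<noteq> {}" "J \<subseteq> monomials"
  obtains p where "p \<in> J" "\<And>p'. p' \<in> J \<Longrightarrow> weight p' \<le> weight p"
    "\<And>V. infinite_ring V \<Longrightarrow> (\<Sum>p\<in>J. \<iota> (c p) * T p) * \<rho> ^ weight p - \<iota> (c p) \<in> nonunits V"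
proof -
  have "\<exists>p\<in>J. weight p = Max (weight ` J)" using J by (metis (mono_tags, lifting) Max_in finite_imageI image_iff image_is_empty)
  then obtain p where p: "p \<in> J" "weight p = Max (weight ` J)" by blast
  have le: "weight p' \<le> weight p" if "p' \<in> J" for p' using J that p(2) by simp
  have less: "weight p' < weight p" if "p' \<in> J" "p' \<noteq> p" for p'
  proof -
    have "weight p' \<noteq> weight p" using inj_onD[OF weight_inj] that p(1) J by blast
    then show ?thesis using le[OF that(1)] by simp
  qed
  show ?thesis
  proof (rule that[OF p(1) le])
    fix V assume "infinite_ring V"
    then interpret infinite_valuation \<iota> q n e t y F V by (rule infinite_ringD)
    show "(\<Sum>p\<in>J. \<iota> (c p) * T p) * \<rho> ^ weight p - \<iota> (c p) \<in> nonunits V"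
      by (rule leading_term[OF J(1) p(1) less])
  qed
qed

text \<open>Evaluated at some infinite place: if the sum were 0, its leading coefficient, a nonzero
  constant, would be a nonunit.\<close>

lemma sum_nonzero:
  assumes J: "finite J" "J \<noteq> {}" "J \<subseteq> monomials" and c: "\<And>p. p \<in> J \<Longrightarrow> c p \<noteq> 0"
  shows "(\<Sum>p\<in>J. \<iota> (c p) * T p) \<noteq> 0"
proof
  assume 0: "(\<Sum>p\<in>J. \<iota> (c p) * T p) = 0"
  obtain p where p: "p \<in> J" 
    "\<And>V. infinite_ring V \<Longrightarrow> (\<Sum>p\<in>J. \<iota> (c p) * T p) * \<rho> ^ weight p - \<iota> (c p) \<in> nonunits V"
    using leading_sum[OF J, of c] by blast
  obtain V where V: "infinite_ring V" using infinite_ring_exists by blast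
  then interpret infinite_valuation \<iota> q n e t y F V by (rule infinite_ringD)
  have "\<iota> (- c p) \<in> nonunits V" using p(2)[OF V] 0 by (simp add: \<iota>_simps)
  moreover have "\<iota> (- c p) \<noteq> 0" "inverse (\<iota> (- c p)) \<in> V"
    using c[OF p(1)] const_R[of "inverse (- c p)"] by (auto simp: \<iota>_simps)
  ultimately show False by (simp add: nonunits_def)
qed

lemma T_inj: "inj_on T monomials"
proof (rule inj_onI, rule ccontr)
  fix p p' assume p: "p \<in> monomials" "p' \<in> monomials" "T p = T p'" "p \<noteq> p'"
  have "(\<Sum>x\<in>{p, p'}. \<iota> ((if x = p then 1 else - 1)) * T x) \<noteq> 0"
    by (rule sum_nonzero) (use p in auto)
  then show False using p by (simp add: \<iota>_simps)
qed

lemma span_monomials: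
  assumes M: "M \<subseteq> monomials" and z: "z \<in> vs.span (T ` M)"
  obtains J c where "finite J" "J \<subseteq> M" "\<And>p. p \<in> J \<Longrightarrow> c p \<noteq> 0" "z = (\<Sum>p\<in>J. \<iota> (c p) * T p)"
proof -
  obtain S u where S: "finite S" "S \<subseteq> T ` M" "z = (\<Sum>v\<in>S. \<iota> (u v) * v)"
    using z unfolding vs.span_explicit by blast
  obtain J0 where J0: "J0 \<subseteq> M" "S = T ` J0" "inj_on T J0"
    using S(2) subset_image_inj by metis
  then have fin: "finite J0" using S(1) finite_image_iff by blast
  define J where "J = {p \<in> J0. u (T p) \<noteq> 0}"
  have "z = (\<Sum>p\<in>J0. \<iota> (u (T p)) * T p)" using S(3) J0 by (simp add: sum.reindex)
  also have "\<dots> = (\<Sum>p\<in>J. \<iota> (u (T p)) * T p)"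
    by (rule sum.mono_neutral_right) (use fin in \<open>auto simp: J_def \<iota>_simps\<close>)
  finally have z_eq: "z = (\<Sum>p\<in>J. \<iota> (u (T p)) * T p)" .
  show ?thesis by (rule that[OF _ _ _ z_eq]) (use fin J0 in \<open>auto simp: J_def\<close>)
qed

lemma independent_T: "vs.independent (T ` monomials)"
  unfolding vs.dependent_explicit
proof
  assume "\<exists>S u. finite S \<and> S \<subseteq> T ` monomials \<and> (\<Sum>v\<in>S. \<iota> (u v) * v) = 0 \<and> (\<exists>v\<in>S. u v \<noteq> 0)"
  then obtain S u where S: "finite S" "S \<subseteq> T ` monomials" "(\<Sum>v\<in>S. \<iota> (u v) * v) = 0" "\<exists>v\<in>S. u v \<noteq> 0"
    by blast
  obtain J0 where J0: "J0 \<subseteq> monomials" "S = T ` J0" "inj_on T J0"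
    using S(2) subset_image_inj by metis
  then have fin: "finite J0" using S(1) finite_image_iff by blast
  define J where "J = {p \<in> J0. u (T p) \<noteq> 0}"
  have "0 = (\<Sum>p\<in>J0. \<iota> (u (T p)) * T p)" using S(3) J0 by (simp add: sum.reindex)
  also have "\<dots> = (\<Sum>p\<in>J. \<iota> (u (T p)) * T p)"
    by (rule sum.mono_neutral_right) (use fin in \<open>auto simp: J_def \<iota>_simps\<close>)
  also have "\<dots> \<noteq> 0" by (rule sum_nonzero) (use J0 S fin in \<open>auto simp: J_def\<close>)
  finally show False by simp
qed

lemma dim_R_upto: "vs.dim (R_upto N) = card (monomials_upto N)"
proof -
  have sub: "monomials_upto N \<subseteq> monomials" by (auto simp: monomials_upto_def)
  then have "vs.independent (T ` monomials_upto N)"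
    using vs.independent_mono[OF independent_T] by (meson image_mono)
  then show ?thesis unfolding R_upto_def
    using vs.dim_span_eq_card_independent card_image inj_on_subset[OF T_inj sub] by metis
qed

lemma finite_R_upto: "finite (R_upto N)"
proof -
  have fin: "finite (T ` monomials_upto N)" using finite_monomials_upto by simp
  have "R_upto N \<subseteq> comb (T ` monomials_upto N) ` coordinates (T ` monomials_upto N)"
  proof
    fix v assume "v \<in> R_upto N"
    then obtain u where "v = (\<Sum>b\<in>T ` monomials_upto N. \<iota> (u b) * b)"
      unfolding R_upto_def using vs.span_finite[OF fin] by auto
    then have "v = comb (T ` monomials_upto N) (\<lambda>b. if b \<in> T ` monomials_upto N then u b else 0)"
      by (simp add: comb_def)
    then show "v \<in> comb (T ` monomials_upto N) ` coordinates (T ` monomials_upto N)"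
      by (rule image_eqI[where x = "\<lambda>b. if b \<in> T ` monomials_upto N then u b else 0"])
        (simp add: coordinates_def)
  qed
  then show ?thesis using finite_coordinates[OF fin] finite_subset by blast
qed

lemma card_R_upto: "card (R_upto N) = Q ^ card (monomials_upto N)"
  using card_subspace[OF subspace_R_upto finite_R_upto] by (simp add: dim_R_upto)

lemma R_eq_Union: "R = (\<Union>N. R_upto N)"
proof
  show "R \<subseteq> (\<Union>N. R_upto N)"
  proof
    fix z assume "z \<in> R"
    then obtain J c where J: "finite J" "J \<subseteq> monomials" "z = (\<Sum>p\<in>J. \<iota> (c p) * T p)"
      unfolding R_def using span_monomials[OF order_refl] by metis
    have "z \<in> R_upto (Max (weight ` J))" unfolding R_upto_def J(3)
      using J by (intro vs.span_sum vs.span_scale vs.span_base) (auto simp: monomials_upto_def)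
    then show "z \<in> (\<Union>N. R_upto N)" by blast
  qed
qed (use R_upto_R in auto)

lemma leading_R_upto:
  assumes z: "z \<in> R_upto N" "z \<noteq> 0"
  obtains w c where "w \<le> N" "z \<in> R_upto w" "c \<noteq> 0"
    "\<And>V. infinite_ring V \<Longrightarrow> z * \<rho> ^ w - \<iota> c \<in> nonunits V"
proof -
  obtain J c where J: "finite J" "J \<subseteq> monomials_upto N" "\<And>p. p \<in> J \<Longrightarrow> c p \<noteq> 0"
    "z = (\<Sum>p\<in>J. \<iota> (c p) * T p)"
    by (rule span_monomials[OF _ z(1)[unfolded R_upto_def]]) (auto simp: monomials_upto_def)
  have "J \<noteq> {}" using J z by auto
  moreover have Jm: "J \<subseteq> monomials" using J by (auto simp: monomials_upto_def)
  ultimately obtain p where p: "p \<in> J" "\<And>p'. p' \<in> J \<Longrightarrow> weight p' \<le> weight p"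
    "\<And>V. infinite_ring V \<Longrightarrow> z * \<rho> ^ weight p - \<iota> (c p) \<in> nonunits V"
    using leading_sum[OF J(1), of c] unfolding J(4) by blast
  have "z \<in> R_upto (weight p)" unfolding R_upto_def J(4)
    using J Jm p by (intro vs.span_sum vs.span_scale vs.span_base) (auto simp: monomials_upto_def)
  moreover have "weight p \<le> N" using p(1) J by (auto simp: monomials_upto_def)
  ultimately show ?thesis using that[of "weight p" "c p"] p J(3) by blast
qed

text \<open>Row j contributes floor((N - n j)/q) + 1 monomials; the bound on N keeps n j below N in
  every row. The count is stated doubled and with the genus term on the left to stay within natural
  numbers.\<close>

lemma card_monomials_upto:
  assumes N: "N \<ge> n * q"
  shows "2 * card (monomials_upto N) + (n - 1) * (q - 1) = 2 * N + 2"
proof -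
  have le: "n * j \<le> N" if "j < q" for j
    using that N by (meson le_trans less_imp_le mult_le_mono2)
  have eq: "monomials_upto N = (\<lambda>(j, i). (i, j)) ` (SIGMA j:{..<q}. {..(N - n * j) div q})"
  proof -
    have "q * i + n * j \<le> N \<longleftrightarrow> i \<le> (N - n * j) div q" if "j < q" for i j
      using le[OF that] q_ge_2 by (auto simp: less_eq_div_iff_mult_less_eq mult.commute)
    then show ?thesis by (force simp: monomials_upto_def monomials_def weight_def)
  qed
  have "card (monomials_upto N) = card (SIGMA j:{..<q}. {..(N - n * j) div q})"
    unfolding eq by (rule card_image) (auto simp: inj_on_def)
  also have "\<dots> = (\<Sum>j<q. (N - n * j) div q + 1)" by simp
  finally have card: "card (monomials_upto N) = (\<Sum>j<q. (N - n * j) div q) + q"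
    by (simp add: sum_Suc)
  \<comment> \<open>As n is invertible modulo q, the remainders run through 0, ..., q - 1 exactly
    once, so the sum of the floors is known in closed form.\<close>
  have inj: "inj_on (\<lambda>j. (N - n * j) mod q) {..<q}"
  proof (rule inj_onI)
    fix j j' assume j: "j \<in> {..<q}" "j' \<in> {..<q}" "(N - n * j) mod q = (N - n * j') mod q"
    then have "int (N - n * j) mod int q = int (N - n * j') mod int q" by (metis of_nat_mod)
    then have "int q dvd int (N - n * j) - int (N - n * j')" by (simp add: mod_eq_dvd_iff)
    also have "int (N - n * j) - int (N - n * j') = int n * (int j' - int j)"
      using le[of j] le[of j'] j by (simp add: of_nat_diff algebra_simps)
    finally have "int q dvd int j' - int j" using cop by (simp add: coprime_commute coprime_dvd_mult_right_iff)
    then have "int j' mod int q = int j mod int q" by (simp add: mod_eq_dvd_iff)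
    then show "j = j'" using j by simp
  qed
  have "(\<lambda>j. (N - n * j) mod q) ` {..<q} = {..<q}"
    by (rule endo_inj_surj[OF _ _ inj]) (use q_ge_2 in auto)
  then have "(\<Sum>j<q. (N - n * j) mod q) = \<Sum>{..<q}"
    using inj by (metis (no_types, lifting) sum.reindex_cong)
  moreover have "(\<Sum>j<q. N - n * j) = (\<Sum>j<q. q * ((N - n * j) div q) + (N - n * j) mod q)"
    by simp
  ultimately have "(\<Sum>j<q. N - n * j) = (\<Sum>j<q. q * ((N - n * j) div q)) + \<Sum>{..<q}"
    by (simp only: sum.distrib)
  also have "(\<Sum>j<q. q * ((N - n * j) div q)) = q * (card (monomials_upto N) - q)"
    by (simp add: card sum_distrib_left)
  finally have 1: "(\<Sum>j<q. N - n * j) = q * (card (monomials_upto N) - q) + \<Sum>{..<q}" .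
  have "(\<Sum>j<q. N - n * j) + n * \<Sum>{..<q} = (\<Sum>j<q. (N - n * j) + n * j)"
    by (simp add: sum.distrib sum_distrib_left)
  also have "\<dots> = q * N" using le by simp
  finally have 2: "(\<Sum>j<q. N - n * j) + n * \<Sum>{..<q} = q * N" .
  have 3: "2 * \<Sum>{..<q} = q * (q - 1)"
    using gauss_sum_nat[of "q - 1"] q_ge_2 atMost_atLeast0 lessThan_Suc_atMost[of "q - 1"] by simp
  have cq: "card (monomials_upto N) \<ge> q" using card by simp
  define X where "X = card (monomials_upto N) - q"
  have "2 * (q * N) = q * (2 * X) + 2 * \<Sum>{..<q} + n * (2 * \<Sum>{..<q})"
    using 1 2 unfolding X_def[symmetric] by (simp add: algebra_simps)
  then have "2 * (q * N) = q * (2 * (card (monomials_upto N) - q)) + q * (q - 1) + n * (q * (q - 1))"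
    unfolding 3 X_def .
  then have "q * (2 * N) = q * (2 * (card (monomials_upto N) - q) + (q - 1) + n * (q - 1))"
    by (simp only: distrib_left) (simp only: ac_simps)
  then have "2 * N = 2 * (card (monomials_upto N) - q) + (q - 1) + n * (q - 1)"
    using q_ge_2 by simp
  moreover have "n * (q - 1) = (n - 1) * (q - 1) + (q - 1)" using n_pos by (cases n) auto
  ultimately show ?thesis using cq q_ge_2 by linarith
qed

end

section \<open>Uniqueness and degree of the place at infinity\<close>

context infinite_valuation
begin

lemma const_unit: "c \<noteq> 0 \<Longrightarrow> \<iota> c \<in> V - \<mm>"
  using const_R[of c] const_R[of "inverse c"] by (auto simp: nonunits_def \<iota>_simps)

lemma congruent_const_unit: "u - \<iota> c \<in> \<mm> \<Longrightarrow> c \<noteq> 0 \<Longrightarrow> u \<in> V - \<mm>"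
  using unit_add_nonunit[OF const_unit, of c "u - \<iota> c"] by simp

lemma congruent_const_divide:
  assumes "u - \<iota> c \<in> \<mm>" "c \<noteq> 0" "v - \<iota> d \<in> \<mm>" "d \<noteq> 0"
  shows "u / v - \<iota> (c / d) \<in> \<mm>"
proof -
  have v: "inverse v \<in> V" "v \<noteq> 0" using congruent_const_unit[OF assms(3,4)] unit_inverse by auto
  have d: "\<iota> d \<noteq> 0" using assms(4) by (simp add: \<iota>_simps)
  have "inverse v * ((u - \<iota> c) - \<iota> (c / d) * (v - \<iota> d)) \<in> \<mm>"
    by (intro nonunits_mult[OF v(1)] nonunits_diff[OF assms(1)] nonunits_mult[OF const_R assms(3)])
  moreover have "inverse v * ((u - \<iota> c) - \<iota> (c / d) * (v - \<iota> d)) = u / v - \<iota> (c / d)"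
    using v(2) d by (simp add: \<iota>_simps field_simps)
  ultimately show ?thesis by simp
qed

end

context artin_schreier_curve
begin

text \<open>Leading terms of numerator and denominator are divided. The quantifier over V stands
  inside: order and leading coefficient are common to all infinite valuation rings.\<close>

lemma infinite_expansion:
  assumes z: "z \<in> F" "z \<noteq> 0"
  shows "\<exists>k c. c \<noteq> 0 \<and> (\<forall>V. infinite_ring V \<longrightarrow> z * \<rho> powi k - \<iota> c \<in> nonunits V)"
proof -
  obtain r s where rs: "r \<in> R" "s \<in> R" "s \<noteq> 0" "z = r / s" using fraction[OF z(1)] .
  have r0: "r \<noteq> 0" using rs z by auto
  obtain N N' where N: "r \<in> R_upto N" "s \<in> R_upto N'" using rs R_eq_Union by blast
  obtain w c where r: "c \<noteq> 0" "\<And>V. infinite_ring V \<Longrightarrow> r * \<rho> ^ w - \<iota> c \<in> nonunits V"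
    using leading_R_upto[OF N(1) r0] by metis
  obtain w' d where s: "d \<noteq> 0" "\<And>V. infinite_ring V \<Longrightarrow> s * \<rho> ^ w' - \<iota> d \<in> nonunits V"
    using leading_R_upto[OF N(2) rs(3)] by metis
  show ?thesis
  proof (intro exI[of _ "int w - int w'"] exI[of _ "c / d"] conjI allI impI)
    show "c / d \<noteq> 0" using r s by simp
    fix V assume V: "infinite_ring V"
    then interpret infinite_valuation \<iota> q n e t y F V by (rule infinite_ringD)
    have "(r * \<rho> ^ w) / (s * \<rho> ^ w') - \<iota> (c / d) \<in> nonunits V"
      by (rule congruent_const_divide[OF r(2)[OF V] r(1) s(2)[OF V] s(1)])
    moreover have "(r * \<rho> ^ w) / (s * \<rho> ^ w') = z * \<rho> powi (int w - int w')"
      using rs \<rho>_nonzero by (simp add: power_int_diff)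
    ultimately show "z * \<rho> powi (int w - int w') - \<iota> (c / d) \<in> nonunits V" by simp
  qed
qed

lemma infinite_discrete: "infinite_ring V \<Longrightarrow> discrete_place \<iota> F V \<rho>"
proof -
  assume V: "infinite_ring V"
  then interpret infinite_valuation \<iota> q n e t y F V by (rule infinite_ringD)
  show ?thesis
  proof unfold_locales
    show "\<rho> \<in> nonunits V" "\<rho> \<noteq> 0" using \<rho>_nonunit \<rho>_nonzero by auto
    fix z assume "z \<in> F" "z \<noteq> 0"
    then obtain k c where "c \<noteq> 0" "z * \<rho> powi k - \<iota> c \<in> nonunits V"
      using infinite_expansion V by blast
    then have "z * \<rho> powi (- (- k)) \<in> V - nonunits V" using congruent_const_unit[of _ c] by simp
    then show "\<exists>n. z * \<rho> powi (- n) \<in> V - nonunits V" by blast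
  qed
qed

text \<open>z is a unit times \<rho>^(-k) in either ring, with the same k, so the sign of k decides
  membership in both.\<close>

lemma infinite_ring_unique:
  assumes "infinite_ring V" "infinite_ring V'"
  shows "V = V'"
proof -
  have sub: "V \<subseteq> V'" if V: "infinite_ring V" and V': "infinite_ring V'" for V V'
  proof
    fix z assume z: "z \<in> V"
    interpret v: infinite_valuation \<iota> q n e t y F V using V by (rule infinite_ringD)
    interpret v': infinite_valuation \<iota> q n e t y F V' using V' by (rule infinite_ringD)
    interpret d: discrete_place \<iota> F V \<rho> using infinite_discrete[OF V] .
    interpret d': discrete_place \<iota> F V' \<rho> using infinite_discrete[OF V'] .
    show "z \<in> V'"
    proof (cases "z = 0")
      case True then show ?thesis using v'.R_0 by simp
    next
      case False
      then obtain k c where kc: "c \<noteq> 0" "\<And>V. infinite_ring V \<Longrightarrow> z * \<rho> powi k - \<iota> c \<in> nonunits V"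
        using infinite_expansion[OF _ False] z v.R_F by blast
      have eq: "z * \<rho> powi k * \<rho> powi (- k) = z" using v.\<rho>_nonzero by (simp add: power_int_minus)
      have "- k \<ge> 0" using d.unit_times_\<pi>_powi(1)[OF v.congruent_const_unit[OF kc(2)[OF V] kc(1)], of "- k"] eq z by simp
      then show ?thesis
        using d'.unit_times_\<pi>_powi(1)[OF v'.congruent_const_unit[OF kc(2)[OF V'] kc(1)], of "- k"] eq by simp
    qed
  qed
  show ?thesis using sub assms by blast
qed

definition V_inf :: "'h set" where "V_inf = (SOME V. infinite_ring V)"

definition P_inf :: "'h set" where "P_inf = nonunits V_inf"

lemma infinite_ring_V: "infinite_ring V_inf"
  unfolding V_inf_def using infinite_ring_exists by (rule someI_ex)

sublocale inf: infinite_valuation \<iota> q n e t y F V_inf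
  by (rule infinite_ringD[OF infinite_ring_V])

sublocale inf: discrete_place \<iota> F V_inf \<rho>
  by (rule infinite_discrete[OF infinite_ring_V])

text \<open>A unit has order k = 0 in \<open>infinite_expansion\<close>, so it is congruent to its
  leading coefficient: the residue field is k itself and the place has degree 1.\<close>

lemma quotient_basis_infinite: "quotient_basis \<iota> V_inf P_inf {1}"
proof -
  have ex: "\<exists>a. v - \<iota> a \<in> P_inf" if v: "v \<in> V_inf" for v
  proof (cases "v \<in> P_inf")
    case True then show ?thesis by (intro exI[of _ 0]) (simp add: \<iota>_simps)
  next
    case False
    then have v0: "v \<noteq> 0" using inf.nonunits_0 by (auto simp: P_inf_def)
    have "v \<in> F" using v inf.R_F by blast
    then obtain k c where kc: "c \<noteq> 0" "v * \<rho> powi k - \<iota> c \<in> P_inf"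
      using infinite_expansion[OF _ v0] infinite_ring_V unfolding P_inf_def by blast
    have u: "v * \<rho> powi k \<in> V_inf - nonunits V_inf"
      using inf.congruent_const_unit kc by (simp add: P_inf_def)
    have "v \<in> V_inf - nonunits V_inf" using v False by (simp add: P_inf_def)
    then have "k \<ge> 0" "\<not> k > 0" using u inf.unit_times_\<pi>_powi[of v k] by auto
    then have "k = 0" by simp
    then show ?thesis using kc by auto
  qed
  have uniq: "a = b" if "v - \<iota> a \<in> P_inf" "v - \<iota> b \<in> P_inf" for v a b
  proof (rule ccontr)
    assume "a \<noteq> b"
    have "(v - \<iota> b) - (v - \<iota> a) \<in> nonunits V_inf" using that inf.nonunits_diff[of "v - \<iota> b" "v - \<iota> a"] unfolding P_inf_def by blast
    then have "\<iota> (a - b) \<in> nonunits V_inf" by (simp add: \<iota>_simps)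
    then show False using inf.const_unit[of "a - b"] \<open>a \<noteq> b\<close> by simp
  qed
  show ?thesis unfolding quotient_basis_def
  proof (intro conjI ballI)
    show "{1} \<subseteq> V_inf" using inf.R_1 by simp
    fix v assume "v \<in> V_inf"
    then obtain a where a: "v - \<iota> a \<in> P_inf" using ex by blast
    show "\<exists>!f. f \<in> coordinates {1} \<and> v - (\<Sum>b\<in>{1}. \<iota> (f b) * b) \<in> P_inf"
    proof (rule ex1I[of _ "\<lambda>b. if b = 1 then a else 0"])
      show "(\<lambda>b. if b = 1 then a else 0) \<in> coordinates {1} \<and>
          v - (\<Sum>b\<in>{1}. \<iota> (if b = 1 then a else 0) * b) \<in> P_inf"
        using a by (simp add: coordinates_def)
      fix f assume f: "f \<in> coordinates {1} \<and> v - (\<Sum>b\<in>{1}. \<iota> (f b) * b) \<in> P_inf"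
      then have "f 1 = a" using uniq[of v "f 1" a] a by simp
      then show "f = (\<lambda>b. if b = 1 then a else 0)" using f by (auto simp: coordinates_def)
    qed
  qed simp
qed

text \<open>Distinct weights exclude cancellation of poles, so the pole order of z equals its
  largest weight w, and N must be at least w.\<close>

lemma R_upto_iff:
  assumes "z \<in> R"
  shows "z \<in> R_upto N \<longleftrightarrow> z * \<rho> ^ N \<in> V_inf"
proof (cases "z = 0")
  case True then show ?thesis using vs.subspace_0[OF subspace_R_upto] inf.R_0 by simp
next
  case False
  obtain N' where N': "z \<in> R_upto N'" using assms R_eq_Union by blast
  obtain w c where w: "z \<in> R_upto w" "c \<noteq> 0" "z * \<rho> ^ w - \<iota> c \<in> nonunits V_inf"
    using leading_R_upto[OF N' False] infinite_ring_V by metis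
  have unit: "z * \<rho> ^ w \<in> V_inf - nonunits V_inf" if "c \<noteq> 0" "z * \<rho> ^ w - \<iota> c \<in> nonunits V_inf" for w c
    using inf.congruent_const_unit[OF that(2,1)] .
  show ?thesis
  proof
    assume "z \<in> R_upto N"
    then obtain v d where v: "v \<le> N" "d \<noteq> 0" "z * \<rho> ^ v - \<iota> d \<in> nonunits V_inf"
      using leading_R_upto[OF _ False] infinite_ring_V by metis
    have "z * \<rho> ^ v * \<rho> ^ (N - v) \<in> V_inf"
      using unit[OF v(2,3)] inf.\<pi>_R inf.R_power inf.R_mult by blast
    then show "z * \<rho> ^ N \<in> V_inf" using v(1) by (simp add: mult.assoc flip: power_add)
  next
    assume N: "z * \<rho> ^ N \<in> V_inf"
    have "z * \<rho> ^ w * \<rho> powi (int N - int w) = z * \<rho> ^ N"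
      using inf.\<rho>_nonzero by (simp add: power_int_diff)
    then have "int N - int w \<ge> 0" using inf.unit_times_\<pi>_powi(1)[OF unit[OF w(2,3)]] N by metis
    then show "z \<in> R_upto N" using w(1) R_upto_mono[of w N] by auto
  qed
qed

lemma R_upto_mult:
  assumes "a \<in> R_upto M" "b \<in> R_upto N"
  shows "a * b \<in> R_upto (M + N)"
proof -
  have ab: "a \<in> R" "b \<in> R" using assms R_upto_R by auto
  then have "(a * \<rho> ^ M) * (b * \<rho> ^ N) \<in> V_inf" using assms R_upto_iff inf.R_mult by blast
  then have "a * b * \<rho> ^ (M + N) \<in> V_inf" by (simp add: power_add algebra_simps)
  then show ?thesis using R_upto_iff R_mult_closed ab by blast
qed

section \<open>Residue rings of the coordinate ring\<close>

definition multiples :: "'h \<Rightarrow> 'h set" where "multiples r = (*) r ` R"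

lemma multiples_closed:
  shows multiples_0: "0 \<in> multiples r"
    and multiples_add: "a \<in> multiples r \<Longrightarrow> b \<in> multiples r \<Longrightarrow> a + b \<in> multiples r"
    and multiples_diff: "a \<in> multiples r \<Longrightarrow> b \<in> multiples r \<Longrightarrow> a - b \<in> multiples r"
    and multiples_mult: "c \<in> R \<Longrightarrow> a \<in> multiples r \<Longrightarrow> c * a \<in> multiples r"
proof -
  note c = subring_closed[OF R_subring]
  have I: "r * x \<in> multiples r" if "x \<in> R" for x using that by (auto simp: multiples_def)
  show "0 \<in> multiples r" using I[of 0] c by simp
  show "a + b \<in> multiples r" "a - b \<in> multiples r" if ab: "a \<in> multiples r" "b \<in> multiples r"
  proof -
    obtain x x' where "x \<in> R" "x' \<in> R" "a = r * x" "b = r * x'"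
      using ab unfolding multiples_def by blast
    then show "a + b \<in> multiples r" "a - b \<in> multiples r"
      using I[of "x + x'"] I[of "x - x'"] c by (simp_all add: algebra_simps)
  qed
  show "c * a \<in> multiples r" if ca: "c \<in> R" "a \<in> multiples r"
  proof -
    obtain x where "x \<in> R" "a = r * x" using ca unfolding multiples_def by blast
    then show ?thesis using I[of "c * x"] c ca by (simp add: mult.left_commute)
  qed
qed

text \<open>Bounds |R/rR|. Multiplication by r embeds \<open>R_upto K\<close> into
  \<open>R_upto (K + w)\<close>, and for large K the dimensions differ by exactly w. Translates of
  the image by incongruent elements are disjoint, so at most Q^w of them fit.\<close>

lemma incongruent_card_le:
  assumes r: "r \<in> R_upto w" "r \<noteq> 0" and X: "X \<subseteq> R" "finite X" "incongruent (multiples r) X"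
  shows "card X \<le> Q ^ w"
proof -
  have "\<exists>N. X \<subseteq> R_upto N" using X(2,1)
  proof (induction X)
    case (insert x X)
    then obtain N where N: "X \<subseteq> R_upto N" by auto
    obtain N' where N': "x \<in> R_upto N'" using insert R_eq_Union by blast
    have "insert x X \<subseteq> R_upto (max N N')"
      using N N' R_upto_mono[of N "max N N'"] R_upto_mono[of N' "max N N'"] by auto
    then show ?case by blast
  qed simp
  then obtain N0 where N0: "X \<subseteq> R_upto N0" by blast
  \<comment> \<open>The summand n q brings K and N into the range where
    \<open>card_monomials_upto\<close> is exact; N0 makes room for X.\<close>
  define K N where "K = N0 + n * q" and "N = K + w"
  define A where "A = (*) r ` R_upto K"
  have A: "A \<subseteq> R_upto N" "A \<subseteq> multiples r"
    using R_upto_mult[OF r(1), of _ K] R_upto_R by (auto simp: A_def N_def multiples_def add.commute)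
  have cA: "card A = Q ^ card (monomials_upto K)"
    unfolding A_def card_R_upto[symmetric] using r(2) by (intro card_image) (auto simp: inj_on_def)
  have XN: "X \<subseteq> R_upto N" using N0 R_upto_mono[of N0 N] by (auto simp: N_def K_def)
  have "inj_on (\<lambda>(x, a). x + a) (X \<times> A)"
  proof (rule inj_onI)
    fix u v assume uv: "u \<in> X \<times> A" "v \<in> X \<times> A" "(\<lambda>(x, a). x + a) u = (\<lambda>(x, a). x + a) v"
    obtain x a x' a' where xa: "u = (x, a)" "v = (x', a')" by (cases u; cases v)
    have "x - x' = a' - a" using uv xa by (simp add: algebra_simps)
    moreover have "a' \<in> multiples r" "a \<in> multiples r" using uv xa A by auto
    ultimately have "x - x' \<in> multiples r" using multiples_diff by metis
    then have "x = x'" using X uv xa by (auto simp: incongruent_def)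
    then show "u = v" using uv xa by simp
  qed
  moreover have "(\<lambda>(x, a). x + a) ` (X \<times> A) \<subseteq> R_upto N"
    using XN A by (auto intro!: vs.subspace_add[OF subspace_R_upto])
  ultimately have "card (X \<times> A) \<le> card (R_upto N)"
    using finite_R_upto by (rule card_inj_on_le)
  then have "card X * Q ^ card (monomials_upto K) \<le> Q ^ card (monomials_upto N)"
    by (simp add: card_cartesian_product cA card_R_upto)
  also have "card (monomials_upto N) = w + card (monomials_upto K)"
    using card_monomials_upto[of N] card_monomials_upto[of K] by (simp add: N_def K_def)
  finally show ?thesis using Q_gt_1 by (simp add: power_add)
qed

lemma sequence_congruent:
  assumes r: "r \<in> R" "r \<noteq> 0" and g: "\<And>i. g i \<in> R"
  shows "\<exists>i j :: nat. i < j \<and> g i - g j \<in> multiples r"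
proof (rule ccontr)
  assume no: "\<not> ?thesis"
  have no': "g i - g j \<notin> multiples r" if "i < j" for i j using no that by blast
  have neq: "i = j" if "g i - g j \<in> multiples r" for i j
  proof (rule ccontr)
    assume "i \<noteq> j"
    moreover have "g j - g i \<in> multiples r" using that multiples_diff[OF multiples_0 that] by simp
    ultimately show False using no' that by (meson linorder_neqE_nat)
  qed
  obtain w where w: "r \<in> R_upto w" using r R_eq_Union by blast
  have "inj_on g {..Q ^ w}" using neq multiples_0 by (intro inj_onI) auto
  then have "card (g ` {..Q ^ w}) = Q ^ w + 1" by (simp add: card_image)
  moreover have "card (g ` {..Q ^ w}) \<le> Q ^ w"
    by (rule incongruent_card_le[OF w r(2)]) (use g neq in \<open>auto simp: incongruent_def\<close>)
  ultimately show False by simp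
qed

lemmas frobenius_add = power_char2[OF char2]

text \<open>In characteristic 2 this is t^(2^M) - t, whose roots in t are the elements of the field
  with 2^M elements, each of them simple.\<close>

definition f :: "nat \<Rightarrow> 'h" where "f M = t ^ (2 ^ M) + t"

lemma f_R: "f M \<in> R"
  using R_gens R_subring by (auto simp: f_def subring_closed)

lemma f_monomials: "M \<ge> 1 \<Longrightarrow> f M = (\<Sum>p\<in>{(2 ^ M, 0), (1, 0)}. \<iota> 1 * T p)"
  by (simp add: f_def T_def \<iota>_simps)

lemma f_nonzero: "M \<ge> 1 \<Longrightarrow> f M \<noteq> 0"
  unfolding f_monomials by (rule sum_nonzero) (use q_ge_2 in \<open>auto simp: monomials_def\<close>)

lemma f_leading: "M \<ge> 1 \<Longrightarrow> f M * \<rho> ^ (q * 2 ^ M) \<in> V_inf - nonunits V_inf"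
proof -
  assume M: "M \<ge> 1"
  then have "(1 :: nat) < 2 ^ M" using one_less_power[of "2 :: nat" M] by simp
  then have "(\<Sum>p\<in>{(2 ^ M, 0), (1, 0)}. \<iota> 1 * T p) * \<rho> ^ weight (2 ^ M, 0) - \<iota> 1 \<in> nonunits V_inf"
    using q_ge_2 by (intro inf.leading_term) (auto simp: weight_def)
  then show ?thesis using inf.congruent_const_unit[of _ 1] M by (simp add: f_monomials weight_def)
qed

lemma f_R_upto: "M \<ge> 1 \<Longrightarrow> f M \<in> R_upto (q * 2 ^ M)"
  using R_upto_iff[OF f_R] f_leading by blast

text \<open>Two powers t^(2^i), t^(2^j) agree modulo r by pigeonhole, and their difference is the
  2^i-th power of \<open>f (j - i)\<close>.\<close>

lemma divides_f_power:
  assumes r: "r \<in> R" "r \<noteq> 0"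
  obtains M K where "M \<ge> 1" "f M ^ K \<in> multiples r"
proof -
  obtain i j where ij: "i < j" "t ^ (2 ^ i) - t ^ (2 ^ j) \<in> multiples r"
    using sequence_congruent[OF r, of "\<lambda>i. t ^ (2 ^ i)"] R_gens subring_power[OF R_subring] by blast
  have "(2 :: nat) ^ j = 2 ^ (j - i) * 2 ^ i" using ij(1) by (simp flip: power_add)
  then have "f (j - i) ^ (2 ^ i) = t ^ (2 ^ j) + t ^ (2 ^ i)"
    by (simp add: f_def frobenius_add flip: power_mult)
  also have "\<dots> = t ^ (2 ^ i) - t ^ (2 ^ j)" using minus_self[of "t ^ (2 ^ j)"] by (metis add.commute diff_conv_add_uminus)
  finally show ?thesis using that[of "j - i" "2 ^ i"] ij by simp
qed

text \<open>Squaring is injective in characteristic 2, hence surjective on the finite field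
  k.\<close>

lemma square_root_const: "\<exists>d :: 'k. d\<^sup>2 = c"
proof -
  have c2: "(1 :: 'k) + 1 = 0"
  proof -
    have "\<iota> (1 + 1) = \<iota> 0" by (simp only: \<iota>_simps char2)
    then show ?thesis using \<iota>_simps(10) by blast
  qed
  have "inj (\<lambda>d :: 'k. d\<^sup>2)"
  proof (rule injI)
    fix a b :: 'k assume "a\<^sup>2 = b\<^sup>2"
    then have "(a + b) * (a - b) = 0" by (simp add: power2_eq_square algebra_simps)
    moreover have "a + b = a - b"
    proof -
      have "b + b = (1 + 1) * b" by (simp add: distrib_right)
      then have "b + b = 0" using c2 by simp
      then have "- b = b" by (rule minus_unique)
      then show ?thesis by (metis diff_conv_add_uminus)
    qed
    ultimately show "a = b" by simp
  qed
  then show ?thesis using finite_UNIV_inj_surj[OF finite_const] by (metis surjD)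
qed

text \<open>Modulo \<open>t^(2^M) + t\<close> every element of \<open>k[t, y]\<close> is a square, because \<open>y\<close> is
  \<open>(y^(q/2))^2 + t^n\<close>.  On the finite residue ring squaring is therefore injective, i.e. the
  residue ring is reduced.\<close>

lemma square_mod_f:
  assumes M: "M \<ge> 1" and r: "r \<in> R"
  shows "\<exists>s\<in>R. r - s\<^sup>2 \<in> multiples (f M)"
proof -
  note c = subring_closed[OF R_subring]
  define S where "S = {r \<in> R. \<exists>s\<in>R. r - s\<^sup>2 \<in> multiples (f M)}"
  have SI: "r \<in> S" if "r \<in> R" "s \<in> R" "r - s\<^sup>2 \<in> multiples (f M)" for r s using that by (auto simp: S_def)
  have sq: "s\<^sup>2 \<in> S" if "s \<in> R" for s using SI[of "s\<^sup>2" s] that c multiples_0 by simp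
  have add: "a + b \<in> S" if ab: "a \<in> S" "b \<in> S" for a b
  proof -
    obtain s s' where s: "a \<in> R" "b \<in> R" "s \<in> R" "s' \<in> R" "a - s\<^sup>2 \<in> multiples (f M)" "b - s'\<^sup>2 \<in> multiples (f M)"
      using ab by (auto simp: S_def)
    have "(a - s\<^sup>2) + (b - s'\<^sup>2) \<in> multiples (f M)" using s multiples_add by blast
    moreover have "(a - s\<^sup>2) + (b - s'\<^sup>2) = (a + b) - (s + s')\<^sup>2"
      using frobenius_add[of s s' 1] by simp
    ultimately show ?thesis using SI[of "a + b" "s + s'"] s c by metis
  qed
  have mult: "a * b \<in> S" if ab: "a \<in> S" "b \<in> S" for a b
  proof -
    obtain s s' where s: "a \<in> R" "b \<in> R" "s \<in> R" "s' \<in> R" "a - s\<^sup>2 \<in> multiples (f M)" "b - s'\<^sup>2 \<in> multiples (f M)"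
      using ab by (auto simp: S_def)
    have "a * (b - s'\<^sup>2) + s'\<^sup>2 * (a - s\<^sup>2) \<in> multiples (f M)"
      using s c by (intro multiples_add multiples_mult) auto
    moreover have "a * (b - s'\<^sup>2) + s'\<^sup>2 * (a - s\<^sup>2) = a * b - (s * s')\<^sup>2"
      by (simp add: algebra_simps)
    ultimately show ?thesis using SI[of "a * b" "s * s'"] s c by metis
  qed
  have 1: "1 \<in> S" using sq[of 1] c by simp
  have pow: "a ^ k \<in> S" if "a \<in> S" for a k by (induction k) (use 1 mult that in auto)
  have t: "t \<in> S"
  \<comment> \<open>Modulo \<open>f M\<close> one has t = t^(2^M), the square of
    t^(2^(M-1)).\<close>
  proof (rule SI[of _ "t ^ (2 ^ (M - 1))"])
    have "(2 :: nat) ^ M = 2 ^ (M - 1) * 2" using M by (cases M) auto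
    then have "(t ^ (2 ^ (M - 1)))\<^sup>2 = t ^ (2 ^ M)" by (simp flip: power_mult)
    moreover have "t - t ^ (2 ^ M) = f M * 1" using minus_self[of "t ^ (2 ^ M)"]
      by (metis add.commute diff_conv_add_uminus f_def mult.right_neutral)
    ultimately show "t - (t ^ (2 ^ (M - 1)))\<^sup>2 \<in> multiples (f M)"
      using c(1) unfolding multiples_def by (intro image_eqI[of _ _ 1]) auto
  qed (use R_gens c in auto)
  have y: "y \<in> S"
  proof -
    have "q = 2 ^ (e - 1) * 2" using e q by (cases e) auto
    then have "y ^ q = (y ^ (2 ^ (e - 1)))\<^sup>2" by (simp flip: power_mult)
    then have "y ^ q \<in> S" using sq R_gens c by simp
    moreover have "y = y ^ q + t ^ n" using curve double_0[of "y ^ q"] by (metis add.assoc add.left_neutral)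
    ultimately show ?thesis using add pow[OF t] by metis
  qed
  have const: "\<iota> a \<in> S" for a
    using square_root_const[of a] sq[OF R_gens(3)] by (metis \<iota>_simps(7))
  have "vs.subspace S"
  proof (rule vs.subspaceI)
    show "0 \<in> S" using const[of 0] by (simp add: \<iota>_simps)
  qed (use add mult const in auto)
  moreover have "T ` monomials \<subseteq> S" using mult pow t y by (auto simp: T_def)
  ultimately have "R \<subseteq> S" unfolding R_def[symmetric] using vs.span_minimal R_def by metis
  then show ?thesis using r by (auto simp: S_def)
qed

text \<open>An incongruent set of greatest size, which exists by \<open>incongruent_card_le\<close>,
  meets every class.\<close>

lemma complete_residues:
  assumes r: "r \<in> R" "r \<noteq> 0"
  shows "\<exists>X. X \<subseteq> R \<and> finite X \<and> incongruent (multiples r) X \<and>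
    (\<forall>z\<in>R. \<exists>x\<in>X. z - x \<in> multiples r)"
proof -
  define P where "P X \<longleftrightarrow> X \<subseteq> R \<and> finite X \<and> incongruent (multiples r) X" for X
  obtain w where w: "r \<in> R_upto w" using r R_eq_Union by blast
  have "P {}" by (simp add: P_def incongruent_def)
  moreover have "\<forall>X. P X \<longrightarrow> card X < Suc (Q ^ w)"
    using incongruent_card_le[OF w r(2)] by (simp add: P_def less_Suc_eq_le)
  ultimately obtain X where X: "P X" and max: "\<And>Y. P Y \<Longrightarrow> card Y \<le> card X"
    using ex_has_greatest_nat[of P "{}" card "Suc (Q ^ w)"] by blast
  have "\<exists>x\<in>X. z - x \<in> multiples r" if z: "z \<in> R" for z
  proof (rule ccontr)
    assume no: "\<not> ?thesis"
    have no': "x - z \<notin> multiples r" if "x \<in> X" for x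
      using no that multiples_diff[OF multiples_0, of "x - z"] by force
    have "z \<notin> X" using no multiples_0 by force
    moreover have "P (insert z X)" using X z no no' by (auto simp: P_def incongruent_def)
    ultimately show False using max[of "insert z X"] X by (simp add: P_def)
  qed
  then show ?thesis using X by (auto simp: P_def)
qed

text \<open>On a finite system X of representatives, x -> rep (x^2) is onto by
  \<open>square_mod_f\<close>, hence injective; the classes of u and of 0 have the same
  square.\<close>

lemma residue_ring_reduced:
  assumes M: "M \<ge> 1" and u: "u \<in> R" "u\<^sup>2 \<in> multiples (f M)"
  shows "u \<in> multiples (f M)"
proof -
  let ?I = "multiples (f M)"
  note c = subring_closed[OF R_subring]
  obtain X where X: "X \<subseteq> R" "finite X" "incongruent ?I X" "\<And>z. z \<in> R \<Longrightarrow> \<exists>x\<in>X. z - x \<in> ?I"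
    using complete_residues[OF f_R f_nonzero[OF M]] by blast
  obtain rep where rep: "\<And>z. z \<in> R \<Longrightarrow> rep z \<in> X" "\<And>z. z \<in> R \<Longrightarrow> z - rep z \<in> ?I" using X(4) by metis
  have rep_eq: "rep z = x" if "z \<in> R" "x \<in> X" "z - x \<in> ?I" for z x
  proof -
    have "(z - x) - (z - rep z) \<in> ?I" using that rep multiples_diff by blast
    then show ?thesis using X(3) rep(1)[OF that(1)] that by (simp add: incongruent_def)
  qed
  have sq: "a\<^sup>2 - b\<^sup>2 \<in> ?I" if "a - b \<in> ?I" "a \<in> R" "b \<in> R" for a b
    using multiples_mult[of "a + b" "a - b"] that c by (simp add: power2_eq_square algebra_simps)
  have "X \<subseteq> (\<lambda>x. rep (x\<^sup>2)) ` X"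
  proof
    fix x assume x: "x \<in> X"
    then have xR: "x \<in> R" using X by blast
    then obtain s where s: "s \<in> R" "x - s\<^sup>2 \<in> ?I" using square_mod_f[OF M] by blast
    define x' where "x' = rep s"
    have x': "x' \<in> X" "s - x' \<in> ?I" "x' \<in> R" using rep[OF s(1)] X(1) by (auto simp: x'_def)
    have "s\<^sup>2 - x \<in> ?I" using multiples_diff[OF multiples_0 s(2)] by simp
    then have "(s\<^sup>2 - x) - (s\<^sup>2 - x'\<^sup>2) \<in> ?I"
      using sq[OF x'(2) s(1) x'(3)] by (rule multiples_diff)
    then have "x'\<^sup>2 - x \<in> ?I" by simp
    then have "rep (x'\<^sup>2) = x" by (intro rep_eq c(7) x x'(3))
    then show "x \<in> (\<lambda>x. rep (x\<^sup>2)) ` X" using x' by blast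
  qed
  then have inj: "inj_on (\<lambda>x. rep (x\<^sup>2)) X" by (rule finite_surj_inj[OF X(2)])
  \<comment> \<open>0 need not belong to X, so its class is represented by z.\<close>
  define z where "z = rep 0"
  define x where "x = rep u"
  have z: "z \<in> X" "z \<in> R" "0 - z \<in> ?I" using rep[OF c(2)] X(1) by (auto simp: z_def)
  have x: "x \<in> X" "x \<in> R" "u - x \<in> ?I" using rep[OF u(1)] X(1) by (auto simp: x_def)
  have z2: "0\<^sup>2 - z\<^sup>2 \<in> ?I" by (rule sq[OF z(3) c(2) z(2)])
  have x2: "u\<^sup>2 - x\<^sup>2 \<in> ?I" by (rule sq[OF x(3) u(1) x(2)])
  have "(u\<^sup>2 - x\<^sup>2) - (0\<^sup>2 - z\<^sup>2) - u\<^sup>2 \<in> ?I"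
    by (rule multiples_diff[OF multiples_diff[OF x2 z2] u(2)])
  then have zx: "z\<^sup>2 - x\<^sup>2 \<in> ?I" by simp
  have "z\<^sup>2 - rep (x\<^sup>2) \<in> ?I"
  proof -
    have "(z\<^sup>2 - x\<^sup>2) + (x\<^sup>2 - rep (x\<^sup>2)) \<in> ?I" by (intro multiples_add zx rep(2) c(7) x(2))
    then show ?thesis by simp
  qed
  then have "rep (z\<^sup>2) = rep (x\<^sup>2)" by (intro rep_eq c(7) z(2) rep(1) x(2))
  then have "z = x" using inj_onD[OF inj _ z(1) x(1)] by blast
  then have "(u - x) - (0 - z) \<in> ?I" by (intro multiples_diff x(3) z(3))
  then show ?thesis using \<open>z = x\<close> by simp
qed

text \<open>Since k <= 2^k, the exponent may be raised to a power of two and then halved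
  repeatedly.\<close>

lemma residue_ring_reduced_power:
  assumes M: "M \<ge> 1" and u: "u \<in> R" "u ^ k \<in> multiples (f M)"
  shows "u \<in> multiples (f M)"
proof -
  note c = subring_closed[OF R_subring]
  have *: "u ^ (2 ^ i) \<in> multiples (f M) \<Longrightarrow> u \<in> multiples (f M)" for i
  proof (induction i)
    case (Suc i)
    have "(u ^ (2 ^ i))\<^sup>2 = u ^ (2 ^ Suc i)" by (simp add: mult.commute flip: power_mult)
    then have "u ^ (2 ^ i) \<in> multiples (f M)" using Suc residue_ring_reduced[OF M, of "u ^ (2 ^ i)"] u c by simp
    then show ?case using Suc by blast
  qed simp
  have "k \<le> 2 ^ k" by (simp add: less_imp_le)
  then have "u ^ (2 ^ k) = u ^ (2 ^ k - k) * u ^ k" by (simp flip: power_add)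
  then have "u ^ (2 ^ k) \<in> multiples (f M)" using u c multiples_mult by simp
  then show ?thesis by (rule *)
qed

text \<open>Makes r^N idempotent modulo \<open>f M\<close>, which does the work of decomposing the
  reduced finite ring R/(f M) into fields.\<close>

lemma power_fixed_mod_f:
  assumes M: "M \<ge> 1" and r: "r \<in> R"
  obtains N where "N \<ge> 1" "r ^ (N + 1) - r \<in> multiples (f M)"
proof -
  note c = subring_closed[OF R_subring]
  obtain i j where ij: "i < j" "r ^ (2 ^ i) - r ^ (2 ^ j) \<in> multiples (f M)"
    using sequence_congruent[OF f_R f_nonzero[OF M], of "\<lambda>i. r ^ (2 ^ i)"] c(7)[OF r] by blast
  have "(2 :: nat) ^ j = 2 ^ (j - i) * 2 ^ i" using ij(1) by (simp flip: power_add)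
  \<comment> \<open>The coincidence of two iterated squares is a 2^i-th power by Frobenius, and
    reducedness removes the exponent; N is 2^(j-i) - 1.\<close>
  then have "(r ^ (2 ^ (j - i)) + r) ^ (2 ^ i) = r ^ (2 ^ j) + r ^ (2 ^ i)"
    by (simp add: frobenius_add flip: power_mult)
  also have "\<dots> = r ^ (2 ^ i) - r ^ (2 ^ j)" using minus_self[of "r ^ (2 ^ j)"] by (metis add.commute diff_conv_add_uminus)
  finally have "r ^ (2 ^ (j - i)) + r \<in> multiples (f M)"
    using residue_ring_reduced_power[OF M, of "r ^ (2 ^ (j - i)) + r" "2 ^ i"] ij r c by simp
  then have "r ^ (2 ^ (j - i)) - r \<in> multiples (f M)"
    using minus_self[of r] by (metis diff_conv_add_uminus)
  moreover have "(2 :: nat) ^ (j - i) = (2 ^ (j - i) - 1) + 1" by simp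
  moreover have "(2 :: nat) ^ (j - i) - 1 \<ge> 1"
  proof -
    have "(2 :: nat) ^ 1 \<le> 2 ^ (j - i)" using ij(1) by (intro power_increasing) auto
    then show ?thesis by simp
  qed
  ultimately show ?thesis using that by metis
qed

end

section \<open>Finite places\<close>

locale finite_valuation = artin_schreier_curve \<iota> q n e t y F + valuation \<iota> F V
  for \<iota> :: "'k::field \<Rightarrow> 'h::field" and q n e t y F V +
  assumes t_in: "t \<in> V"
begin

abbreviation "\<mm> \<equiv> nonunits V"

lemma y_in: "y \<in> V"
proof (rule ccontr)
  assume y: "y \<notin> V"
  then have iy: "inverse y \<in> \<mm>" "y \<noteq> 0" using not_in_R_inverse F_gens R_0 by auto
  have "t ^ n * inverse y ^ q \<in> \<mm>"
    using t_in R_power power_nonunits[OF iy(1)] q_ge_2 by (intro nonunits_mult) auto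
  moreover have "t ^ n * inverse y ^ q = 1 + inverse y ^ (q - 1)"
  proof -
    have "y ^ q = y * y ^ (q - 1)" using q_ge_2 by (cases q) auto
    then show ?thesis using iy(2) by (simp add: field_simps flip: curve)
  qed
  moreover have "inverse y ^ (q - 1) \<in> \<mm>" using power_nonunits[OF iy(1)] q_ge_2 by simp
  ultimately have "1 \<in> \<mm>" using nonunits_diff[of "1 + inverse y ^ (q - 1)" "inverse y ^ (q - 1)"] by simp
  then show False using nonunits_1 by blast
qed

lemma R_V: "R \<subseteq> V"
proof -
  have "vs.subspace V" by (auto intro!: vs.subspaceI R_0 R_add R_mult const_R)
  moreover have "T p \<in> V" for p
    using t_in y_in by (simp add: T_def R_mult R_power)
  ultimately show ?thesis unfolding R_def by (intro vs.span_minimal) auto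
qed

lemma multiples_nonunits: "r \<in> \<mm> \<Longrightarrow> multiples r \<subseteq> \<mm>"
  using R_V nonunits_mult' by (auto simp: multiples_def)

text \<open>Some nonzero r in \<open>R\<close> vanishes at the place, as otherwise V would contain
  all fractions, i.e. F. A power of some \<open>f M\<close> is a multiple of r.\<close>

lemma f_nonunit_exists: "\<exists>M\<ge>1. f M \<in> \<mm>"
proof -
  have "\<exists>r\<in>R. r \<noteq> 0 \<and> r \<in> \<mm>"
  proof (rule ccontr)
    assume no: "\<not> ?thesis"
    have "F \<subseteq> V"
    proof
      fix z assume "z \<in> F"
      then obtain r s where "r \<in> R" "s \<in> R" "s \<noteq> 0" "z = r / s" by (rule fraction)
      moreover from this have "inverse s \<in> V" using no R_V unit_inverse by blast
      ultimately show "z \<in> V" using R_V R_mult by (auto simp: divide_inverse)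
    qed
    then show False using valuation_ring by (auto simp: valuation_ring_def)
  qed
  then obtain r where r: "r \<in> R" "r \<noteq> 0" "r \<in> \<mm>" by blast
  obtain M K where "M \<ge> 1" "f M ^ K \<in> multiples r" using divides_f_power[OF r(1,2)] .
  then have "f M \<in> \<mm>" using multiples_nonunits[OF r(3)] nonunits_power f_R R_V by blast
  then show ?thesis using \<open>M \<ge> 1\<close> by blast
qed

context
  fixes M assumes M: "M \<ge> 1" and fM: "f M \<in> \<mm>"
begin

text \<open>With r^(N+1) congruent to r, the product r (1 - r^N) is a multiple of
  \<open>f M\<close>, and 1 - r^N is a unit because r^N vanishes. So \<open>f M\<close> generates
  the maximal ideal: the place is unramified over the t-line.\<close>

lemma nonunit_multiple_f:
  assumes r: "r \<in> R" "r \<in> \<mm>"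
  obtains b h where "b \<in> R - \<mm>" "h \<in> R" "r * b = f M * h"
proof -
  obtain N where N: "N \<ge> 1" "r ^ (N + 1) - r \<in> multiples (f M)"
    using power_fixed_mod_f[OF M r(1)] .
  then obtain h where h: "h \<in> R" "r ^ (N + 1) - r = f M * h" by (auto simp: multiples_def)
  have "r * (1 - r ^ N) = - (r ^ (N + 1) - r)" by (simp add: algebra_simps)
  also have "\<dots> = f M * (- h)" using h(2) by simp
  finally have "r * (1 - r ^ N) = f M * (- h)" .
  moreover have "1 - r ^ N \<in> R" "- h \<in> R" using r h R_subring by (auto simp: subring_closed)
  moreover have "1 - r ^ N \<notin> \<mm>"
  proof
    assume "1 - r ^ N \<in> \<mm>"
    then have "(1 - r ^ N) + r ^ N \<in> \<mm>" using power_nonunits[OF r(2)] N(1) by (intro nonunits_add) auto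
    then show False using nonunits_1 by simp
  qed
  ultimately show ?thesis using that by blast
qed

lemma unit_power_congruent_1:
  assumes r: "r \<in> R" "r \<notin> \<mm>"
  obtains N where "N \<ge> 1" "r ^ N - 1 \<in> \<mm>"
proof -
  obtain N where N: "N \<ge> 1" "r ^ (N + 1) - r \<in> multiples (f M)"
    using power_fixed_mod_f[OF M r(1)] .
  then have "r * (r ^ N - 1) \<in> \<mm>" using multiples_nonunits[OF fM] by (auto simp: algebra_simps)
  moreover have "r \<in> V" "r ^ N - 1 \<in> V" using r R_V R_power R_diff R_1 by auto
  ultimately show ?thesis using that N nonunits_prime r by blast
qed

lemma nonunit_multiple_f': "r \<in> R \<Longrightarrow> r \<in> \<mm> \<Longrightarrow> \<exists>u\<in>V. r = f M * u"
proof -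
  assume "r \<in> R" "r \<in> \<mm>"
  then obtain b h where bh: "b \<in> R - \<mm>" "h \<in> R" "r * b = f M * h" by (rule nonunit_multiple_f)
  then have "inverse b \<in> V" "b \<noteq> 0" using unit_inverse R_V by blast+
  moreover from this have "r = f M * (h * inverse b)" using bh(3) by (simp add: field_simps)
  ultimately show ?thesis using bh R_V R_mult by blast
qed

text \<open>r divides some f M'^K, and \<open>f M'\<close> divides \<open>f M\<close> in V. If f M^k
  divided r with k > K, then \<open>f M\<close> would divide 1.\<close>

lemma f_order_bounded:
  assumes r: "r \<in> R" "r \<noteq> 0"
  shows "\<exists>K. \<forall>k>K. \<forall>u\<in>V. r \<noteq> f M ^ k * u"
proof -
  obtain M' K where K: "M' \<ge> 1" "f M' ^ K \<in> multiples r" using divides_f_power[OF r] .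
  then obtain h where h: "h \<in> R" "f M' ^ K = r * h" by (auto simp: multiples_def)
  \<comment> \<open>If \<open>f M'\<close> vanishes at the place, it generates the maximal ideal too
    and divides \<open>f M\<close>; otherwise it is a unit.\<close>
  obtain v where v: "v \<in> V" "f M = f M' * v"
  proof (cases "f M' \<in> \<mm>")
    case True
    then show ?thesis using finite_valuation.nonunit_multiple_f'[OF finite_valuation_axioms K(1) True f_R fM] that by blast
  next
    case False
    then have "inverse (f M') \<in> V" "f M' \<noteq> 0" using unit_inverse f_R R_V by blast+
    then have "f M = f M' * (f M * inverse (f M'))" "f M * inverse (f M') \<in> V"
      using fM nonunits_R R_mult by auto
    then show ?thesis using that by blast
  qed
  have f0: "f M' \<noteq> 0" using f_nonzero K by blast
  have "r \<noteq> f M ^ k * u" if "k > K" "u \<in> V" for k u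
  proof
    assume eq: "r = f M ^ k * u"
    have "f M ^ k = f M ^ K * f M ^ (k - K)" using that by (simp flip: power_add)
    then have "f M' ^ K * 1 = f M' ^ K * (f M ^ (k - K) * (v ^ K * u * h))"
      using h eq v(2) by (simp add: power_mult_distrib algebra_simps)
    then have "1 = f M ^ (k - K) * (v ^ K * u * h)" using f0 by simp
    moreover have "f M ^ (k - K) * (v ^ K * u * h) \<in> \<mm>"
      using that v h R_V by (intro nonunits_mult' power_nonunits fM R_mult R_power) auto
    ultimately show False using nonunits_1 by simp
  qed
  then show ?thesis by blast
qed

text \<open>\<open>f M\<close> is split off as long as the cofactor a vanishes at the place;
  \<open>f_order_bounded\<close> stops this. The denominator b collects the units from
  \<open>nonunit_multiple_f\<close>.\<close>

lemma f_expansion_R: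
  assumes r: "r \<in> R" "r \<noteq> 0"
  obtains k a b where "a \<in> R - \<mm>" "b \<in> R - \<mm>" "r * b = f M ^ k * a"
proof -
  define P where "P k \<longleftrightarrow> (\<exists>a\<in>R. \<exists>b\<in>R - \<mm>. r * b = f M ^ k * a)" for k
  have "1 \<in> R - \<mm>" using nonunits_1 R_subring by (simp add: subring_1)
  then have "P 0" using r unfolding P_def by (intro bexI[of _ r] bexI[of _ 1]) auto
  moreover obtain K where K: "\<And>k u. k > K \<Longrightarrow> u \<in> V \<Longrightarrow> r \<noteq> f M ^ k * u"
    using f_order_bounded[OF r] by blast
  have "k < Suc K" if Pk: "P k" for k
  proof (rule ccontr)
    assume "\<not> k < Suc K"
    obtain a b where ab: "a \<in> R" "b \<in> R - \<mm>" "r * b = f M ^ k * a"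
      using Pk unfolding P_def by blast
    then have b: "inverse b \<in> V" "b \<noteq> 0" using unit_inverse R_V by blast+
    then have "r = f M ^ k * (a * inverse b)" using ab(3) by (simp add: field_simps)
    moreover have "a * inverse b \<in> V" using ab b R_V R_mult by blast
    ultimately show False using K \<open>\<not> k < Suc K\<close> by auto
  qed
  ultimately obtain k where k: "P k" and max: "\<And>k'. P k' \<Longrightarrow> k' \<le> k"
    using ex_has_greatest_nat[of P 0 "\<lambda>k. k" "Suc K"] by blast
  obtain a b where ab: "a \<in> R" "b \<in> R - \<mm>" "r * b = f M ^ k * a"
    using k unfolding P_def by blast
  have "a \<notin> \<mm>"
  proof
    assume "a \<in> \<mm>"
    then obtain b' h where h: "b' \<in> R - \<mm>" "h \<in> R" "a * b' = f M * h" using ab nonunit_multiple_f by blast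
    have "r * (b * b') = f M ^ k * (a * b')" using ab(3) by (simp add: mult.assoc[symmetric])
    then have "r * (b * b') = f M ^ Suc k * h" using h(3) by simp
    moreover have "b * b' \<in> R - \<mm>" using unit_mult ab h R_V R_mult_closed by blast
    ultimately have "P (Suc k)" using h unfolding P_def by blast
    then show False using max by force
  qed
  then show ?thesis using that ab by blast
qed

lemma f_expansion:
  assumes z: "z \<in> F" "z \<noteq> 0"
  obtains k a b where "a \<in> R - \<mm>" "b \<in> R - \<mm>" "z = f M powi k * (a / b)"
proof -
  obtain r s where rs: "r \<in> R" "s \<in> R" "s \<noteq> 0" "z = r / s" using fraction[OF z(1)] .
  have "r \<noteq> 0" using rs z by auto
  then obtain k a b where ab: "a \<in> R - \<mm>" "b \<in> R - \<mm>" "r * b = f M ^ k * a"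
    using f_expansion_R[OF rs(1)] by blast
  obtain k' a' b' where ab': "a' \<in> R - \<mm>" "b' \<in> R - \<mm>" "s * b' = f M ^ k' * a'"
    using f_expansion_R[OF rs(2,3)] by blast
  have nz: "a \<noteq> 0" "b \<noteq> 0" "a' \<noteq> 0" "b' \<noteq> 0" using ab ab' nonunits_0 by auto
  have "r = f M ^ k * a / b" "s = f M ^ k' * a' / b'"
    using ab(3) ab'(3) nz by (simp_all add: eq_divide_eq)
  then have "z = (f M ^ k * a / b) / (f M ^ k' * a' / b')" using rs(4) by simp
  also have "\<dots> = (f M ^ k / f M ^ k') * ((a * b') / (b * a'))" by (simp add: ac_simps)
  finally have "z = f M powi (int k - int k') * ((a * b') / (b * a'))"
    using f_nonzero[OF M] by (simp add: power_int_diff)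
  moreover have "a * b' \<in> R - \<mm>" "b * a' \<in> R - \<mm>"
    using unit_mult ab ab' R_V R_mult_closed by blast+
  ultimately show ?thesis using that by blast
qed

lemma quotient_unit: "a \<in> R - \<mm> \<Longrightarrow> b \<in> R - \<mm> \<Longrightarrow> a / b \<in> V - \<mm>"
  using unit_mult[of a "inverse b"] unit_inverse R_V by (auto simp: divide_inverse)

lemma finite_discrete: "discrete_place \<iota> F V (f M)"
proof unfold_locales
  show "f M \<in> \<mm>" "f M \<noteq> 0" using fM f_nonzero[OF M] by auto
  fix z assume "z \<in> F" "z \<noteq> 0"
  then obtain k a b where ab: "a \<in> R - \<mm>" "b \<in> R - \<mm>" "z = f M powi k * (a / b)" by (rule f_expansion)
  have "z * f M powi (- k) = a / b" using ab(3) f_nonzero[OF M] by (simp add: power_int_minus)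
  then show "\<exists>n. z * f M powi (- n) \<in> V - \<mm>" using quotient_unit[OF ab(1,2)] by metis
qed

lemma localization:
  assumes "z \<in> V"
  obtains a b where "a \<in> R" "b \<in> R - \<mm>" "z = a / b"
proof (cases "z = 0")
  case True
  have "1 \<in> R - \<mm>" using nonunits_1 R_subring by (simp add: subring_1)
  then show ?thesis using that[of 0 1] True subring_0[OF R_subring] by simp
next
  case False
  interpret d: discrete_place \<iota> F V "f M" by (rule finite_discrete)
  have "z \<in> F" using assms R_F by blast
  then obtain k a b where ab: "a \<in> R - \<mm>" "b \<in> R - \<mm>" "z = f M powi k * (a / b)"
    using False by (rule f_expansion)
  have "k \<ge> 0" using d.unit_times_\<pi>_powi(1)[OF quotient_unit[OF ab(1,2)], of k] ab(3) assms
    by (simp add: mult.commute)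
  then have "z = (f M ^ nat k * a) / b" using ab(3) by (simp add: power_int_def)
  moreover have "f M ^ nat k * a \<in> R" using ab f_R R_subring by (simp add: subring_closed)
  ultimately show ?thesis using that ab by blast
qed

text \<open>Denominators can be cleared in the residue field: if b^N is congruent to 1, then a/b is
  congruent to a b^(N-1).\<close>

lemma residue_representative:
  assumes "z \<in> V"
  obtains r where "r \<in> R" "z - r \<in> \<mm>"
proof -
  obtain a b where ab: "a \<in> R" "b \<in> R - \<mm>" "z = a / b" using assms by (rule localization)
  obtain N where N: "N \<ge> 1" "b ^ N - 1 \<in> \<mm>" using unit_power_congruent_1[of b] ab by blast
  have b: "inverse b \<in> V" "b \<noteq> 0" using ab(2) unit_inverse R_V by blast+
  have "b ^ N = b * b ^ (N - 1)" using N(1) by (cases N) auto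
  then have "z - a * b ^ (N - 1) = - ((a * inverse b) * (b ^ N - 1))"
    using b(2) ab(3) by (simp add: field_simps)
  moreover have "(a * inverse b) * (b ^ N - 1) \<in> \<mm>"
    using N ab b R_V by (intro nonunits_mult R_mult) auto
  ultimately have "z - a * b ^ (N - 1) \<in> \<mm>" using nonunits_uminus by simp
  moreover have "a * b ^ (N - 1) \<in> R" using ab R_subring by (simp add: subring_closed)
  ultimately show ?thesis using that by blast
qed

text \<open>Every residue class has a representative in \<open>R\<close>, and classes distinct
  modulo the place are distinct modulo \<open>f M\<close>, so |R/(f M)| bounds their number.\<close>

lemma finite_residue: "\<exists>B. quotient_basis \<iota> V \<mm> B"
proof -
  have V: "vs.subspace V" "vs.subspace \<mm>"
    using subspace_place[OF F_subfield is_place_nonunits] by (simp_all add: place_ring_nonunits)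
  have "card X \<le> Q ^ (q * 2 ^ M)" if X: "X \<subseteq> V" "finite X" "incongruent \<mm> X" for X
  proof -
    have "\<forall>x\<in>X. \<exists>r\<in>R. x - r \<in> \<mm>" using residue_representative X by blast
    then obtain g where g: "\<And>x. x \<in> X \<Longrightarrow> g x \<in> R" "\<And>x. x \<in> X \<Longrightarrow> x - g x \<in> \<mm>" by metis
    have eq: "x = x'" if x: "x \<in> X" "x' \<in> X" "g x - g x' \<in> \<mm>" for x x'
    proof -
      have "(x - g x) - (x' - g x') + (g x - g x') \<in> \<mm>"
        by (intro nonunits_add nonunits_diff g x)
      then show ?thesis using X x by (simp add: incongruent_def)
    qed
    have "inj_on g X" using eq nonunits_0 by (intro inj_onI) auto
    moreover have "incongruent (multiples (f M)) (g ` X)"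
      using eq multiples_nonunits[OF fM] unfolding incongruent_def by blast
    then have "card (g ` X) \<le> Q ^ (q * 2 ^ M)"
      using g X by (intro incongruent_card_le[OF f_R_upto[OF M] f_nonzero[OF M]]) auto
    ultimately show ?thesis by (simp add: card_image)
  qed
  then show ?thesis using quotient_basis_exists[OF V] by metis
qed

end

end

section \<open>Separation of finite places, Chinese remainders, integral closedness\<close>

context artin_schreier_curve
begin

definition finite_place :: "'h set \<Rightarrow> bool" where
  "finite_place P \<longleftrightarrow> is_place \<iota> F P \<and> t \<in> place_ring F P"

lemma finite_placeD:
  assumes "finite_place P"
  shows "finite_valuation \<iota> q n e t y F (place_ring F P)" "nonunits (place_ring F P) = P"
proof -
  have P: "is_place \<iota> F P" "t \<in> place_ring F P" using assms by (auto simp: finite_place_def)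
  interpret valuation \<iota> F "place_ring F P" using placeD[OF F_subfield P(1)] by blast
  show "finite_valuation \<iota> q n e t y F (place_ring F P)" using P by unfold_locales
  show "nonunits (place_ring F P) = P" using placeD[OF F_subfield P(1)] by blast
qed

lemma place_ring_P_inf: "place_ring F P_inf = V_inf"
  unfolding P_inf_def by (rule inf.place_ring_nonunits)

lemma is_place_P_inf: "is_place \<iota> F P_inf"
  unfolding P_inf_def by (rule inf.is_place_nonunits)

lemma is_place_iff: "is_place \<iota> F P \<longleftrightarrow> P = P_inf \<or> finite_place P"
proof
  assume P: "is_place \<iota> F P"
  interpret valuation \<iota> F "place_ring F P" using placeD[OF F_subfield P] by blast
  show "P = P_inf \<or> finite_place P"
  proof (cases "t \<in> place_ring F P")
    case False
    then have "infinite_ring (place_ring F P)" using valuation_ring by (simp add: infinite_ring_def)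
    then have "place_ring F P = V_inf" using infinite_ring_unique infinite_ring_V by blast
    then show ?thesis using placeD(2)[OF F_subfield P] by (simp add: P_inf_def)
  qed (use P finite_place_def in auto)
qed (use is_place_P_inf finite_place_def in auto)

lemma not_finite_place_P_inf: "\<not> finite_place P_inf"
  using infinite_ring_V by (simp add: finite_place_def place_ring_P_inf infinite_ring_def)

text \<open>An element of \<open>R\<close> in P' but outside P exists because the contractions to
  \<open>R\<close> are incomparable; a power of it is congruent to 1 modulo P.\<close>

lemma finite_place_nonsub:
  assumes P: "finite_place P" "finite_place P'" "P \<noteq> P'" and M: "M \<ge> 1" "f M \<in> P" "f M \<in> P'"
  obtains u where "u \<in> R" "u \<in> P'" "u - 1 \<in> P"
proof -
  \<comment> \<open>The contractions are maximal ideals: for r in P' outside P, the element r^N - 1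
    lies in P, hence in P', and so does r^N.\<close>
  have sub: "R \<inter> P' \<subseteq> P" if pp: "finite_place P" "finite_place P'" "f M \<in> P" "f M \<in> P'" "R \<inter> P \<subseteq> P'" for P P'
  proof
    fix r assume r: "r \<in> R \<inter> P'"
    interpret v: finite_valuation \<iota> q n e t y F "place_ring F P" using finite_placeD pp by blast
    interpret v': finite_valuation \<iota> q n e t y F "place_ring F P'" using finite_placeD pp by blast
    have nu: "v.\<mm> = P" "v'.\<mm> = P'" using finite_placeD pp by blast+
    show "r \<in> P"
    proof (rule ccontr)
      assume "r \<notin> P"
      then have "f M \<in> v.\<mm>" "r \<in> R" "r \<notin> v.\<mm>" using r pp(3) nu by auto
      then obtain N where N: "N \<ge> 1" "r ^ N - 1 \<in> v.\<mm>"
        by (rule v.unit_power_congruent_1[OF M(1)])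
      then have "r ^ N - 1 \<in> P" using nu by simp
      then have "r ^ N - 1 \<in> v'.\<mm>" using r pp R_subring nu by (auto simp: subring_closed)
      moreover have "r ^ N \<in> v'.\<mm>" using v'.power_nonunits r N nu by simp
      ultimately have "r ^ N - (r ^ N - 1) \<in> v'.\<mm>" using v'.nonunits_diff by blast
      then show False using v'.nonunits_1 by simp
    qed
  qed
  \<comment> \<open>Both rings are localizations of \<open>R\<close>, so inclusion of the ideals
    reverses to inclusion of the rings; equal contractions then give equal places.\<close>
  have ring_sub: "place_ring F P \<subseteq> place_ring F P'"
    if pp: "finite_place P" "finite_place P'" "f M \<in> P" "f M \<in> P'" "R \<inter> P' \<subseteq> P" for P P'
  proof
    fix z assume z: "z \<in> place_ring F P"
    interpret v: finite_valuation \<iota> q n e t y F "place_ring F P" using finite_placeD pp by blast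
    interpret v': finite_valuation \<iota> q n e t y F "place_ring F P'" using finite_placeD pp by blast
    have nu: "v.\<mm> = P" "v'.\<mm> = P'" using finite_placeD pp by blast+
    have "f M \<in> v.\<mm>" using pp(3) nu by simp
    then obtain a b where "a \<in> R" "b \<in> R - v.\<mm>" "z = a / b" by (rule v.localization[OF M(1) _ z])
    then have ab: "a \<in> R" "b \<in> R - P" "z = a / b" using nu by auto
    then have "b \<notin> P'" using pp by blast
    then have "inverse b \<in> place_ring F P'" using ab v'.unit_inverse(1) v'.R_V nu by blast
    then show "z \<in> place_ring F P'" using ab v'.R_V v'.R_mult by (auto simp: divide_inverse)
  qed
  have "\<not> R \<inter> P' \<subseteq> P"
  proof
    assume 1: "R \<inter> P' \<subseteq> P"
    then have 2: "R \<inter> P \<subseteq> P'" using sub[OF P(2,1) M(3,2)] by blast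
    have "place_ring F P = place_ring F P'"
      using ring_sub[OF P(1,2) M(2,3) 1] ring_sub[OF P(2,1) M(3,2) 2] by blast
    then show False using finite_placeD(2)[OF P(1)] finite_placeD(2)[OF P(2)] P(3) by simp
  qed
  then obtain w where w: "w \<in> R" "w \<in> P'" "w \<notin> P" by blast
  interpret v: finite_valuation \<iota> q n e t y F "place_ring F P" using finite_placeD P by blast
  interpret v': finite_valuation \<iota> q n e t y F "place_ring F P'" using finite_placeD P by blast
  have nu: "v.\<mm> = P" "v'.\<mm> = P'" using finite_placeD P by blast+
  have "f M \<in> v.\<mm>" "w \<notin> v.\<mm>" using w M nu by auto
  then obtain N where "N \<ge> 1" "w ^ N - 1 \<in> v.\<mm>"
    by (rule v.unit_power_congruent_1[OF M(1) _ w(1)])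
  then have N: "N \<ge> 1" "w ^ N - 1 \<in> P" using nu by auto
  have "w ^ N \<in> P'" using v'.power_nonunits[of w N] w N nu by simp
  then show ?thesis using that[of "w ^ N"] N w R_subring by (simp add: subring_closed)
qed

text \<open>The product, over the places of S, of the elements that separate P from one place at a
  time.\<close>

lemma separating_element:
  assumes S: "finite S" "\<And>P'. P' \<in> S \<Longrightarrow> finite_place P' \<and> f M \<in> P' \<and> P' \<noteq> P"
    and P: "finite_place P" "f M \<in> P" and M: "M \<ge> 1"
  shows "\<exists>e\<in>R. e - 1 \<in> P \<and> (\<forall>P'\<in>S. e \<in> P')"
  using S
proof (induction S)
  case empty
  interpret v: finite_valuation \<iota> q n e t y F "place_ring F P" using finite_placeD P by blast
  have "0 \<in> P" using v.nonunits_0 finite_placeD(2)[OF P(1)] by simp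
  then show ?case using subring_1[OF R_subring] by (intro bexI[of _ 1]) auto
next
  case (insert P' S)
  then obtain e1 where e1: "e1 \<in> R" "e1 - 1 \<in> P" "\<forall>P'\<in>S. e1 \<in> P'" by blast
  have P': "finite_place P'" "f M \<in> P'" "P' \<noteq> P" using insert(4) by auto
  obtain e2 where e2: "e2 \<in> R" "e2 \<in> P'" "e2 - 1 \<in> P"
    using finite_place_nonsub[OF P(1) P'(1) _ M P(2) P'(2)] P'(3) by blast
  interpret v: finite_valuation \<iota> q n e t y F "place_ring F P" using finite_placeD P by blast
  have nu: "v.\<mm> = P" using finite_placeD P by blast
  have "e1 * (e2 - 1) + (e1 - 1) \<in> v.\<mm>"
    using e1 e2 nu v.R_V by (intro v.nonunits_add v.nonunits_mult) auto
  then have "e1 * e2 - 1 \<in> P" using nu by (simp add: algebra_simps)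
  moreover have "e1 * e2 \<in> P''" if "P'' \<in> insert P' S" for P''
  proof -
    have fp: "finite_place P''" using insert(4) that by blast
    interpret v'': finite_valuation \<iota> q n e t y F "place_ring F P''" using finite_placeD fp by blast
    have nu'': "v''.\<mm> = P''" using finite_placeD fp by blast
    show ?thesis
    proof (cases "P'' = P'")
      case True then show ?thesis using v''.nonunits_mult[of e1 e2] nu'' e1 e2 v''.R_V by auto
    next
      case False then show ?thesis using v''.nonunits_mult'[of e1 e2] nu'' e1 e2 v''.R_V that by auto
    qed
  qed
  ultimately show ?case using e1 e2 R_mult_closed by (intro bexI[of _ "e1 * e2"]) auto
qed

definition zeros :: "nat \<Rightarrow> 'h set set" where "zeros M = {P. finite_place P \<and> f M \<in> P}"

text \<open>The targets are first moved into \<open>R\<close> by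
  \<open>residue_representative\<close>, then combined with separating elements as weights.\<close>

lemma chinese_remainder:
  assumes S: "finite S" "S \<subseteq> zeros M" and M: "M \<ge> 1"
    and g: "\<And>P. P \<in> S \<Longrightarrow> g P \<in> place_ring F P"
  obtains r where "r \<in> R" "\<And>P. P \<in> S \<Longrightarrow> r - g P \<in> P"
proof -
  have "\<forall>P\<in>S. \<exists>e\<in>R. e - 1 \<in> P \<and> (\<forall>P'\<in>S - {P}. e \<in> P')"
    using S M by (intro ballI separating_element[of _ M]) (auto simp: zeros_def)
  then obtain E where E: "\<And>P. P \<in> S \<Longrightarrow> E P \<in> R" "\<And>P. P \<in> S \<Longrightarrow> E P - 1 \<in> P"
    "\<And>P P'. P \<in> S \<Longrightarrow> P' \<in> S \<Longrightarrow> P' \<noteq> P \<Longrightarrow> E P \<in> P'" by (metis DiffI singletonD)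
  have "\<exists>h\<in>R. g P - h \<in> P" if P: "P \<in> S" for P
  proof -
    have fp: "finite_place P" "f M \<in> P" using P S by (auto simp: zeros_def)
    interpret v: finite_valuation \<iota> q n e t y F "place_ring F P" using finite_placeD fp by blast
    have nu: "v.\<mm> = P" using finite_placeD fp by blast
    have "f M \<in> v.\<mm>" using fp nu by simp
    then obtain h where "h \<in> R" "g P - h \<in> v.\<mm>" by (rule v.residue_representative[OF M _ g[OF P]])
    then show ?thesis using nu by auto
  qed
  then obtain h where h: "\<And>P. P \<in> S \<Longrightarrow> h P \<in> R" "\<And>P. P \<in> S \<Longrightarrow> g P - h P \<in> P" by metis
  define r where "r = (\<Sum>P\<in>S. E P * h P)"
  have "r - g P \<in> P" if P: "P \<in> S" for P
  proof -
    have fp: "finite_place P" "f M \<in> P" using P S by (auto simp: zeros_def)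
    interpret v: finite_valuation \<iota> q n e t y F "place_ring F P" using finite_placeD fp by blast
    have nu: "v.\<mm> = P" using finite_placeD fp by blast
    have "(\<Sum>P'\<in>S - {P}. E P' * h P') \<in> v.\<mm>"
    proof (rule v.nonunits_sum)
      fix P' assume P': "P' \<in> S - {P}"
      then have "E P' \<in> v.\<mm>" using E(3)[of P' P] P unfolding nu by blast
      moreover have "h P' \<in> place_ring F P" using h(1)[of P'] P' v.R_V by blast
      ultimately show "E P' * h P' \<in> v.\<mm>" by (rule v.nonunits_mult')
    qed
    moreover have "(E P - 1) * h P \<in> v.\<mm>"
      using E(2) h(1) P nu v.R_V by (intro v.nonunits_mult') auto
    moreover have "- (g P - h P) \<in> v.\<mm>" using h P nu by (intro v.nonunits_uminus) auto
    ultimately have "(\<Sum>P'\<in>S - {P}. E P' * h P') + (E P - 1) * h P + - (g P - h P) \<in> v.\<mm>"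
      by (intro v.nonunits_add)
    moreover have "r = E P * h P + (\<Sum>P'\<in>S - {P}. E P' * h P')"
      unfolding r_def using S(1) P by (simp add: sum.remove)
    ultimately show ?thesis using nu by (simp add: algebra_simps)
  qed
  moreover have "r \<in> R" unfolding r_def using E h R_subring by (auto simp: subring_mult intro!: subring_sum)
  ultimately show ?thesis using that by blast
qed

lemma finite_place_basis:
  assumes "finite_place P"
  shows "\<exists>B. quotient_basis \<iota> (place_ring F P) P B"
proof -
  interpret v: finite_valuation \<iota> q n e t y F "place_ring F P" using finite_placeD assms by blast
  show ?thesis using v.f_nonunit_exists v.finite_residue finite_placeD(2)[OF assms] by metis
qed

lemma place_degree_pos:
  assumes P: "finite_place P"
  shows "place_degree \<iota> F P > 0"
proof -
  have pl: "is_place \<iota> F P" using P by (simp add: finite_place_def)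
  interpret v: finite_valuation \<iota> q n e t y F "place_ring F P" using finite_placeD P by blast
  obtain B where B: "quotient_basis \<iota> (place_ring F P) P B" using finite_place_basis[OF P] by blast
  have "B \<noteq> {}"
  proof
    assume "B = {}"
    then have "1 \<in> P" using B v.R_1 unfolding quotient_basis_def by auto
    then show False using v.nonunits_1 finite_placeD(2)[OF P] by simp
  qed
  then show ?thesis using place_degree_eq[OF F_subfield pl B] B by (simp add: quotient_basis_def card_gt_0_iff)
qed

text \<open>The Chinese remainder theorem embeds the product of the residue fields into the residue
  ring modulo \<open>f M\<close>, whose dimension is at most \<open>q * 2 ^ M\<close>.\<close>

lemma sum_place_degree_le:
  assumes S: "finite S" "S \<subseteq> zeros M" and M: "M \<ge> 1"
  shows "(\<Sum>P\<in>S. place_degree \<iota> F P) \<le> q * 2 ^ M"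
proof -
  have fp: "finite_place P" "f M \<in> P" if "P \<in> S" for P using that S by (auto simp: zeros_def)
  have pl: "is_place \<iota> F P" if "P \<in> S" for P using fp(1)[OF that] by (simp add: finite_place_def)
  have "\<forall>P\<in>S. \<exists>B. quotient_basis \<iota> (place_ring F P) P B" using finite_place_basis fp by blast
  then obtain B where B: "\<And>P. P \<in> S \<Longrightarrow> quotient_basis \<iota> (place_ring F P) P (B P)" by metis
  define \<C> where "\<C> = (\<Pi>\<^sub>E P\<in>S. (coordinates (B P) :: ('h \<Rightarrow> 'k) set))"
  have BV: "B P \<subseteq> place_ring F P" "finite (B P)" if "P \<in> S" for P
    using B[OF that] by (auto simp: quotient_basis_def)
  have comb: "comb (B P) c \<in> place_ring F P" if "P \<in> S" for P c
    using comb_in[OF subspace_place(1)[OF F_subfield pl] BV(1)] that by blast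
  have "\<forall>c. \<exists>r\<in>R. \<forall>P\<in>S. r - comb (B P) (c P) \<in> P"
    using chinese_remainder[OF S M, of "\<lambda>P. comb (B P) (c P)" for c] comb by metis
  then obtain r where r: "\<And>c. r c \<in> R" "\<And>c P. P \<in> S \<Longrightarrow> r c - comb (B P) (c P) \<in> P" by metis
  have eq: "c = c'" if c: "c \<in> \<C>" "c' \<in> \<C>" "r c - r c' \<in> multiples (f M)" for c c'
  proof (rule PiE_ext)
    show "c \<in> (\<Pi>\<^sub>E P\<in>S. coordinates (B P))" "c' \<in> (\<Pi>\<^sub>E P\<in>S. coordinates (B P))"
      using c by (simp_all add: \<C>_def)
    fix P assume P: "P \<in> S"
    interpret v: finite_valuation \<iota> q n e t y F "place_ring F P" using finite_placeD fp P by blast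
    have nu: "v.\<mm> = P" using finite_placeD fp P by blast
    have "r c - r c' \<in> P" using c(3) v.multiples_nonunits fp(2)[OF P] nu by blast
    then have "(r c - r c') - (r c - comb (B P) (c P)) + (r c' - comb (B P) (c' P)) \<in> P"
      using v.nonunits_diff[unfolded nu] v.nonunits_add[unfolded nu] r(2)[OF P] by blast
    then have 2: "comb (B P) (c P) - comb (B P) (c' P) \<in> P" by simp
    have 3: "comb (B P) (c P) - comb (B P) (c P) \<in> P" using v.nonunits_0 nu by simp
    have "c P \<in> coordinates (B P)" "c' P \<in> coordinates (B P)" using c P by (auto simp: \<C>_def)
    then show "c P = c' P"
      by (rule quotient_basis_unique_comb[OF B[OF P] comb[OF P] _ _ 3 2])
  qed
  have "inj_on r \<C>" using eq multiples_0 by (intro inj_onI) auto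
  moreover have "incongruent (multiples (f M)) (r ` \<C>)"
    using eq unfolding incongruent_def by blast
  moreover have finC: "finite \<C>"
    unfolding \<C>_def using S BV by (intro finite_PiE finite_coordinates)
  ultimately have "card \<C> \<le> Q ^ (q * 2 ^ M)"
    using incongruent_card_le[OF f_R_upto[OF M] f_nonzero[OF M], of "r ` \<C>"] r(1)
    by (auto simp: card_image)
  moreover have "card \<C> = (\<Prod>P\<in>S. Q ^ place_degree \<iota> F P)"
    unfolding \<C>_def card_PiE[OF S(1)]
    by (intro prod.cong refl) (simp add: card_coordinates_const BV place_degree_eq[OF F_subfield pl B])
  moreover have "\<dots> = Q ^ (\<Sum>P\<in>S. place_degree \<iota> F P)" by (simp add: power_sum)
  ultimately show ?thesis using Q_gt_1 by simp
qed

text \<open>Every place has positive degree, so the bound on the sum of degrees also bounds the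
  number of places.\<close>

lemma finite_zeros:
  assumes M: "M \<ge> 1"
  shows "finite (zeros M)"
proof (rule ccontr)
  assume "infinite (zeros M)"
  then obtain S where S: "finite S" "card S = Suc (q * 2 ^ M)" "S \<subseteq> zeros M"
    using infinite_arbitrarily_large by blast
  have "(\<Sum>P\<in>S. 1) \<le> (\<Sum>P\<in>S. place_degree \<iota> F P)"
    using S(3) place_degree_pos by (intro sum_mono) (force simp: zeros_def Suc_le_eq)
  then have "card S \<le> (\<Sum>P\<in>S. place_degree \<iota> F P)" by simp
  then show False using sum_place_degree_le[OF S(1,3) M] S(2) by simp
qed

text \<open>Induction through f(M N)^(2^M) + f M = f(M (N + 1)); it reflects the inclusion of the
  field with 2^M elements in the one with 2^(M N).\<close>

lemma f_dvd_in_place: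
  assumes P: "finite_place P" "f M \<in> P"
  shows "f (M * N) \<in> P"
proof -
  interpret v: finite_valuation \<iota> q n e t y F "place_ring F P" using finite_placeD P by blast
  have nu: "v.\<mm> = P" using finite_placeD P by blast
  have "f (M * N) \<in> v.\<mm>"
  proof (induction N)
    case 0
    have "f (M * 0) = t + t" by (simp add: f_def)
    then show ?case using double_0[of t] v.nonunits_0 by metis
  next
    case (Suc N)
    have "f (M * N) ^ (2 ^ M) + f M = f (M * Suc N)"
      using double_0[of "t ^ (2 ^ M)"]
      by (simp add: f_def frobenius_add power_add mult.commute add.assoc flip: power_mult)
    moreover have "f (M * N) ^ (2 ^ M) + f M \<in> v.\<mm>"
      using Suc P nu by (intro v.nonunits_add v.power_nonunits) auto
    ultimately show ?case by simp
  qed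
  then show ?thesis using nu by simp
qed

text \<open>Multiplying the exponents M belonging to the single places gives one \<open>f M\<close>
  that vanishes at all of them.\<close>

lemma common_zeros:
  assumes S: "finite S" "\<And>P. P \<in> S \<Longrightarrow> finite_place P"
  obtains M where "M \<ge> 1" "S \<subseteq> zeros M"
proof -
  have "\<exists>M\<ge>1. S \<subseteq> zeros M" using S
  proof (induction S)
    case empty then show ?case by auto
  next
    case (insert P S)
    then obtain M where M: "M \<ge> 1" "S \<subseteq> zeros M" by auto
    have P: "finite_place P" using insert by blast
    interpret v: finite_valuation \<iota> q n e t y F "place_ring F P" using finite_placeD P by blast
    obtain M' where M': "M' \<ge> 1" "f M' \<in> P" using v.f_nonunit_exists finite_placeD(2)[OF P] by metis
    have "insert P S \<subseteq> zeros (M * M')"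
      using M(2) P M'(2) f_dvd_in_place[of _ M M'] f_dvd_in_place[of P M' M]
      by (auto simp: zeros_def mult.commute)
    moreover have "M * M' \<ge> 1" using M M' by simp
    ultimately show ?case by blast
  qed
  then show ?thesis using that by blast
qed

text \<open>Reducedness modulo \<open>f M\<close> yields, for z outside \<open>R\<close>, a finite
  place where f M^K z is a unit although \<open>f M\<close> vanishes and K > 0 is minimal; there z
  has a pole.\<close>

lemma integrally_closed:
  assumes z: "z \<in> F" "\<And>P. finite_place P \<Longrightarrow> z \<in> place_ring F P"
  shows "z \<in> R"
proof -
  note c = subring_closed[OF R_subring]
  obtain r s where rs: "r \<in> R" "s \<in> R" "s \<noteq> 0" "z = r / s" using fraction[OF z(1)] .
  obtain M K where M: "M \<ge> 1" "f M ^ K \<in> multiples s" using divides_f_power[OF rs(2,3)] .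
  then obtain h where h: "h \<in> R" "f M ^ K = s * h" by (auto simp: multiples_def)
  have "f M ^ K * z = r * h" using rs h by simp
  then have "\<exists>K. f M ^ K * z \<in> R" using rs h R_mult_closed by metis
  then obtain K where K: "f M ^ K * z \<in> R" "\<And>K'. K' < K \<Longrightarrow> f M ^ K' * z \<notin> R"
    using exists_least_iff[of "\<lambda>K. f M ^ K * z \<in> R"] by blast
  have f0: "f M \<noteq> 0" using f_nonzero M by blast
  show ?thesis
  proof (cases K)
    case 0 then show ?thesis using K by simp
  next
    case (Suc K')
    define r0 where "r0 = f M ^ K * z"
    have r0: "r0 \<in> R" using K r0_def by simp
    have fw: "r0 = f M * (f M ^ K' * z)" by (simp add: r0_def Suc)
    have nm: "r0 \<notin> multiples (f M)"
    proof
      assume "r0 \<in> multiples (f M)"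
      then obtain h where "h \<in> R" "r0 = f M * h" by (auto simp: multiples_def)
      then have "f M ^ K' * z \<in> R" using fw f0 by simp
      then show False using K(2)[of K'] Suc by simp
    qed
    then have r0nz: "r0 \<noteq> 0" using multiples_0 by auto
    define A where "A = {poly p (inverse r0) | p. \<forall>i. coeff p i \<in> R}"
    have A: "is_subring A" "R \<subseteq> A" "inverse r0 \<in> A"
      unfolding A_def using is_subring_adjoin[OF R_subring] adjoin_superset[OF R_subring] by blast+
    have "A \<subseteq> F"
    proof -
      have "inverse r0 \<in> F" using r0 R_F subfield_inverse[OF F_subfield] by blast
      then have "poly p (inverse r0) \<in> F" if "\<forall>i. coeff p i \<in> R" for p
        using that R_F F_subring by (auto simp: poly_altdef intro!: subring_sum subring_mult subring_power)
      then show ?thesis by (auto simp: A_def)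
    qed
    \<comment> \<open>Clearing powers of r0 in an expression of 1/f M as a polynomial in 1/r0 would
      make a power of r0 a multiple of \<open>f M\<close>, and by reducedness r0 itself.\<close>
    have notA: "inverse (f M) \<notin> A"
    proof
      assume "inverse (f M) \<in> A"
      then obtain p where p: "\<forall>i. coeff p i \<in> R" "inverse (f M) = poly p (inverse r0)" by (auto simp: A_def)
      have "inverse (f M) * r0 ^ degree p = (\<Sum>i\<le>degree p. coeff p i * (inverse r0 ^ i * r0 ^ degree p))"
        by (simp add: p(2) poly_altdef sum_distrib_right mult.assoc)
      also have "\<dots> = (\<Sum>i\<le>degree p. coeff p i * r0 ^ (degree p - i))"
        using r0nz by (intro sum.cong) (auto simp: power_diff field_simps)
      also have "\<dots> \<in> R" using p(1) r0 R_subring by (auto intro!: subring_sum subring_mult subring_power)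
      finally have "inverse (f M) * r0 ^ degree p \<in> R" .
      moreover have "r0 ^ degree p = f M * (inverse (f M) * r0 ^ degree p)" using f0 by simp
      ultimately have "r0 ^ degree p \<in> multiples (f M)" unfolding multiples_def by blast
      then show False using residue_ring_reduced_power[OF M(1) r0] nm by blast
    qed
    have "range \<iota> \<subseteq> A" using R_gens A by blast
    moreover have "f M \<in> A" using f_R A by blast
    \<comment> \<open>In V the element r0 is a unit and \<open>f M\<close> a nonunit; V contains t,
      so its place is finite and z is regular there by assumption.\<close>
    ultimately obtain V where V: "valuation_ring \<iota> F V" "A \<subseteq> V" "inverse (f M) \<notin> V"
      using exists_valuation_ring[OF hom F_subfield A(1) \<open>A \<subseteq> F\<close>] f0 notA by metis
    interpret v: valuation \<iota> F V using F_subfield V by unfold_locales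
    have "finite_place (nonunits V)"
      unfolding finite_place_def v.place_ring_nonunits using v.is_place_nonunits V A R_gens by blast
    then have "z \<in> V" using z(2)[of "nonunits V"] v.place_ring_nonunits by simp
    moreover have "f M \<in> V" using f_R A V by blast
    ultimately have "f M ^ K' * z \<in> V" using v.R_mult v.R_power by blast
    moreover have "f M \<in> nonunits V" using \<open>f M \<in> V\<close> V(3) by (simp add: nonunits_def)
    ultimately have "r0 \<in> nonunits V" unfolding fw by (rule v.nonunits_mult'[rotated])
    moreover have "inverse r0 \<in> V" using A V by blast
    ultimately show ?thesis using r0nz by (simp add: nonunits_def)
  qed
qed

end

section \<open>The genus of the curve\<close>

context artin_schreier_curve
begin

text \<open>At a finite place any \<open>f M\<close> vanishing there may be chosen, by
  \<open>finite_discrete\<close>.\<close>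

definition uniformizer :: "'h set \<Rightarrow> 'h" where
  "uniformizer P = (if P = P_inf then \<rho> else f (SOME M. M \<ge> 1 \<and> f M \<in> P))"

lemma finite_place_discrete:
  assumes "finite_place P" "M \<ge> 1" "f M \<in> P"
  shows "discrete_place \<iota> F (place_ring F P) (f M)"
proof -
  interpret v: finite_valuation \<iota> q n e t y F "place_ring F P" using finite_placeD assms by blast
  show ?thesis using v.finite_discrete assms finite_placeD(2)[OF assms(1)] by simp
qed

lemma const_F: "range \<iota> \<subseteq> F"
  using F_gens by auto

sublocale ff: discrete_function_field \<iota> F uniformizer
proof (rule discrete_function_field.intro[OF finite_constants_axioms], rule discrete_function_field_axioms.intro)
  show "is_subfield F" by (rule F_subfield)
  fix P assume "is_place \<iota> F P"
  then consider "P = P_inf" | "finite_place P" "P \<noteq> P_inf" using is_place_iff not_finite_place_P_inf by blast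
  then show "discrete_place \<iota> F (place_ring F P) (uniformizer P)"
  proof cases
    case 1 then show ?thesis
      using inf.discrete_place_axioms by (simp add: uniformizer_def place_ring_P_inf)
  next
    case 2
    interpret v: finite_valuation \<iota> q n e t y F "place_ring F P" using finite_placeD 2 by blast
    have "\<exists>M. M \<ge> 1 \<and> f M \<in> P" using v.f_nonunit_exists finite_placeD(2)[OF 2(1)] by simp
    then have "(SOME M. M \<ge> 1 \<and> f M \<in> P) \<ge> 1 \<and> f (SOME M. M \<ge> 1 \<and> f M \<in> P) \<in> P" by (rule someI_ex)
    then show ?thesis using finite_place_discrete[OF 2(1)] 2(2) by (simp add: uniformizer_def)
  qed
  show "\<exists>B. quotient_basis \<iota> (place_ring F P) P B"
    using \<open>is_place \<iota> F P\<close> finite_place_basis quotient_basis_infinite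
    by (auto simp: is_place_iff place_ring_P_inf)
qed

lemma place_degree_infinite: "place_degree \<iota> F P_inf = 1"
  using place_degree_eq[OF F_subfield is_place_P_inf] quotient_basis_infinite by (simp add: place_ring_P_inf)

text \<open>The divisor N P_inf + j (sum of the zeros of \<open>f M\<close>). These divisors
  dominate every divisor, and their Riemann-Roch spaces can be written down.\<close>

definition pole_divisor :: "nat \<Rightarrow> nat \<Rightarrow> nat \<Rightarrow> 'h set \<Rightarrow> int" where
  "pole_divisor M j N P = (if P = P_inf then int N else if P \<in> zeros M then int j else 0)"

lemma zero_of_place_val: 
  assumes P: "finite_place P" and z: "z \<in> F" "z \<noteq> 0" and M: "M \<ge> 1"
  shows "place_val F P z \<ge> - pole_divisor M j N P \<longleftrightarrow> z * f M ^ j \<in> place_ring F P"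
proof -
  interpret v: finite_valuation \<iota> q n e t y F "place_ring F P" using finite_placeD P by blast
  have nu: "v.\<mm> = P" using finite_placeD P by blast
  have Pi: "P \<noteq> P_inf" using P not_finite_place_P_inf by blast
  show ?thesis
  proof (cases "P \<in> zeros M")
    case True
    then have "f M \<in> P" by (simp add: zeros_def)
    then interpret d: discrete_place \<iota> F "place_ring F P" "f M" using finite_place_discrete P M by blast
    show ?thesis using d.place_val_ge_iff[OF z, of "int j"] True Pi nu by (simp add: pole_divisor_def)
  next
    case False
    then have "f M \<notin> P" using P by (simp add: zeros_def)
    then have "f M \<in> place_ring F P - v.\<mm>" using f_R v.R_V nu by blast
    then have u: "f M ^ j \<in> place_ring F P" "inverse (f M ^ j) \<in> place_ring F P" "f M ^ j \<noteq> 0"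
      using v.unit_power[of "f M" j] v.unit_inverse[of "f M ^ j"] by auto
    interpret d: discrete_place \<iota> F "place_ring F P" "uniformizer P"
      using ff.disc P by (simp add: finite_place_def)
    have "place_val F P z \<ge> 0 \<longleftrightarrow> z \<in> place_ring F P"
      using d.place_val_ge_iff[OF z, of 0] nu by simp
    also have "\<dots> \<longleftrightarrow> z * f M ^ j \<in> place_ring F P"
      using u v.R_mult[of z "f M ^ j"] v.R_mult[of "z * f M ^ j" "inverse (f M ^ j)"] by (auto simp: mult.assoc)
    finally show ?thesis using Pi False by (simp add: pole_divisor_def)
  qed
qed

text \<open>Multiplying by f M^j removes the allowed finite poles, so the product lies in
  \<open>R\<close> by \<open>integrally_closed\<close>; at infinity it adds j q 2^M to the pole
  order.\<close>

lemma riemann_roch_space_pole_divisor: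
  assumes M: "M \<ge> 1"
  shows "riemann_roch_space \<iota> F (pole_divisor M j N) = (\<lambda>r. r / f M ^ j) ` R_upto (N + j * (q * 2 ^ M))"
    (is "?L = ?I")
proof -
  define w where "w = q * 2 ^ M"
  have f0: "f M \<noteq> 0" using f_nonzero M by blast
  \<comment> \<open>A unit at infinity: \<open>f M\<close> has pole order exactly w there.\<close>
  define U where "U = (f M * \<rho> ^ w) ^ j"
  have u: "U \<in> V_inf - inf.\<mm>"
    using inf.unit_power[OF f_leading[OF M]] by (simp add: w_def U_def)
  then have u': "inverse U \<in> V_inf" "U \<noteq> 0" using inf.unit_inverse(1,3) by blast+
  have key: "z * \<rho> ^ N \<in> V_inf \<longleftrightarrow> z * f M ^ j * \<rho> ^ (N + j * w) \<in> V_inf" for z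
  proof -
    have "z * f M ^ j * \<rho> ^ (N + j * w) = z * \<rho> ^ N * U"
      by (simp add: U_def power_add power_mult_distrib ac_simps flip: power_mult)
    then show ?thesis
      using u u' inf.R_mult[of "z * \<rho> ^ N" U] inf.R_mult[of "z * \<rho> ^ N * U" "inverse U"]
      by (auto simp: mult.assoc)
  qed
  have iff: "z \<in> ?L \<longleftrightarrow> z * f M ^ j \<in> R_upto (N + j * w)" if z: "z \<in> F" "z \<noteq> 0" for z
  proof -
    have "z \<in> ?L \<longleftrightarrow> z * \<rho> ^ N \<in> V_inf \<and> (\<forall>P. finite_place P \<longrightarrow> z * f M ^ j \<in> place_ring F P)"
    proof -
      have "place_val F P_inf z \<ge> - pole_divisor M j N P_inf \<longleftrightarrow> z * \<rho> ^ N \<in> V_inf"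
        using inf.place_val_ge_iff[OF z, of "int N"] by (simp add: pole_divisor_def P_inf_def)
      then show ?thesis
        using z zero_of_place_val[OF _ z M] unfolding riemann_roch_space_def is_place_iff by blast
    qed
    also have "\<dots> \<longleftrightarrow> z * f M ^ j \<in> R \<and> z * f M ^ j * \<rho> ^ (N + j * w) \<in> V_inf"
    proof -
      have "f M \<in> F" using f_R R_F by blast
      then have zF: "z * f M ^ j \<in> F" using z F_subring by (simp add: subring_closed)
      have "z * f M ^ j \<in> R \<Longrightarrow> finite_place P \<Longrightarrow> z * f M ^ j \<in> place_ring F P" for P
        using finite_valuation.R_V[OF finite_placeD(1)] by blast
      then show ?thesis using key[of z] integrally_closed[OF zF] by blast
    qed
    also have "\<dots> \<longleftrightarrow> z * f M ^ j \<in> R_upto (N + j * w)" using R_upto_iff R_upto_R by blast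
    finally show ?thesis .
  qed
  have z0: "0 \<in> ?L" using F_subring by (auto simp: riemann_roch_space_def subring_0)
  have z0': "0 \<in> R_upto (N + j * w)" by (rule vs.subspace_0[OF subspace_R_upto])
  show ?thesis unfolding w_def[symmetric]
  proof
    show "?L \<subseteq> (\<lambda>r. r / f M ^ j) ` R_upto (N + j * w)"
    proof
      fix z assume z: "z \<in> ?L"
      then have zF: "z \<in> F" by (auto simp: riemann_roch_space_def)
      have "z * f M ^ j \<in> R_upto (N + j * w)" using iff[OF zF] z z0' by (cases "z = 0") auto
      then show "z \<in> (\<lambda>r. r / f M ^ j) ` R_upto (N + j * w)"
        using f0 by (intro image_eqI[of _ _ "z * f M ^ j"]) auto
    qed
    show "(\<lambda>r. r / f M ^ j) ` R_upto (N + j * w) \<subseteq> ?L"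
    proof
      fix z assume "z \<in> (\<lambda>r. r / f M ^ j) ` R_upto (N + j * w)"
      then obtain r where r: "r \<in> R_upto (N + j * w)" "z = r / f M ^ j" by blast
      then have zr: "z * f M ^ j = r" using f0 by simp
      have "r \<in> F" "f M \<in> F" using r(1) R_upto_R R_F f_R by blast+
      then have "r \<in> F" "f M ^ j \<in> F" using F_subring by (simp_all add: subring_closed)
      then have "z \<in> F" using r subfield_divide[OF F_subfield] by blast
      then show "z \<in> ?L" using iff[of z] r zr z0 by (cases "z = 0") auto
    qed
  qed
qed

lemma finite_riemann_roch_space_pole_divisor:
  "M \<ge> 1 \<Longrightarrow> finite (riemann_roch_space \<iota> F (pole_divisor M j N))"
  by (simp add: riemann_roch_space_pole_divisor finite_R_upto)

lemma divisor_dim_pole_divisor: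
  assumes M: "M \<ge> 1"
  shows "divisor_dim \<iota> F (pole_divisor M j N) = card (monomials_upto (N + j * (q * 2 ^ M)))"
proof -
  have f0: "f M \<noteq> 0" using f_nonzero M by blast
  let ?L = "riemann_roch_space \<iota> F (pole_divisor M j N)"
  have "card ?L = card (R_upto (N + j * (q * 2 ^ M)))"
    unfolding riemann_roch_space_pole_divisor[OF M] using f0 by (intro card_image) (auto simp: inj_on_def)
  moreover have "card ?L = Q ^ vs.dim ?L"
    by (intro card_subspace ff.subspace_L const_F finite_riemann_roch_space_pole_divisor M)
  ultimately show ?thesis using Q_gt_1 by (simp add: card_R_upto divisor_dim_def)
qed

lemma divisor_degree_pole_divisor:
  assumes M: "M \<ge> 1"
  shows "divisor_degree \<iota> F (pole_divisor M j N) = int N + int j * (\<Sum>P\<in>zeros M. int (place_degree \<iota> F P))"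
proof -
  have ni: "P_inf \<notin> zeros M" using not_finite_place_P_inf by (auto simp: zeros_def)
  have "divisor_degree \<iota> F (pole_divisor M j N)
      = (\<Sum>P\<in>insert P_inf (zeros M). pole_divisor M j N P * int (place_degree \<iota> F P))"
    using finite_zeros[OF M] by (intro ff.Deg_eq_sum const_F) (auto simp: pole_divisor_def split: if_splits)
  also have "\<dots> = int N + (\<Sum>P\<in>zeros M. pole_divisor M j N P * int (place_degree \<iota> F P))"
    using finite_zeros[OF M] ni by (simp add: place_degree_infinite) (simp add: pole_divisor_def)
  also have "(\<Sum>P\<in>zeros M. pole_divisor M j N P * int (place_degree \<iota> F P))
      = (\<Sum>P\<in>zeros M. int j * int (place_degree \<iota> F P))"
    using ni by (intro sum.cong) (auto simp: pole_divisor_def)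
  finally show ?thesis by (simp add: sum_distrib_left)
qed

lemma is_divisor_pole_divisor: "M \<ge> 1 \<Longrightarrow> is_divisor \<iota> F (pole_divisor M j N)"
  unfolding is_divisor_def is_place_iff
  by (auto simp: pole_divisor_def zeros_def[of M] intro!: finite_subset[of _ "insert P_inf (zeros M)"]
      finite_zeros split: if_splits)

theorem genus_artin_schreier_curve: "genus \<iota> F = int ((n - 1) * (q - 1) div 2)"
  unfolding genus_def
proof (rule Greatest_equality)
  define g where "g = (n - 1) * (q - 1) div 2"
  have card: "int (card (monomials_upto N)) = int N + 1 - int g" if "N \<ge> n * q" for N
  proof -
    have eq: "2 * card (monomials_upto N) + (n - 1) * (q - 1) = 2 * N + 2"
      by (rule card_monomials_upto[OF that])
    then have "even ((n - 1) * (q - 1))" by presburger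
    then have "(n - 1) * (q - 1) = 2 * g" by (simp add: g_def)
    then show ?thesis using eq by linarith
  qed
  show "\<exists>A. is_divisor \<iota> F A \<and> int ((n - 1) * (q - 1) div 2)
      = divisor_degree \<iota> F A - int (divisor_dim \<iota> F A) + 1"
  proof (intro exI conjI)
    \<comment> \<open>With j = 0 this is n q P_inf, where the count is already exact; the value 1 of
      M is arbitrary.\<close>
    show "is_divisor \<iota> F (pole_divisor 1 0 (n * q))" by (rule is_divisor_pole_divisor) simp
    show "int ((n - 1) * (q - 1) div 2) = divisor_degree \<iota> F (pole_divisor 1 0 (n * q))
        - int (divisor_dim \<iota> F (pole_divisor 1 0 (n * q))) + 1"
      using card[of "n * q"] by (simp add: divisor_degree_pole_divisor divisor_dim_pole_divisor g_def)
  qed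
  fix g' assume "\<exists>A. is_divisor \<iota> F A \<and> g' = divisor_degree \<iota> F A - int (divisor_dim \<iota> F A) + 1"
  then obtain A where A: "is_divisor \<iota> F A" "g' = divisor_degree \<iota> F A - int (divisor_dim \<iota> F A) + 1" by blast
  define S where "S = {P. A P \<noteq> 0} - {P_inf}"
  have finA: "finite {P. A P \<noteq> 0}" and plA: "\<And>P. A P \<noteq> 0 \<Longrightarrow> is_place \<iota> F P"
    using A(1) by (auto simp: is_divisor_def)
  have "finite S" "\<And>P. P \<in> S \<Longrightarrow> finite_place P" using finA plA is_place_iff by (auto simp: S_def)
  then obtain M where M: "M \<ge> 1" "S \<subseteq> zeros M" using common_zeros by blast
  \<comment> \<open>One bound for all finite coefficients of A. In N, the summand n q keeps the
    later count in its exact range.\<close>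
  define j where "j = nat (\<Sum>P\<in>S. \<bar>A P\<bar>)"
  define N where "N = nat \<bar>A P_inf\<bar> + n * q"
  let ?D = "pole_divisor M j N"
  have le: "A \<le> ?D"
  proof (rule le_funI)
    fix P
    show "A P \<le> ?D P"
    proof (cases "P = P_inf")
      case True then show ?thesis by (auto simp: pole_divisor_def N_def intro!: add_increasing2)
    next
      case False
      have "A P \<le> \<bar>A P\<bar>" by simp
      moreover have "\<bar>A P\<bar> \<le> (\<Sum>P\<in>S. \<bar>A P\<bar>)" if "P \<in> S"
        using that \<open>finite S\<close> by (intro member_le_sum) auto
      ultimately show ?thesis using False M(2) by (cases "P \<in> S") (auto simp: pole_divisor_def j_def S_def)
    qed
  qed
  have "divisor_degree \<iota> F A - int (divisor_dim \<iota> F A) \<le> divisor_degree \<iota> F ?D - int (divisor_dim \<iota> F ?D)"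
  proof (rule ff.Deg_minus_dim_mono[OF const_F, where S = "insert P_inf (zeros M)"])
    show "finite (insert P_inf (zeros M))" using finite_zeros[OF M(1)] by simp
    show "is_place \<iota> F P" if "P \<in> insert P_inf (zeros M)" for P
      using that by (auto simp: is_place_iff zeros_def)
    show "{P. A P \<noteq> 0} \<subseteq> insert P_inf (zeros M)" using M(2) by (auto simp: S_def)
    show "{P. ?D P \<noteq> 0} \<subseteq> insert P_inf (zeros M)" by (auto simp: pole_divisor_def split: if_splits)
    show "finite (riemann_roch_space \<iota> F ?D)" by (rule finite_riemann_roch_space_pole_divisor[OF M(1)])
  qed (rule le)
  \<comment> \<open>The zeros of \<open>f M\<close> have total degree at most q 2^M, while the
    dimension grows by the full j q 2^M; the inequality points in the required direction.\<close>
  also have "\<dots> \<le> int g - 1"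
  proof -
    have "int (\<Sum>P\<in>zeros M. place_degree \<iota> F P) \<le> int (q * 2 ^ M)"
      using sum_place_degree_le[OF finite_zeros[OF M(1)] order_refl M(1)] by (rule of_nat_mono)
    then have "int j * (\<Sum>P\<in>zeros M. int (place_degree \<iota> F P)) \<le> int j * int (q * 2 ^ M)"
      by (intro mult_left_mono) auto
    moreover have "int (card (monomials_upto (N + j * (q * 2 ^ M)))) = int (N + j * (q * 2 ^ M)) + 1 - int g"
      by (rule card) (simp add: N_def)
    ultimately show ?thesis
      by (simp add: divisor_degree_pole_divisor[OF M(1)] divisor_dim_pole_divisor[OF M(1)])
  qed
  finally show "g' \<le> int ((n - 1) * (q - 1) div 2)" using A(2) by (simp add: g_def)
qed

end

section \<open>Algebraic extensions of finite rings\<close>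

text \<open>S[z] is contained in the S-combinations of 1, ..., z^(d-1), of which there are finitely
  many.\<close>

lemma finite_adjoin_integral:
  assumes S: "is_subring S" "finite S" and c: "\<And>i. i < d \<Longrightarrow> c i \<in> S"
    and z: "z ^ d = (\<Sum>i<d. c i * z ^ i)"
  shows "finite {poly p z | p. \<forall>i. coeff p i \<in> S}"
proof -
  define E where "E = (\<lambda>s. \<Sum>i<d. s i * z ^ i) ` ({..<d} \<rightarrow>\<^sub>E S)"
  have EI: "(\<Sum>i<d. s i * z ^ i) \<in> E" if "\<And>i. i < d \<Longrightarrow> s i \<in> S" for s
  proof -
    have "(\<Sum>i<d. s i * z ^ i) = (\<Sum>i<d. restrict s {..<d} i * z ^ i)" by simp
    moreover have "restrict s {..<d} \<in> {..<d} \<rightarrow>\<^sub>E S" using that by auto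
    ultimately show ?thesis unfolding E_def by blast
  qed
  have EE: "\<exists>s. (\<forall>i<d. s i \<in> S) \<and> v = (\<Sum>i<d. s i * z ^ i)" if "v \<in> E" for v
    using that by (auto simp: E_def)
  have add: "u + v \<in> E" if uv: "u \<in> E" "v \<in> E" for u v
  proof -
    obtain s s' where s: "\<forall>i<d. s i \<in> S" "u = (\<Sum>i<d. s i * z ^ i)"
      "\<forall>i<d. s' i \<in> S" "v = (\<Sum>i<d. s' i * z ^ i)" using EE uv by meson
    have "u + v = (\<Sum>i<d. (s i + s' i) * z ^ i)" by (simp add: s sum.distrib distrib_right)
    also have "\<dots> \<in> E" using s S by (intro EI) (auto simp: subring_add)
    finally show ?thesis .
  qed
  have scale: "a * v \<in> E" if "a \<in> S" and v: "v \<in> E" for a v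
  proof -
    obtain s where s: "\<forall>i<d. s i \<in> S" "v = (\<Sum>i<d. s i * z ^ i)" using EE v by meson
    have "a * v = (\<Sum>i<d. (a * s i) * z ^ i)" by (simp add: s sum_distrib_left mult.assoc)
    also have "\<dots> \<in> E" using s S that by (intro EI) (auto simp: subring_mult)
    finally show ?thesis .
  qed
  have zd: "z ^ d \<in> E" unfolding z using c by (rule EI)
  have low: "z ^ i \<in> E" if "i < d" for i
  proof -
    have "z ^ i = (\<Sum>j<d. (if j = i then 1 else 0) * z ^ j)" using that by (simp add: if_distrib[of "\<lambda>u. u * _"] cong: if_cong)
    also have "\<dots> \<in> E" using S by (intro EI) (auto simp: subring_0 subring_1)
    finally show ?thesis .
  qed
  have zero: "0 \<in> E" using EI[of "\<lambda>_. 0"] S by (simp add: subring_0)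
  have sumE: "finite A \<Longrightarrow> (\<And>i. i \<in> A \<Longrightarrow> g i \<in> E) \<Longrightarrow> sum g A \<in> E" for g and A :: "nat set"
    by (induction A rule: finite_induct) (auto intro: zero add)
  have "z * v \<in> E" if v: "v \<in> E" for v
  proof -
    obtain s where s: "\<forall>i<d. s i \<in> S" "v = (\<Sum>i<d. s i * z ^ i)" using EE v by meson
    have "z * v = (\<Sum>i<d. s i * z ^ Suc i)" by (simp add: s sum_distrib_left mult.left_commute)
    also have "\<dots> \<in> E"
    proof (rule sumE)
      fix i assume "i \<in> {..<d}"
      then have "z ^ Suc i \<in> E" using zd low[of "Suc i"] by (cases "Suc i = d") auto
      then show "s i * z ^ Suc i \<in> E" using s \<open>i \<in> {..<d}\<close> scale by blast
    qed simp
    finally show ?thesis .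
  qed
  moreover have "1 \<in> E"
  proof (cases d)
    case 0 then show ?thesis using zd by simp
  next
    case (Suc d') then show ?thesis using low[of 0] by simp
  qed
  ultimately have pow: "z ^ k \<in> E" for k by (induction k) auto
  have "poly p z \<in> E" if "\<forall>i. coeff p i \<in> S" for p
    unfolding poly_altdef using that by (intro sumE scale pow) auto
  then have "{poly p z | p. \<forall>i. coeff p i \<in> S} \<subseteq> E" by blast
  moreover have "finite E" unfolding E_def using S by (intro finite_imageI finite_PiE) auto
  ultimately show ?thesis using finite_subset by blast
qed

text \<open>The powers of a nonzero z repeat, and cancellation exhibits 1/z as a power of z.\<close>

lemma finite_subring_subfield:
  fixes S :: "'h::field set"
  assumes S: "is_subring S" "finite S"
  shows "is_subfield S"
  unfolding is_subfield_def
proof (intro conjI ballI)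
  fix z assume z: "z \<in> S"
  show "inverse z \<in> S"
  proof (cases "z = 0")
    case False
    have "range (\<lambda>i::nat. z ^ i) \<subseteq> S" using z S by (auto simp: subring_power)
    then have "\<not> inj (\<lambda>i::nat. z ^ i)" using S(2) finite_subset range_inj_infinite by blast
    then obtain i j :: nat where ij: "z ^ i = z ^ j" "i < j" unfolding inj_def by (metis linorder_neqE_nat)
    have "z ^ j = z ^ i * (z * z ^ (j - i - 1))" using ij(2) by (simp flip: power_add power_Suc)
    then have "z * z ^ (j - i - 1) = 1" using ij(1) False by simp
    then have "inverse z = z ^ (j - i - 1)" by (rule inverse_unique)
    then show ?thesis using z S by (simp add: subring_power)
  qed (use S subring_0 in auto)
qed (rule S(1))

lemma algebraic_relation:
  assumes \<iota>: "field_hom \<iota>" and nt: "\<not> transcendental_over \<iota> z"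
  obtains d c where "z ^ d = (\<Sum>i<d. \<iota> (c i) * z ^ i)"
proof -
  note s = field_hom_simps[OF \<iota>]
  obtain p where p: "poly (map_poly \<iota> p) z = 0" "p \<noteq> 0" using nt by (auto simp: transcendental_over_def)
  define d where "d = degree p"
  have "degree (map_poly \<iota> p) = d" unfolding d_def by (rule degree_map_poly) (simp add: s)
  then have "(\<Sum>i\<le>d. \<iota> (coeff p i) * z ^ i) = 0"
    using p(1) by (simp add: poly_altdef coeff_map_poly s)
  then have "\<iota> (coeff p d) * z ^ d = - (\<Sum>i<d. \<iota> (coeff p i) * z ^ i)"
    by (simp add: lessThan_Suc_atMost[symmetric] eq_neg_iff_add_eq_0 add.commute)
  moreover have lc: "\<iota> (coeff p d) \<noteq> 0" using p(2) by (simp add: s d_def)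
  then have "z ^ d = (\<iota> (coeff p d) * z ^ d) / \<iota> (coeff p d)" by simp
  ultimately have "z ^ d = (- (\<Sum>i<d. \<iota> (coeff p i) * z ^ i)) / \<iota> (coeff p d)" by simp
  also have "\<dots> = (\<Sum>i<d. \<iota> (- coeff p i / coeff p d) * z ^ i)"
    by (simp add: sum_negf[symmetric] sum_divide_distrib s)
  finally show ?thesis by (rule that)
qed

lemma transcendental_infinite:
  assumes \<iota>: "field_hom \<iota>" and tr: "transcendental_over \<iota> (z :: 'h::field)"
  shows "infinite (UNIV :: 'h set)"
proof
  assume "finite (UNIV :: 'h set)"
  then have "\<not> inj (\<lambda>i::nat. z ^ i)"
    using range_inj_infinite[of "\<lambda>i. z ^ i"] rev_finite_subset[OF _ subset_UNIV] by blast
  then obtain i j :: nat where ij: "z ^ i = z ^ j" "i \<noteq> j" unfolding inj_def by blast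
  note s = field_hom_simps[OF \<iota>]
  have "(\<Sum>k\<in>{i, j}. \<iota> (if k = i then 1 else - 1) * z ^ k) = 0" using ij by (simp add: s)
  from transcendental_sum_eq_0[OF \<iota> tr _ this, of i] show False by simp
qed

section \<open>Fixed fields of cyclic groups of constant automorphisms\<close>

lemma aut_group_simps [simp]:
  "carrier (aut_group \<iota>) = {\<sigma>. constant_automorphism \<iota> \<sigma>}"
  "mult (aut_group \<iota>) = (\<circ>)" "one (aut_group \<iota>) = id"
  by (simp_all add: aut_group_def)

lemma group_aut_group: "group (aut_group \<iota>)"
proof (rule groupI)
  fix \<sigma> assume "\<sigma> \<in> carrier (aut_group \<iota>)"
  then have s: "field_hom \<sigma>" "bij \<sigma>" "\<And>c. \<sigma> (\<iota> c) = \<iota> c" by (auto simp: constant_automorphism_def)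
  have inv: "inv_into UNIV \<sigma> (\<sigma> z) = z" "\<sigma> (inv_into UNIV \<sigma> z) = z" for z
    using s(2) by (simp_all add: bij_is_inj bij_is_surj surj_f_inv_f)
  have "field_hom (inv_into UNIV \<sigma>)" unfolding field_hom_def
    by (metis inv field_hom_simps(1-3)[OF s(1)])
  moreover have "inv_into UNIV \<sigma> (\<iota> c) = \<iota> c" for c using inv(1)[of "\<iota> c"] s(3) by simp
  ultimately have "constant_automorphism \<iota> (inv_into UNIV \<sigma>)"
    using s(2) by (simp add: constant_automorphism_def bij_imp_bij_inv)
  then show "\<exists>\<tau>\<in>carrier (aut_group \<iota>). \<tau> \<otimes>\<^bsub>aut_group \<iota>\<^esub> \<sigma> = \<one>\<^bsub>aut_group \<iota>\<^esub>"
    using inv(1) by (intro bexI[of _ "inv_into UNIV \<sigma>"]) (auto simp: fun_eq_iff)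
qed (auto simp: constant_automorphism_def field_hom_def bij_comp comp_assoc)

lemma pow_aut_group: "\<sigma> [^]\<^bsub>aut_group \<iota>\<^esub> k = \<sigma> ^^ (k :: nat)"
  by (induction k) (auto simp: nat_pow_def simp del: funpow.simps(2) simp: funpow_Suc_right)

lemma constant_automorphism_funpow:
  assumes "constant_automorphism \<iota> \<sigma>"
  shows "constant_automorphism \<iota> (\<sigma> ^^ k)"
proof -
  interpret group "aut_group \<iota>" by (rule group_aut_group)
  show ?thesis using nat_pow_closed[of \<sigma> k] assms by (simp add: pow_aut_group)
qed

lemma fixed_field_generate:
  assumes \<tau>: "constant_automorphism \<iota> \<tau>"
  shows "fixed_field (generate (aut_group \<iota>) {\<tau>}) = {z. \<tau> z = z}"
proof -
  interpret group "aut_group \<iota>" by (rule group_aut_group)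
  have "h z = z" if "h \<in> generate (aut_group \<iota>) {\<tau>}" "\<tau> z = z" for h z
    using that
  proof (induction rule: generate.induct)
    case (inv h)
    have "inv\<^bsub>aut_group \<iota>\<^esub> \<tau> \<otimes>\<^bsub>aut_group \<iota>\<^esub> \<tau> = \<one>\<^bsub>aut_group \<iota>\<^esub>"
      using \<tau> by (intro l_inv) simp
    then have "(inv\<^bsub>aut_group \<iota>\<^esub> \<tau>) (\<tau> z) = z" by (simp add: fun_eq_iff)
    then show ?case using inv by simp
  qed auto
  then show ?thesis using generate.incl[of \<tau> "{\<tau>}" "aut_group \<iota>"] by (auto simp: fixed_field_def)
qed

text \<open>Kummer theory: if \<open>\<tau>\<close> multiplies \<open>u\<close> by a primitive \<open>m\<close>-th root of unity, averaging over
  the powers of \<open>\<tau>\<close> projects \<open>F[u]\<close> to \<open>F[u^m]\<close>; denominators are first made invariant by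
  multiplying with their conjugates.\<close>

lemma fixed_points_kummer:
  fixes F :: "'h::field set"
  assumes F: "is_subfield F" and \<tau>: "field_hom \<tau>" and fixF: "\<And>z. z \<in> F \<Longrightarrow> \<tau> z = z"
    and gen: "generated_field (F \<union> {u}) = UNIV" and um: "u ^ m \<in> F" and m: "m > 0" "of_nat m \<noteq> (0 :: 'h)"
    and \<omega>: "\<omega> \<in> F" "\<tau> u = \<omega> * u" "\<omega> ^ m = 1" "\<And>i. 0 < i \<Longrightarrow> i < m \<Longrightarrow> \<omega> ^ i \<noteq> 1"
    and z: "\<tau> z = z"
  shows "z \<in> F"
proof -
  note h = field_hom_simps[OF \<tau>]
  have Fs: "is_subring F" using F by (rule subfield_subring)
  define E where "E = {poly p u | p. \<forall>i. coeff p i \<in> F}"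
  have E: "is_subring E" "F \<subseteq> E" "u \<in> E"
    unfolding E_def using is_subring_adjoin[OF Fs] adjoin_superset[OF Fs] by blast+
  have pow: "(\<tau> ^^ l) (poly p u) = (\<Sum>i\<le>degree p. coeff p i * u ^ i * \<omega> ^ (l * i))"
    if "\<forall>i. coeff p i \<in> F" for p l
  proof (induction l)
    case 0 then show ?case by (simp add: poly_altdef)
  next
    case (Suc l)
    then have "(\<tau> ^^ Suc l) (poly p u) = (\<Sum>i\<le>degree p. coeff p i * (\<omega> * u) ^ i * \<omega> ^ (l * i))"
      using that fixF \<omega>(1,2) by (simp add: h)
    then show ?case by (simp add: power_mult_distrib power_add algebra_simps)
  qed
  have E\<tau>: "\<tau> v \<in> E" if v: "v \<in> E" for v
  proof -
    obtain p where p: "\<forall>i. coeff p i \<in> F" "v = poly p u" using v by (auto simp: E_def)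
    have "\<tau> v = (\<Sum>i\<le>degree p. coeff p i * u ^ i * \<omega> ^ (1 * i))" using pow[OF p(1), of 1] p(2) by simp
    also have "\<dots> \<in> E" using p E \<omega>(1) by (intro subring_sum[OF E(1)] subring_mult[OF E(1)] subring_power[OF E(1)]) auto
    finally show ?thesis .
  qed
  have fixE: "v \<in> F" if v: "v \<in> E" "\<tau> v = v" for v
  proof -
    obtain p where p: "\<forall>i. coeff p i \<in> F" "v = poly p u" using v(1) by (auto simp: E_def)
    have "(\<tau> ^^ l) v = v" for l by (induction l) (use v(2) in auto)
    \<comment> \<open>Averaging over the powers of \<tau>: the coefficient of u^i acquires the
      factor sum of \<omega>^(i l), a geometric sum that vanishes unless m divides i.\<close>
    then have "of_nat m * v = (\<Sum>l<m. (\<tau> ^^ l) v)" by simp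
    also have "\<dots> = (\<Sum>l<m. \<Sum>i\<le>degree p. coeff p i * u ^ i * \<omega> ^ (l * i))"
      using pow[OF p(1)] p(2) by simp
    also have "\<dots> = (\<Sum>i\<le>degree p. coeff p i * u ^ i * (\<Sum>l<m. (\<omega> ^ i) ^ l))"
      by (subst sum.swap) (simp add: sum_distrib_left mult.commute flip: power_mult)
    also have "\<dots> \<in> F"
    proof (rule subring_sum[OF Fs])
      fix i
      show "coeff p i * u ^ i * (\<Sum>l<m. (\<omega> ^ i) ^ l) \<in> F"
      proof (cases "m dvd i")
        case True
        then obtain k where "i = m * k" by blast
        then have "u ^ i \<in> F" using um Fs by (simp add: power_mult subring_power)
        moreover have "(\<Sum>l<m. (\<omega> ^ i) ^ l) \<in> F"
          using \<omega>(1) by (intro subring_sum[OF Fs] subring_power[OF Fs])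
        ultimately show ?thesis using p(1) by (intro subring_mult[OF Fs]) auto
      next
        case False
        have "\<omega> ^ i = \<omega> ^ (m * (i div m) + i mod m)" by simp
        also have "\<dots> = \<omega> ^ (i mod m)" unfolding power_add power_mult \<omega>(3) by simp
        also have "\<dots> \<noteq> 1" using False m(1) by (intro \<omega>(4)) (auto simp: dvd_eq_mod_eq_0)
        finally have ne: "\<omega> ^ i \<noteq> 1" .
        have "(\<omega> ^ i) ^ m = (\<omega> ^ m) ^ i" by (simp add: mult.commute flip: power_mult)
        then have "(\<Sum>l<m. (\<omega> ^ i) ^ l) = 0" using ne \<omega>(3) by (simp add: geometric_sum)
        then show ?thesis using Fs by (simp add: subring_0)
      qed
    qed
    finally have "of_nat m * v \<in> F" .
    moreover have "of_nat m \<in> F"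
      by (induction m) (use Fs in \<open>auto simp: subring_0 subring_1 subring_add\<close>)
    ultimately have "(of_nat m * v) / of_nat m \<in> F" using subfield_divide[OF F] by blast
    then show ?thesis using m(2) by simp
  qed
  have "UNIV = {r / s | r s. r \<in> E \<and> s \<in> E \<and> s \<noteq> 0}"
    using generated_field_minimal[OF is_subfield_fractions[OF E(1)], of "F \<union> {u}"]
      fractions_superset[OF E(1)] E gen by blast
  then obtain r s where rs: "r \<in> E" "s \<in> E" "s \<noteq> 0" "z = r / s" by blast
  \<comment> \<open>The product of the other conjugates of s: s w is a norm, and
    \<open>\<tau>m\<close> makes it invariant under the cyclic shift.\<close>
  define w where "w = (\<Prod>l\<in>{1..<m}. (\<tau> ^^ l) s)"
  have \<tau>m: "(\<tau> ^^ m) s = s"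
  proof -
    obtain p where p: "\<forall>i. coeff p i \<in> F" "s = poly p u" using rs by (auto simp: E_def)
    have "(\<tau> ^^ m) s = (\<Sum>i\<le>degree p. coeff p i * u ^ i * \<omega> ^ (m * i))" using pow[OF p(1)] p(2) by simp
    also have "\<dots> = s" by (simp add: power_mult \<omega>(3) poly_altdef p(2))
    finally show ?thesis .
  qed
  have sE: "(\<tau> ^^ l) s \<in> E" and s0: "(\<tau> ^^ l) s \<noteq> 0" for l
    by (induction l) (use rs E\<tau> h in auto)
  have wE: "w \<in> E" "w \<noteq> 0" unfolding w_def using sE s0 E by (auto intro!: subring_prod)
  have N: "s * w = (\<Prod>l<m. (\<tau> ^^ l) s)"
    using m(1) by (cases m) (simp_all add: w_def lessThan_atLeast0 prod.atLeast0_lessThan_Suc_shift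
      prod.atLeast_Suc_lessThan)
  have prod: "\<tau> (prod g A) = (\<Prod>l\<in>A. \<tau> (g l))" for g and A :: "nat set"
    by (induction A rule: infinite_finite_induct) (auto simp: h)
  have "\<tau> (s * w) = (\<Prod>l<m. (\<tau> ^^ Suc l) s)" unfolding N prod by simp
  also have "\<dots> = (\<Prod>l<m. (\<tau> ^^ l) s)"
  proof -
    have "s * (\<Prod>l<m. (\<tau> ^^ Suc l) s) = (\<Prod>l<Suc m. (\<tau> ^^ l) s)" by (subst prod.lessThan_Suc_shift) simp
    also have "\<dots> = (\<Prod>l<m. (\<tau> ^^ l) s) * s" using \<tau>m by simp
    finally show ?thesis using rs(3) by simp
  qed
  finally have fsw: "\<tau> (s * w) = s * w" using N by simp
  then have swF: "s * w \<in> F" using rs wE E by (intro fixE) (auto simp: subring_mult)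
  have rw: "r * w = z * (s * w)" using rs by simp
  then have "\<tau> (r * w) = r * w" using z fsw h(3) by metis
  then have "r * w \<in> F" using rs wE E by (intro fixE) (auto simp: subring_mult)
  then have "(r * w) / (s * w) \<in> F" using swF subfield_divide[OF F] by blast
  then show ?thesis using rs wE by simp
qed

section \<open>The Hermitian function field\<close>

text \<open>If u^m were algebraic over the finite field k, then k[u^m], k[u] and k[u, v] would be
  finite rings in turn, and the last one, a field, would be the whole infinite type.\<close>

lemma transcendental_of_generators:
  fixes \<iota> :: "'k::field \<Rightarrow> 'h::field"
  assumes \<iota>: "field_hom \<iota>" and fin: "finite (UNIV :: 'k set)" and inf: "infinite (UNIV :: 'h set)"
    and gen: "generated_field (range \<iota> \<union> {u, v}) = UNIV"
    and m: "m > 0" and q: "q \<ge> 2" and v: "v ^ q + v = u ^ r"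
  shows "transcendental_over \<iota> (u ^ m)"
proof (rule ccontr)
  assume "\<not> transcendental_over \<iota> (u ^ m)"
  then obtain d c where c: "(u ^ m) ^ d = (\<Sum>i<d. \<iota> (c i) * (u ^ m) ^ i)"
    using algebraic_relation[OF \<iota>] by metis
  note s = field_hom_simps[OF \<iota>]
  define adjoin :: "'h set \<Rightarrow> 'h \<Rightarrow> 'h set" where "adjoin S z = {poly p z | p. \<forall>i. coeff p i \<in> S}" for S z
  have adj: "is_subring (adjoin S z)" "S \<subseteq> adjoin S z" "z \<in> adjoin S z" if "is_subring S" for S z
    unfolding adjoin_def using is_subring_adjoin[OF that] adjoin_superset[OF that] by blast+
  have S0: "is_subring (range \<iota>)"
    by (auto simp: is_subring_def s(1)[symmetric]) (auto simp flip: s)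
  define S1 where "S1 = adjoin (range \<iota>) (u ^ m)"
  define S2 where "S2 = adjoin S1 u"
  define S3 where "S3 = adjoin S2 v"
  have S1: "is_subring S1" "range \<iota> \<subseteq> S1" "u ^ m \<in> S1" unfolding S1_def using adj[OF S0] by auto
  have S2: "is_subring S2" "S1 \<subseteq> S2" "u \<in> S2" unfolding S2_def using adj[OF S1(1)] by auto
  have S3: "is_subring S3" "S2 \<subseteq> S3" "v \<in> S3" unfolding S3_def using adj[OF S2(1)] by auto
  have f1: "finite S1" unfolding S1_def adjoin_def
    by (rule finite_adjoin_integral[OF S0 _ _ c]) (use fin in auto)
  have "u ^ m = (\<Sum>i<m. (if i = 0 then u ^ m else 0) * u ^ i)"
    using m by (simp add: if_distrib[of "\<lambda>w. w * _"] cong: if_cong)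
  then have f2: "finite S2" unfolding S2_def adjoin_def
    by (rule finite_adjoin_integral[OF S1(1) f1, rotated]) (use S1 in \<open>auto simp: subring_0\<close>)
  have "v ^ q = (\<Sum>i\<in>{0, 1}. (if i = 0 then u ^ r else - 1) * v ^ i)"
    using v by (simp add: algebra_simps)
  also have "\<dots> = (\<Sum>i<q. (if i = 0 then u ^ r else if i = 1 then - 1 else 0) * v ^ i)"
    using q by (intro sum.mono_neutral_cong_left) auto
  finally have f3: "finite S3" unfolding S3_def adjoin_def
    by (rule finite_adjoin_integral[OF S2(1) f2, rotated])
      (use S2 in \<open>auto simp: subring_0 subring_1 subring_uminus subring_power\<close>)
  have "generated_field (range \<iota> \<union> {u, v}) \<subseteq> S3"
    by (rule generated_field_minimal[OF finite_subring_subfield[OF S3(1) f3]]) (use S1 S2 S3 in auto)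
  then show False using gen f3 inf by (metis finite_subset)
qed

text \<open>Translation by 1 permutes k, so comparing the sums of all elements gives 2^e = 0 in
  k.\<close>

lemma char2_of_card:
  assumes "card (UNIV :: 'k::field set) = 2 ^ e" 
  shows "(1 :: 'k) + 1 = 0"
proof -
  have "(\<Sum>x\<in>(UNIV :: 'k set). x) = (\<Sum>x\<in>UNIV. x + 1)"
    by (rule sum.reindex_bij_witness[of _ "\<lambda>x. x + 1" "\<lambda>x. x - 1"]) auto
  also have "\<dots> = (\<Sum>x\<in>UNIV. x) + of_nat (card (UNIV :: 'k set))" by (simp add: sum.distrib)
  finally have "of_nat (2 ^ e) = (0 :: 'k)" using assms by simp
  then have "(2 :: 'k) ^ e = 0" by simp
  then show ?thesis by simp
qed

lemma primitive_root_power_eq_1: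
  assumes a: "primitive_root_of_unity N a" and "a ^ j = 1"
  shows "N dvd j"
proof (rule ccontr)
  assume "\<not> N dvd j"
  moreover have N: "N > 0" "a ^ N = 1" using a by (auto simp: primitive_root_of_unity_def)
  ultimately have r: "0 < j mod N" "j mod N < N" by (auto simp: dvd_eq_mod_eq_0)
  have "a ^ j = a ^ (N * (j div N) + j mod N)" by simp
  also have "\<dots> = a ^ (j mod N)" unfolding power_add power_mult N(2) by simp
  finally show False using assms r by (auto simp: primitive_root_of_unity_def)
qed

lemma primitive_root_generates:
  fixes a c :: "'k::field"
  assumes a: "primitive_root_of_unity (card (UNIV :: 'k set) - 1) a" and c: "c \<noteq> 0"
  obtains s where "c = a ^ s"
proof -
  define N where "N = card (UNIV :: 'k set) - 1"
  have N: "N > 0" "a ^ N = 1" using a by (auto simp: primitive_root_of_unity_def N_def)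
  then have fin: "finite (UNIV :: 'k set)" unfolding N_def by (metis card.infinite diff_0_eq_0 less_irrefl)
  have a0: "a \<noteq> 0" using N by (metis power_0_left zero_neq_one less_irrefl)
  have "inj_on (\<lambda>i. a ^ i) {..<N}"
  proof (rule inj_onI)
    have "i = j" if "a ^ i = a ^ j" "i \<le> j" "j < N" for i j
    proof -
      have "a ^ j = a ^ i * a ^ (j - i)" using power_add[of a i "j - i"] that by simp
      then have "a ^ (j - i) = 1" using that a0 by simp
      then have "N dvd j - i" using primitive_root_power_eq_1 a N_def by blast
      then have "j - i = 0" using that(3) by (intro ccontr[of "j - i = 0"]) (auto dest: dvd_imp_le)
      then show ?thesis using that(2) by simp
    qed
    then show "i = j" if "i \<in> {..<N}" "j \<in> {..<N}" "a ^ i = a ^ j" for i j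
      using that by (metis lessThan_iff nat_le_linear)
  qed
  then have "card ((\<lambda>i. a ^ i) ` {..<N}) = N" by (simp add: card_image)
  moreover have "card (UNIV - {0 :: 'k}) = N" using fin by (simp add: card_Diff_singleton N_def)
  moreover have "(\<lambda>i. a ^ i) ` {..<N} \<subseteq> UNIV - {0}" using a0 by auto
  ultimately have "(\<lambda>i. a ^ i) ` {..<N} = UNIV - {0}" using fin by (intro card_subset_eq) auto
  then show ?thesis using c that by blast
qed

text \<open>In the projective coordinates \<open>(x : y : 1)\<close> the automorphism \<open>\<sigma>\<close> is a homology with
  eigenforms \<open>x\<close>, \<open>a^q y + 1\<close> (eigenvalue \<open>a\<close>) and \<open>a y + 1\<close> (eigenvalue \<open>a^q\<close>).  The new
  generators are quotients of linear forms chosen such that \<open>\<sigma>\<close> fixes a point at infinity.\<close>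

lemma hermitian_diagonalization:
  fixes \<iota> :: "'k::field \<Rightarrow> 'h::field"
  assumes e: "e \<ge> 1" and q: "q = 2 ^ e" and H: "hermitian_function_field q \<iota> x y"
    and a: "primitive_root_of_unity (q ^ 2 - 1) a" and c: "c = a + a ^ q"
    and \<sigma>: "constant_automorphism \<iota> \<sigma>"
    and \<sigma>x: "\<sigma> x = \<iota> a * x / (\<iota> (a ^ (q + 1)) * y + \<iota> c)"
    and \<sigma>y: "\<sigma> y = 1 / (\<iota> (a ^ (q + 1)) * y + \<iota> c)"
  obtains u v where "v ^ q + v = u ^ (q + 1)" "generated_field (range \<iota> \<union> {u, v}) = UNIV"
    "\<sigma> u = \<iota> (a ^ (q - 1)) * u" "\<sigma> v = v"
proof -
  have \<iota>: "field_hom \<iota>" and cardk: "card (UNIV :: 'k set) = q ^ 2" and tr: "transcendental_over \<iota> x"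
    and curve: "y ^ q + y = x ^ (q + 1)" and gen: "generated_field (range \<iota> \<union> {x, y}) = UNIV"
    using H by (auto simp: hermitian_function_field_def)
  note s = field_hom_simps[OF \<iota>]
  have \<sigma>h: "field_hom \<sigma>" and \<sigma>\<iota>: "\<And>b. \<sigma> (\<iota> b) = \<iota> b" using \<sigma> by (auto simp: constant_automorphism_def)
  note \<sigma>s = field_hom_simps[OF \<sigma>h]
  have q2: "q \<ge> 2" using e q by (metis one_le_numeral power_increasing power_one_right)
  have "card (UNIV :: 'k set) = 2 ^ (e * 2)" by (simp add: cardk q power_mult)
  then have k2: "(1 :: 'k) + 1 = 0" by (rule char2_of_card)
  have "\<iota> (1 + 1) = \<iota> 0" using k2 by (rule arg_cong)
  then have h2: "(1 :: 'h) + 1 = 0" unfolding s .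
  have dbl: "z + z = 0" for z :: 'h using h2 by (metis distrib_left mult.right_neutral mult_zero_right)
  have frobk: "(z + w) ^ q = z ^ q + w ^ q" for z w :: 'k unfolding q by (rule power_char2[OF k2])
  have frob: "(z + w) ^ q = z ^ q + w ^ q" for z w :: 'h unfolding q by (rule power_char2[OF h2])
  have qq: "q\<^sup>2 - 1 = (q - 1) * (q + 1)" by (simp add: power2_eq_square algebra_simps)
  have aN: "a ^ (q\<^sup>2 - 1) = 1" using a by (auto simp: primitive_root_of_unity_def)
  have "q\<^sup>2 - 1 > 0" using a by (auto simp: primitive_root_of_unity_def)
  then have a0: "a \<noteq> 0" using aN by (metis zero_neq_one zero_power)
  have aqq: "(a ^ q) ^ q = a"
  proof -
    have "(a ^ q) ^ q = a ^ (Suc (q\<^sup>2 - 1))" using q2 by (simp add: power2_eq_square flip: power_mult)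
    then show ?thesis using aN by simp
  qed
  \<comment> \<open>In characteristic 2, c = 0 would mean a^q = a, and the order q^2 - 1 of a would
    divide q - 1.\<close>
  have c0: "c \<noteq> 0"
  proof
    assume "c = 0"
    then have "a ^ q = - a" using c by (simp add: eq_neg_iff_add_eq_0 add.commute)
    moreover have "a + a = 0" using k2 by (metis distrib_left mult.right_neutral mult_zero_right)
    then have "- a = a" by (rule minus_unique)
    ultimately have "a * a ^ (q - 1) = a * 1" using q2 by (simp flip: power_Suc)
    then have "a ^ (q - 1) = 1" using a0 by simp
    then have "q\<^sup>2 - 1 dvd q - 1" using primitive_root_power_eq_1[OF a] by blast
    then have "(q - 1) * (q + 1) \<le> q - 1" using q2 unfolding qq by (intro dvd_imp_le) auto
    then have "(q - 1) * (q + 1) \<le> (q - 1) * 1" by (simp only: mult_1_right)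
    then show False using q2 unfolding mult_le_cancel1 by simp
  qed
  \<comment> \<open>The q-Frobenius exchanges a and a^q, so c lies in the field with q elements.
    Hence c is a norm: writing c = a^k, the exponent k is divisible by q + 1, which provides g with
    g^(q+1) = c.\<close>
  have cq: "c ^ q = c" unfolding c frobk aqq by (rule add.commute)
  obtain k where k: "c = a ^ k" using primitive_root_generates[of a c] a c0 cardk by metis
  have "c ^ (q - 1) = 1"
  proof -
    have "c * c ^ (q - 1) = c * 1" using cq q2 by (simp flip: power_Suc)
    then show ?thesis using c0 by simp
  qed
  then have "q\<^sup>2 - 1 dvd k * (q - 1)" using primitive_root_power_eq_1[OF a] k by (simp flip: power_mult)
  then have "(q - 1) * (q + 1) dvd (q - 1) * k" by (simp only: qq mult.commute)
  moreover have "q - 1 \<noteq> 0" using q2 by simp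
  ultimately have "q + 1 dvd k" using dvd_times_left_cancel_iff by blast
  then obtain k' where "k = (q + 1) * k'" by blast
  define g where "g = \<iota> (a ^ k')"
  define \<alpha> where "\<alpha> = \<iota> a"
  define \<alpha>' where "\<alpha>' = \<iota> (a ^ q)"
  define \<kappa> where "\<kappa> = \<iota> c"
  have "(a ^ k') ^ (q + 1) = c" unfolding k \<open>k = _\<close> power_mult[symmetric] by (simp only: mult.commute)
  then have gq: "g ^ (q + 1) = \<kappa>" unfolding g_def \<kappa>_def by (simp only: s(7)[symmetric])
  have \<alpha>: "\<alpha> ^ q = \<alpha>'" "\<alpha>' ^ q = \<alpha>" "\<kappa> = \<alpha> + \<alpha>'" "\<alpha> \<noteq> 0" "\<kappa> \<noteq> 0" "\<kappa> ^ q = \<kappa>"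
  proof -
    show "\<alpha> ^ q = \<alpha>'" unfolding \<alpha>_def \<alpha>'_def s(7) ..
    show "\<alpha>' ^ q = \<alpha>" unfolding \<alpha>_def \<alpha>'_def s(7)[symmetric] aqq ..
    show "\<kappa> = \<alpha> + \<alpha>'" unfolding \<alpha>_def \<alpha>'_def \<kappa>_def c s(2) ..
    show "\<alpha> \<noteq> 0" "\<kappa> \<noteq> 0" unfolding \<alpha>_def \<kappa>_def s(11) by (rule a0, rule c0)
    show "\<kappa> ^ q = \<kappa>" unfolding \<kappa>_def s(7)[symmetric] cq ..
  qed
  have b: "\<iota> (a ^ (q + 1)) = \<alpha> * \<alpha>'" by (simp add: \<alpha>_def \<alpha>'_def s)
  have g0: "g \<noteq> 0" using gq \<alpha>(5) by auto
  have x0: "x \<noteq> 0"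
  proof
    assume "x = 0"
    then have "(\<Sum>i\<in>{1}. \<iota> 1 * x ^ i) = 0" by simp
    from transcendental_sum_eq_0[OF \<iota> tr _ this, of 1] show False by simp
  qed
  \<comment> \<open>D is the common denominator of \<sigma>. The factor g in X is chosen to give a
    Fermat model U^(q+1) + X^(q+1) = V^(q+1). A and B span the eigenspace of U and X; their
    coefficients let the mixed terms of A^q B + A B^q cancel in pairs.\<close>
  define D where "D = \<alpha> * \<alpha>' * y + \<kappa>"
  define U where "U = \<alpha>' * y + 1"
  define V where "V = \<alpha> * y + 1"
  define X where "X = g * x"
  define A where "A = U + X"
  define B where "B = \<alpha> * U + \<alpha>' * X"
  have \<sigma>x': "\<sigma> x = \<alpha> * x / D" and \<sigma>y': "\<sigma> y = 1 / D"
    using \<sigma>x \<sigma>y b by (simp_all add: D_def \<alpha>_def \<kappa>_def)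
  have D0: "D \<noteq> 0"
  proof
    assume "D = 0"
    then have "\<sigma> x = 0" using \<sigma>x' by simp
    then show False using x0 \<sigma>s(11) by blast
  qed
  have \<sigma>c: "\<sigma> \<alpha> = \<alpha>" "\<sigma> \<alpha>' = \<alpha>'" "\<sigma> g = g" by (simp_all add: \<alpha>_def \<alpha>'_def g_def \<sigma>\<iota>)
  have \<alpha>\<kappa>: "\<alpha>' + \<kappa> = \<alpha>" "\<alpha> + \<kappa> = \<alpha>'" unfolding \<alpha>(3) using dbl[of \<alpha>] dbl[of \<alpha>']
    by (metis add.assoc add.commute add.right_neutral)+
  have \<sigma>U: "\<sigma> U = \<alpha> * U / D"
  proof -
    have "\<sigma> U = (\<alpha>' + D) / D" using D0 by (simp add: U_def \<sigma>s \<sigma>y' \<sigma>c add_divide_distrib)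
    also have "\<alpha>' + D = \<alpha> * \<alpha>' * y + (\<alpha>' + \<kappa>)" by (simp add: D_def ac_simps)
    also have "\<dots> = \<alpha> * U" unfolding \<alpha>\<kappa> by (simp add: U_def algebra_simps)
    finally show ?thesis .
  qed
  have \<sigma>V: "\<sigma> V = \<alpha>' * V / D"
  proof -
    have "\<sigma> V = (\<alpha> + D) / D" using D0 by (simp add: V_def \<sigma>s \<sigma>y' \<sigma>c add_divide_distrib)
    also have "\<alpha> + D = \<alpha> * \<alpha>' * y + (\<alpha> + \<kappa>)" by (simp add: D_def ac_simps)
    also have "\<dots> = \<alpha>' * V" unfolding \<alpha>\<kappa> by (simp add: V_def algebra_simps)
    finally show ?thesis .
  qed
  have \<sigma>X: "\<sigma> X = \<alpha> * X / D" by (simp add: X_def \<sigma>s \<sigma>x' \<sigma>c)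
  have \<sigma>A: "\<sigma> A = \<alpha> * A / D" by (simp add: A_def \<sigma>s \<sigma>U \<sigma>X add_divide_distrib distrib_left)
  have \<sigma>B: "\<sigma> B = \<alpha> * B / D" by (simp add: B_def \<sigma>s \<sigma>U \<sigma>X \<sigma>c add_divide_distrib distrib_left ac_simps)
  \<comment> \<open>B = 0 would make y a polynomial of degree at most 1 in x over k, and the curve
    equation would become a polynomial relation for x with nonzero coefficient at x^(q+1).\<close>
  have B0: "B \<noteq> 0"
  proof
    assume B0: "B = 0"
    have \<alpha>'0: "\<alpha>' \<noteq> 0" using \<alpha>(2,4) q2 by auto
    define l0 where "l0 = inverse (a ^ q)"
    define l1 where "l1 = a ^ k' * inverse a"
    have "\<alpha> * \<alpha>' * y = - (\<alpha> + \<alpha>' * X)"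
      using B0 by (simp add: B_def U_def eq_neg_iff_add_eq_0 algebra_simps)
    moreover have "- z = z" for z :: 'h using dbl[of z] by (rule minus_unique)
    ultimately have "\<alpha> * \<alpha>' * y = \<alpha> + \<alpha>' * X" by simp
    then have y: "y = \<iota> l0 + \<iota> l1 * x"
      using \<alpha>'0 \<alpha>(4) by (simp add: l0_def l1_def s X_def g_def \<alpha>_def \<alpha>'_def field_simps)
    have "y ^ q + y = \<iota> (l0 ^ q + l0) + \<iota> l1 * x + \<iota> (l1 ^ q) * x ^ q"
      unfolding y frob by (simp add: s power_mult_distrib algebra_simps)
    then have "\<iota> (l0 ^ q + l0) + \<iota> l1 * x + \<iota> (l1 ^ q) * x ^ q - x ^ (q + 1) = 0" using curve by simp
    moreover define co where "co i = (if i = 0 then l0 ^ q + l0 else if i = 1 then l1 else if i = q then l1 ^ q else - 1)" for i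
    have "(\<Sum>i\<in>{0, 1, q, q + 1}. \<iota> (co i) * x ^ i)
        = \<iota> (l0 ^ q + l0) + \<iota> l1 * x + \<iota> (l1 ^ q) * x ^ q - x ^ (q + 1)"
      using q2 by (simp add: co_def s add.assoc)
    ultimately have "(\<Sum>i\<in>{0, 1, q, q + 1}. \<iota> (co i) * x ^ i) = 0" by simp
    from transcendental_sum_eq_0[OF \<iota> tr _ this, of "q + 1"] show False using q2 by (simp add: co_def)
  qed
  have AB: "A ^ q * B + A * B ^ q = \<kappa> * V ^ (q + 1)"
  proof -
    have "A ^ q = U ^ q + X ^ q" "B ^ q = \<alpha>' * U ^ q + \<alpha> * X ^ q"
      unfolding A_def B_def frob power_mult_distrib \<alpha> by simp_all
    then have "A ^ q * B + A * B ^ q = \<kappa> * (U ^ (q + 1) + X ^ (q + 1))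
        + (\<alpha>' * U ^ q * X + \<alpha>' * U ^ q * X) + (\<alpha> * X ^ q * U + \<alpha> * X ^ q * U)"
      unfolding A_def B_def \<alpha>(3) by (simp add: algebra_simps)
    then have 1: "A ^ q * B + A * B ^ q = \<kappa> * (U ^ (q + 1) + X ^ (q + 1))" unfolding dbl by simp
    have Uq: "U ^ q = \<alpha> * y ^ q + 1" "V ^ q = \<alpha>' * y ^ q + 1"
      unfolding U_def V_def frob power_mult_distrib \<alpha> by simp_all
    have "X ^ (q + 1) = \<kappa> * (y ^ q + y)" unfolding X_def power_mult_distrib gq curve ..
    then have "U ^ (q + 1) + X ^ (q + 1) = V ^ (q + 1) + (\<alpha> * y ^ q + \<alpha> * y ^ q) + (\<alpha>' * y + \<alpha>' * y)"
      using Uq unfolding \<alpha>(3) by (simp add: U_def V_def algebra_simps)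
    then show ?thesis using 1 unfolding dbl by simp
  qed
  define v where "v = A / B"
  \<comment> \<open>The factor \<kappa>/g has (q+1)-st power \<kappa>^2/\<kappa> = \<kappa>, which
    is the constant in \<open>AB\<close>.\<close>
  define u where "u = \<kappa> * V / (g * B)"
  have "v ^ q + v = u ^ (q + 1)"
  proof -
    have "v ^ q + v = (A ^ q * B + A * B ^ q) / B ^ (q + 1)"
      using B0 by (simp add: v_def power_divide add_divide_distrib)
    also have "\<dots> = \<kappa> * V ^ (q + 1) / B ^ (q + 1)" unfolding AB ..
    also have "\<dots> = u ^ (q + 1)"
    proof -
      have "u ^ (q + 1) = \<kappa> ^ (q + 1) * V ^ (q + 1) / (\<kappa> * B ^ (q + 1))"
        unfolding u_def power_divide power_mult_distrib gq ..
      also have "\<kappa> ^ (q + 1) = \<kappa> * \<kappa>" using \<alpha>(6) by simp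
      finally show ?thesis using \<alpha>(5) by simp
    qed
    finally show ?thesis .
  qed
  moreover have "\<sigma> v = v"
    using D0 \<alpha>(4) by (simp add: v_def \<sigma>s \<sigma>A \<sigma>B)
  moreover have "\<sigma> u = \<iota> (a ^ (q - 1)) * u"
  proof -
    have "a * a ^ (q - 1) = a ^ q" using q2 by (simp flip: power_Suc)
    then have "\<alpha> * \<iota> (a ^ (q - 1)) = \<alpha>'" unfolding \<alpha>_def \<alpha>'_def by (simp flip: s(3))
    moreover have "\<sigma> \<kappa> = \<kappa>" by (simp add: \<kappa>_def \<sigma>\<iota>)
    then have "\<sigma> u = \<kappa> * (\<alpha>' * V / D) / (g * (\<alpha> * B / D))" by (simp add: u_def \<sigma>s \<sigma>V \<sigma>B \<sigma>c)
    then have "\<sigma> u = \<kappa> * (\<alpha>' * V) / (g * (\<alpha> * B))" using D0 by simp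
    ultimately show ?thesis using \<alpha>(4) by (auto simp: u_def)
  qed
  moreover have "generated_field (range \<iota> \<union> {u, v}) = UNIV"
  proof -
    define K where "K = generated_field (range \<iota> \<union> {u, v})"
    have Kf: "is_subfield K" unfolding K_def by (rule is_subfield_generated_field)
    have KI: "range \<iota> \<union> {u, v} \<subseteq> K" unfolding K_def by (rule generated_field_superset)
    then have K: "\<alpha> \<in> K" "\<alpha>' \<in> K" "g \<in> K" "\<kappa> \<in> K" "u \<in> K" "v \<in> K" "1 \<in> K"
      using subring_1[OF subfield_subring[OF Kf]] by (auto simp: \<alpha>_def \<alpha>'_def g_def \<kappa>_def)
    note kc = subring_closed(3-7)[OF subfield_subring[OF Kf]] subfield_divide[OF Kf]
    \<comment> \<open>Solving back: v gives X/B and U/B, u gives V/B. Since \<alpha> U + \<alpha>' V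
      is the constant \<kappa>, also 1/B is obtained, and with it x and y.\<close>
    have "\<alpha> * A + B = \<kappa> * X + (\<alpha> * U + \<alpha> * U)" unfolding A_def B_def \<alpha>(3) by (simp add: algebra_simps)
    then have "X / B = (\<alpha> * v + 1) / \<kappa>" unfolding dbl v_def using B0 \<alpha>(5) by (simp add: field_simps)
    then have XB: "X / B \<in> K" using K by (auto intro!: kc)
    have "U / B = v - X / B" by (simp add: v_def A_def add_divide_distrib)
    then have UB: "U / B \<in> K" using K XB by (auto intro!: kc)
    have "V / B = g * u / \<kappa>" using g0 \<alpha>(5) by (simp add: u_def)
    then have VB: "V / B \<in> K" using K by (auto intro!: kc)
    have "\<alpha> * U + \<alpha>' * V = \<kappa> + (\<alpha> * \<alpha>' * y + \<alpha> * \<alpha>' * y)" unfolding U_def V_def \<alpha>(3) by (simp add: algebra_simps)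
    then have "1 / B = (\<alpha> * (U / B) + \<alpha>' * (V / B)) / \<kappa>" unfolding dbl using B0 \<alpha>(5) by (simp add: field_simps)
    then have "1 / B \<in> K" using K UB VB by (metis kc(4,2,6))
    then have BK: "B \<in> K" using subfield_inverse[OF Kf, of "1 / B"] by simp
    have "x = (X / B) * B / g" using B0 g0 by (simp add: X_def)
    then have xK: "x \<in> K" using XB BK K by (metis kc(2,6))
    have "U + V = \<kappa> * y + (1 + 1)" unfolding U_def V_def \<alpha>(3) by (simp add: algebra_simps)
    then have "y = (U / B + V / B) * B / \<kappa>" unfolding dbl using B0 \<alpha>(5) by (simp add: field_simps)
    then have yK: "y \<in> K" using UB VB BK K by (metis kc(2,4,6))
    have "generated_field (range \<iota> \<union> {x, y}) \<subseteq> K"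
      by (rule generated_field_minimal[OF Kf]) (use KI xK yK in auto)
    then show ?thesis using gen K_def by blast
  qed
  ultimately show ?thesis using that by blast
qed

theorem theorem5p2:
  fixes q m e :: nat
    and \<iota> :: "'k::field \<Rightarrow> 'h::field"
    and x y :: 'h
    and a c :: 'k
    and \<sigma> :: "'h \<Rightarrow> 'h"
    and G :: "('h \<Rightarrow> 'h) set"
  assumes "e \<ge> 1" and "q = 2 ^ e"
    and "hermitian_function_field q \<iota> x y"
    and "primitive_root_of_unity (q ^ 2 - 1) a"
    and "c = a + a ^ q"
    and "constant_automorphism \<iota> \<sigma>"
    and "\<sigma> x = \<iota> a * x / (\<iota> (a ^ (q + 1)) * y + \<iota> c)"
    and "\<sigma> y = 1 / (\<iota> (a ^ (q + 1)) * y + \<iota> c)"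
    and "m > 0" and "m dvd q + 1"
    and "G = generate (aut_group \<iota>) {\<sigma> [^]\<^bsub>aut_group \<iota>\<^esub> ((q + 1) div m)}"
  shows "rat_of_int (genus \<iota> (fixed_field G)) =
           (of_nat q - 1) * (of_nat q + 1 - of_nat m) / (2 * of_nat m)"
proof -
  obtain u v where uv: "v ^ q + v = u ^ (q + 1)" "generated_field (range \<iota> \<union> {u, v}) = UNIV"
    "\<sigma> u = \<iota> (a ^ (q - 1)) * u" "\<sigma> v = v"
    using hermitian_diagonalization[OF assms(1-8)] by metis
  have \<iota>: "field_hom \<iota>" and cardk: "card (UNIV :: 'k set) = q ^ 2" and tr: "transcendental_over \<iota> x"
    using assms(3) by (auto simp: hermitian_function_field_def)
  note s = field_hom_simps[OF \<iota>]
  have q2: "q \<ge> 2" using assms(1,2) by (metis one_le_numeral power_increasing power_one_right)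
  have fin: "finite (UNIV :: 'k set)" using cardk q2 by (intro card_ge_0_finite) simp
  have "card (UNIV :: 'k set) = 2 ^ (e * 2)" by (simp add: cardk assms(2) power_mult)
  then have k2: "(1 :: 'k) + 1 = 0" by (rule char2_of_card)
  have "\<iota> (1 + 1) = \<iota> 0" using k2 by (rule arg_cong)
  then have h2: "(1 :: 'h) + 1 = 0" unfolding s .
  define n where "n = (q + 1) div m"
  have nm: "q + 1 = m * n" using assms(10) by (simp add: n_def)
  define \<tau> where "\<tau> = \<sigma> ^^ n"
  have \<tau>: "constant_automorphism \<iota> \<tau>" unfolding \<tau>_def by (rule constant_automorphism_funpow[OF assms(6)])
  have \<tau>h: "field_hom \<tau>" and \<tau>\<iota>: "\<And>b. \<tau> (\<iota> b) = \<iota> b" using \<tau> by (auto simp: constant_automorphism_def)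
  note \<tau>s = field_hom_simps[OF \<tau>h]
  have fixed: "fixed_field G = {z. \<tau> z = z}"
    unfolding assms(11) pow_aut_group n_def[symmetric] \<tau>_def[symmetric] by (rule fixed_field_generate[OF \<tau>])
  \<comment> \<open>The factor by which \<sigma>^n multiplies u; as (q - 1) n m = q^2 - 1, it is a
    primitive m-th root of unity.\<close>
  define \<zeta> where "\<zeta> = a ^ ((q - 1) * n)"
  have \<sigma>h: "field_hom \<sigma>" and \<sigma>\<iota>: "\<And>b. \<sigma> (\<iota> b) = \<iota> b" using assms(6) by (auto simp: constant_automorphism_def)
  have "(\<sigma> ^^ k) u = \<iota> (a ^ (q - 1)) ^ k * u" for k
    by (induction k) (simp_all add: field_hom_simps[OF \<sigma>h] \<sigma>\<iota> uv(3) mult.assoc)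
  then have \<tau>u: "\<tau> u = \<iota> \<zeta> * u" by (simp add: \<tau>_def \<zeta>_def s power_mult)
  have \<tau>v: "\<tau> v = v" unfolding \<tau>_def by (induction n) (use uv(4) in auto)
  have qq: "q\<^sup>2 - 1 = (q - 1) * n * m"
  proof -
    have "q\<^sup>2 - 1 = (q - 1) * (q + 1)" by (simp add: power2_eq_square algebra_simps)
    then show ?thesis unfolding nm by (simp only: ac_simps)
  qed
  have n0: "n > 0" using nm by (cases n) auto
  have \<zeta>m: "\<zeta> ^ m = 1"
    using assms(4) unfolding \<zeta>_def qq by (auto simp: primitive_root_of_unity_def simp flip: power_mult)
  have \<zeta>i: "\<zeta> ^ i \<noteq> 1" if "0 < i" "i < m" for i
  proof
    assume "\<zeta> ^ i = 1"
    then have "q\<^sup>2 - 1 dvd (q - 1) * n * i"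
      using primitive_root_power_eq_1[OF assms(4)] by (simp add: \<zeta>_def flip: power_mult)
    then have "(q - 1) * n * m dvd (q - 1) * n * i" unfolding qq .
    moreover have "(q - 1) * n \<noteq> 0" using q2 n0 by simp
    ultimately have "m dvd i" using dvd_times_left_cancel_iff by blast
    then show False using that by (auto dest: dvd_imp_le)
  qed
  define F where "F = generated_field (range \<iota> \<union> {u ^ m, v})"
  have Ff: "is_subfield F" unfolding F_def by (rule is_subfield_generated_field)
  have FI: "range \<iota> \<union> {u ^ m, v} \<subseteq> F" unfolding F_def by (rule generated_field_superset)
  have "is_subfield {z. \<tau> z = z}" by (simp add: is_subfield_def is_subring_def \<tau>s)
  moreover have "\<tau> (u ^ m) = u ^ m"
    using \<zeta>m by (simp add: \<tau>s \<tau>u power_mult_distrib flip: s(7)) (simp add: s)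
  ultimately have Fsub: "F \<subseteq> {z. \<tau> z = z}"
    unfolding F_def by (intro generated_field_minimal) (auto simp: \<tau>\<iota> \<tau>v)
  \<comment> \<open>m divides the odd number q + 1, so it is invertible in characteristic 2, as the
    averaging in \<open>fixed_points_kummer\<close> demands.\<close>
  have "odd m"
  proof
    assume "even m"
    then have "even (q + 1)" using assms(10) dvd_trans by blast
    then show False using assms(1,2) by simp
  qed
  then obtain k where "m = 2 * k + 1" by (rule oddE)
  then have "of_nat m = (1 + 1) * of_nat k + (1 :: 'h)" by simp
  then have m0: "of_nat m \<noteq> (0 :: 'h)" unfolding h2 by simp
  have genF: "generated_field (F \<union> {u}) = UNIV"
  proof -
    have "range \<iota> \<union> {u, v} \<subseteq> generated_field (F \<union> {u})"
      using FI generated_field_superset[of "F \<union> {u}"] by blast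
    then have "generated_field (range \<iota> \<union> {u, v}) \<subseteq> generated_field (F \<union> {u})"
      by (rule generated_field_minimal[OF is_subfield_generated_field])
    then show ?thesis using uv(2) by blast
  qed
  have "z \<in> F" if z: "\<tau> z = z" for z
  proof (rule fixed_points_kummer[OF Ff \<tau>h _ genF _ assms(9) m0 _ \<tau>u _ _ z])
    show "\<tau> w = w" if "w \<in> F" for w using Fsub that by blast
    show "u ^ m \<in> F" "\<iota> \<zeta> \<in> F" using FI by auto
    have p: "\<iota> \<zeta> ^ i = 1 \<longleftrightarrow> \<zeta> ^ i = 1" for i using s(10)[of "\<zeta> ^ i" 1] by (simp add: s)
    show "\<iota> \<zeta> ^ i \<noteq> 1" if "0 < i" "i < m" for i using p \<zeta>i that by auto
    show "\<iota> \<zeta> ^ m = 1" using p \<zeta>m by simp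
  qed
  then have FG: "fixed_field G = F" using Fsub fixed by blast
  \<comment> \<open>With t = u^m the Hermitian equation reads v^q + v = t^n, and n is prime to q
    because it divides q + 1.\<close>
  interpret C: artin_schreier_curve \<iota> q n e "u ^ m" v F
  proof
    show "field_hom \<iota>" "finite (UNIV :: 'k set)" "(1 :: 'h) + 1 = 0" "e \<ge> 1" "q = 2 ^ e"
      using \<iota> fin h2 assms by auto
    have "n dvd q + 1" using nm by simp
    then have "d dvd 1" if "d dvd n" "d dvd q" for d
      using that by (metis dvd_add_right_iff dvd_trans)
    then show "coprime n q" by (rule coprimeI)
    show "v ^ q + v = (u ^ m) ^ n" using uv(1) unfolding nm power_mult .
    show "F = generated_field (range \<iota> \<union> {u ^ m, v})" by (rule F_def)
    show "transcendental_over \<iota> (u ^ m)"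
      by (rule transcendental_of_generators[OF \<iota> fin transcendental_infinite[OF \<iota> tr] uv(2) assms(9) q2 uv(1)])
  qed
  \<comment> \<open>Makes the division by 2 in the genus formula exact; q + 1 - m = m (n - 1) then
    gives the claimed shape.\<close>
  have "odd n"
  proof
    assume "even n"
    then have "even (q + 1)" using nm by simp
    then show False using assms(1,2) by simp
  qed
  then have "even ((n - 1) * (q - 1))" using n0 by simp
  then have "2 * ((n - 1) * (q - 1) div 2) = (n - 1) * (q - 1)" by simp
  then have "rat_of_nat (2 * ((n - 1) * (q - 1) div 2)) = rat_of_nat ((n - 1) * (q - 1))" by (rule arg_cong)
  then have "2 * rat_of_int (genus \<iota> (fixed_field G)) = (of_nat n - 1) * (of_nat q - 1)"
    using n0 q2 unfolding FG C.genus_artin_schreier_curve by (simp add: of_nat_diff)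
  then have "rat_of_int (genus \<iota> (fixed_field G)) = (of_nat n - 1) * (of_nat q - 1) / 2" by simp
  moreover have "rat_of_nat q + 1 = of_nat m * of_nat n" using arg_cong[OF nm, of rat_of_nat] by simp
  then have "rat_of_nat q + 1 - of_nat m = of_nat m * (of_nat n - 1)" by (simp add: algebra_simps)
  ultimately show ?thesis using assms(9) by simp
qed

end
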